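(* Let $\Lambda$ and $\Lambda'$ be finite-dimensional elementary $k$-algebras of rank $2$ with complete sets of primitive orthogonal idempotents $1=e_1+e_2\in\Lambda$ and $1=e'_1+e'_2\in\Lambda'$, such that $e_2\Lambda e_1=0$ and $e'_1\Lambda'e'_2=0$ (equivalently, $\Sigma(\Lambda)\in\mathsf{Fan}^{+-}_{\rm sc}(2)$ and $\Sigma(\Lambda')\in\mathsf{Fan}^{-+}_{\rm sc}(2)$). Then there exists a finite-dimensional elementary $k$-algebra $\Gamma$ of rank $2$ (with a complete set of primitive orthogonal idempotents $1=f_1+f_2$) such that $\Sigma(\Gamma)=\Sigma(\Lambda)\ast\Sigma(\Lambda')$.
   Context: $k$ is a field. Elementary: $\Lambda/J_\Lambda$ is isomorphic to a product of copies of $k$. The $g$-fan $\Sigma(\Lambda)$ is the set of cones $\operatorname{cone}\{[T_1],\dots,[T_m]\}$ for basic 2-term presilting complexes $T=\bigoplus T_i$ (indecomposable $T_i$) in $K^b(\operatorname{proj}\Lambda)$, where 2-term means concentrated in degrees $-1,0$, presilting means $\operatorname{Hom}(T,T[\ell])=0$ for $\ell>0$, and $[T]=[T^0]-[T^{-1}]$; it is viewed in $\mathbb{R}^2$ via $[e_1\Lambda]\mapsto(1,0)$, $[e_2\Lambda]\mapsto(0,1)$ (similarly for $\Lambda'$ and $\Gamma$ with their idempotents). $\mathsf{Fan}^{+-}_{\rm sc}(2)$ (resp. $\mathsf{Fan}^{-+}_{\rm sc}(2)$) denotes sign-coherent fans of rank 2 containing $\sigma_{-+}=\operatorname{cone}\{(-1,0),(0,1)\}$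 (resp. $\sigma_{+-}=\operatorname{cone}\{(1,0),(0,-1)\}$). For $\Sigma\in\mathsf{Fan}^{+-}_{\rm sc}(2)$ and $\Sigma'\in\mathsf{Fan}^{-+}_{\rm sc}(2)$, $\Sigma\ast\Sigma'$ is the fan with rays $\Sigma_1\cup\Sigma'_1$ and 2-dimensional cones $(\Sigma_2\setminus\{\sigma_{-+}\})\cup(\Sigma'_2\setminus\{\sigma_{+-}\})$ (together with their faces). *)

theory Defs
  imports Complex_Main "HOL-Algebra.Ring"
begin

definition kalg :: "'a ring \<Rightarrow> ('k::field \<Rightarrow> 'a \<Rightarrow> 'a) \<Rightarrow> bool" where
  "kalg R sm \<longleftrightarrow> ring R
     \<and> (\<forall>c. \<forall>x\<in>carrier R. sm c x \<in> carrier R)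
     \<and> (\<forall>c. \<forall>x\<in>carrier R. \<forall>y\<in>carrier R. sm c (x \<oplus>\<^bsub>R\<^esub> y) = sm c x \<oplus>\<^bsub>R\<^esub> sm c y)
     \<and> (\<forall>c d. \<forall>x\<in>carrier R. sm (c + d) x = sm c x \<oplus>\<^bsub>R\<^esub> sm d x)
     \<and> (\<forall>c d. \<forall>x\<in>carrier R. sm (c * d) x = sm c (sm d x))
     \<and> (\<forall>x\<in>carrier R. sm 1 x = x)
     \<and> (\<forall>c. \<forall>x\<in>carrier R. \<forall>y\<in>carrier R.
          sm c (x \<otimes>\<^bsub>R\<^esub> y) = sm c x \<otimes>\<^bsub>R\<^esub> y \<and> sm c (x \<otimes>\<^bsub>R\<^esub> y) = x \<otimes>\<^bsub>R\<^esub> sm c y)"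

definition fin_dim :: "'a ring \<Rightarrow> ('k::field \<Rightarrow> 'a \<Rightarrow> 'a) \<Rightarrow> bool" where
  "fin_dim R sm \<longleftrightarrow> (\<exists>B. finite B \<and> B \<subseteq> carrier R \<and>
     (\<forall>x\<in>carrier R. \<exists>f. x = finsum R (\<lambda>b. sm (f b) b) B))"

definition right_ideal :: "'a ring \<Rightarrow> 'a set \<Rightarrow> bool" where
  "right_ideal R I \<longleftrightarrow> I \<subseteq> carrier R \<and> \<zero>\<^bsub>R\<^esub> \<in> I
     \<and> (\<forall>x\<in>I. \<forall>y\<in>I. x \<oplus>\<^bsub>R\<^esub> y \<in> I) \<and> (\<forall>x\<in>I. \<ominus>\<^bsub>R\<^esub> x \<in> I)
     \<and> (\<forall>x\<in>I. \<forall>a\<in>carrier R. x \<otimes>\<^bsub>R\<^esub> a \<in> I)"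

definition max_right_ideal :: "'a ring \<Rightarrow> 'a set \<Rightarrow> bool" where
  "max_right_ideal R I \<longleftrightarrow> right_ideal R I \<and> I \<noteq> carrier R
     \<and> (\<forall>I'. right_ideal R I' \<and> I \<subseteq> I' \<longrightarrow> I' = I \<or> I' = carrier R)"

definition jacobson :: "'a ring \<Rightarrow> 'a set" where
  "jacobson R = carrier R \<inter> \<Inter>{I. max_right_ideal R I}"

definition khom :: "'a ring \<Rightarrow> ('k::field \<Rightarrow> 'a \<Rightarrow> 'a) \<Rightarrow> ('a \<Rightarrow> 'k) \<Rightarrow> bool" where
  "khom R sm \<phi> \<longleftrightarrow> (\<forall>x\<in>carrier R. \<forall>y\<in>carrier R. \<phi> (x \<oplus>\<^bsub>R\<^esub> y) = \<phi> x + \<phi> y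
        \<and> \<phi> (x \<otimes>\<^bsub>R\<^esub> y) = \<phi> x * \<phi> y)
     \<and> \<phi> \<one>\<^bsub>R\<^esub> = 1 \<and> (\<forall>c. \<forall>x\<in>carrier R. \<phi> (sm c x) = c * \<phi> x)"

text \<open>Elementary of rank 2: \<open>R/J_R\<close> is isomorphic to \<open>k \<times> k\<close> as a k-algebra,
  i.e. there is a surjective k-algebra map \<open>R \<rightarrow> k \<times> k\<close> with kernel \<open>J_R\<close>.\<close>
definition elementary2 :: "'a ring \<Rightarrow> ('k::field \<Rightarrow> 'a \<Rightarrow> 'a) \<Rightarrow> bool" where
  "elementary2 R sm \<longleftrightarrow> (\<exists>\<phi>1 \<phi>2. khom R sm \<phi>1 \<and> khom R sm \<phi>2
     \<and> (\<lambda>x. (\<phi>1 x, \<phi>2 x)) ` carrier R = UNIV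
     \<and> {x\<in>carrier R. \<phi>1 x = 0 \<and> \<phi>2 x = 0} = jacobson R)"

definition idem :: "'a ring \<Rightarrow> 'a \<Rightarrow> bool" where
  "idem R e \<longleftrightarrow> e \<in> carrier R \<and> e \<otimes>\<^bsub>R\<^esub> e = e"

definition prim_idem :: "'a ring \<Rightarrow> 'a \<Rightarrow> bool" where
  "prim_idem R e \<longleftrightarrow> idem R e \<and> e \<noteq> \<zero>\<^bsub>R\<^esub> \<and>
     (\<forall>a b. idem R a \<and> idem R b \<and> a \<otimes>\<^bsub>R\<^esub> b = \<zero>\<^bsub>R\<^esub> \<and> b \<otimes>\<^bsub>R\<^esub> a = \<zero>\<^bsub>R\<^esub>
        \<and> a \<oplus>\<^bsub>R\<^esub> b = e \<longrightarrow> a = \<zero>\<^bsub>R\<^esub> \<or> b = \<zero>\<^bsub>R\<^esub>)"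

definition cpoi :: "'a ring \<Rightarrow> 'a \<Rightarrow> 'a \<Rightarrow> bool" where
  "cpoi R e1 e2 \<longleftrightarrow> prim_idem R e1 \<and> prim_idem R e2
     \<and> e1 \<otimes>\<^bsub>R\<^esub> e2 = \<zero>\<^bsub>R\<^esub> \<and> e2 \<otimes>\<^bsub>R\<^esub> e1 = \<zero>\<^bsub>R\<^esub> \<and> e1 \<oplus>\<^bsub>R\<^esub> e2 = \<one>\<^bsub>R\<^esub>"

text \<open>An object is a list of labels in {1,2}: \<open>P = \<Oplus>_j e_{P!j} R\<close>.
  Since \<open>Hom(e_i R, e_j R) = e_j R e_i\<close>, a morphism \<open>P \<rightarrow> Q\<close> is a matrix with
  entry \<open>(i,j)\<close> in \<open>e_{Q!i} R e_{P!j}\<close> (entries outside the range are zero).\<close>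

definition ev :: "'a \<Rightarrow> 'a \<Rightarrow> nat \<Rightarrow> 'a" where
  "ev e1 e2 i = (if i = 1 then e1 else e2)"

type_synonym 'a mat = "nat \<Rightarrow> nat \<Rightarrow> 'a"

definition phom :: "'a ring \<Rightarrow> 'a \<Rightarrow> 'a \<Rightarrow> nat list \<Rightarrow> nat list \<Rightarrow> 'a mat set" where
  "phom R e1 e2 P Q = {M.
     (\<forall>i<length Q. \<forall>j<length P. \<exists>x\<in>carrier R.
        M i j = ev e1 e2 (Q!i) \<otimes>\<^bsub>R\<^esub> x \<otimes>\<^bsub>R\<^esub> ev e1 e2 (P!j))
     \<and> (\<forall>i j. \<not> (i < length Q \<and> j < length P) \<longrightarrow> M i j = \<zero>\<^bsub>R\<^esub>)}"

definition mcomp :: "'a ring \<Rightarrow> nat \<Rightarrow> 'a mat \<Rightarrow> 'a mat \<Rightarrow> 'a mat" where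
  "mcomp R n N M = (\<lambda>i k. finsum R (\<lambda>j. N i j \<otimes>\<^bsub>R\<^esub> M j k) {..<n})"

definition madd :: "'a ring \<Rightarrow> 'a mat \<Rightarrow> 'a mat \<Rightarrow> 'a mat" where
  "madd R M N = (\<lambda>i j. M i j \<oplus>\<^bsub>R\<^esub> N i j)"

definition mneg :: "'a ring \<Rightarrow> 'a mat \<Rightarrow> 'a mat" where
  "mneg R M = (\<lambda>i j. \<ominus>\<^bsub>R\<^esub> M i j)"

definition mid :: "'a ring \<Rightarrow> 'a \<Rightarrow> 'a \<Rightarrow> nat list \<Rightarrow> 'a mat" where
  "mid R e1 e2 P = (\<lambda>i j. if i = j \<and> i < length P then ev e1 e2 (P!i) else \<zero>\<^bsub>R\<^esub>)"

section \<open>2-term complexes \<open>T^{-1} \<rightarrow> T^0\<close> in \<open>K^b(proj R)\<close>\<close>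

type_synonym 'a cx = "nat list \<times> nat list \<times> 'a mat"

definition c1 :: "'a cx \<Rightarrow> nat list" where "c1 T = fst T"
definition c0 :: "'a cx \<Rightarrow> nat list" where "c0 T = fst (snd T)"
definition cd :: "'a cx \<Rightarrow> 'a mat" where "cd T = snd (snd T)"

definition wf_cx :: "'a ring \<Rightarrow> 'a \<Rightarrow> 'a \<Rightarrow> 'a cx \<Rightarrow> bool" where
  "wf_cx R e1 e2 T \<longleftrightarrow> set (c1 T) \<subseteq> {1,2} \<and> set (c0 T) \<subseteq> {1,2}
     \<and> cd T \<in> phom R e1 e2 (c1 T) (c0 T)"

definition chain_map :: "'a ring \<Rightarrow> 'a \<Rightarrow> 'a \<Rightarrow> 'a cx \<Rightarrow> 'a cx \<Rightarrow> 'a mat \<times> 'a mat \<Rightarrow> bool" where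
  "chain_map R e1 e2 T T' f \<longleftrightarrow>
     fst f \<in> phom R e1 e2 (c1 T) (c1 T') \<and> snd f \<in> phom R e1 e2 (c0 T) (c0 T')
     \<and> mcomp R (length (c1 T')) (cd T') (fst f) = mcomp R (length (c0 T)) (snd f) (cd T)"

definition null_htpy :: "'a ring \<Rightarrow> 'a \<Rightarrow> 'a \<Rightarrow> 'a cx \<Rightarrow> 'a cx \<Rightarrow> 'a mat \<times> 'a mat \<Rightarrow> bool" where
  "null_htpy R e1 e2 T T' f \<longleftrightarrow> (\<exists>h\<in>phom R e1 e2 (c0 T) (c1 T').
     fst f = mcomp R (length (c0 T)) h (cd T) \<and> snd f = mcomp R (length (c1 T')) (cd T') h)"

definition homotopic :: "'a ring \<Rightarrow> 'a \<Rightarrow> 'a \<Rightarrow> 'a cx \<Rightarrow> 'a cx \<Rightarrow> 'a mat \<times> 'a mat \<Rightarrow> 'a mat \<times> 'a mat \<Rightarrow> bool" where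
  "homotopic R e1 e2 T T' f g \<longleftrightarrow>
     null_htpy R e1 e2 T T' (madd R (fst f) (mneg R (fst g)), madd R (snd f) (mneg R (snd g)))"

definition cm_comp :: "'a ring \<Rightarrow> 'a cx \<Rightarrow> 'a mat \<times> 'a mat \<Rightarrow> 'a mat \<times> 'a mat \<Rightarrow> 'a mat \<times> 'a mat" where
  "cm_comp R T' g f = (mcomp R (length (c1 T')) (fst g) (fst f), mcomp R (length (c0 T')) (snd g) (snd f))"

definition cm_id :: "'a ring \<Rightarrow> 'a \<Rightarrow> 'a \<Rightarrow> 'a cx \<Rightarrow> 'a mat \<times> 'a mat" where
  "cm_id R e1 e2 T = (mid R e1 e2 (c1 T), mid R e1 e2 (c0 T))"

definition isoK :: "'a ring \<Rightarrow> 'a \<Rightarrow> 'a \<Rightarrow> 'a cx \<Rightarrow> 'a cx \<Rightarrow> bool" where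
  "isoK R e1 e2 T T' \<longleftrightarrow> (\<exists>f g. chain_map R e1 e2 T T' f \<and> chain_map R e1 e2 T' T g
     \<and> homotopic R e1 e2 T T (cm_comp R T' g f) (cm_id R e1 e2 T)
     \<and> homotopic R e1 e2 T' T' (cm_comp R T f g) (cm_id R e1 e2 T'))"

definition zeroK :: "'a ring \<Rightarrow> 'a \<Rightarrow> 'a \<Rightarrow> 'a cx \<Rightarrow> bool" where
  "zeroK R e1 e2 T \<longleftrightarrow> null_htpy R e1 e2 T T (cm_id R e1 e2 T)"

definition dsum :: "'a ring \<Rightarrow> 'a cx \<Rightarrow> 'a cx \<Rightarrow> 'a cx" where
  "dsum R X Y = (c1 X @ c1 Y, c0 X @ c0 Y,
     (\<lambda>i j. if i < length (c0 X) \<and> j < length (c1 X) then cd X i j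
            else if length (c0 X) \<le> i \<and> length (c1 X) \<le> j
                 then cd Y (i - length (c0 X)) (j - length (c1 X))
            else \<zero>\<^bsub>R\<^esub>))"

definition zero_cx :: "'a ring \<Rightarrow> 'a cx" where
  "zero_cx R = ([], [], (\<lambda>i j. \<zero>\<^bsub>R\<^esub>))"

definition dsum_list :: "'a ring \<Rightarrow> 'a cx list \<Rightarrow> 'a cx" where
  "dsum_list R Ts = foldr (dsum R) Ts (zero_cx R)"

definition indecK :: "'a ring \<Rightarrow> 'a \<Rightarrow> 'a \<Rightarrow> 'a cx \<Rightarrow> bool" where
  "indecK R e1 e2 T \<longleftrightarrow> wf_cx R e1 e2 T \<and> \<not> zeroK R e1 e2 T
     \<and> (\<forall>X Y. wf_cx R e1 e2 X \<and> wf_cx R e1 e2 Y \<and> isoK R e1 e2 T (dsum R X Y)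
          \<longrightarrow> zeroK R e1 e2 X \<or> zeroK R e1 e2 Y)"

text \<open>\<open>Hom_K(T, T'[1]) = 0\<close>: every \<open>f : T^{-1} \<rightarrow> T'^0\<close> is null-homotopic,
  i.e. of the form \<open>d' h^{-1} + h^0 d\<close>.\<close>
definition shift_hom_zero :: "'a ring \<Rightarrow> 'a \<Rightarrow> 'a \<Rightarrow> 'a cx \<Rightarrow> 'a cx \<Rightarrow> bool" where
  "shift_hom_zero R e1 e2 T T' \<longleftrightarrow> (\<forall>f\<in>phom R e1 e2 (c1 T) (c0 T').
     \<exists>h1\<in>phom R e1 e2 (c1 T) (c1 T'). \<exists>h0\<in>phom R e1 e2 (c0 T) (c0 T').
       f = madd R (mcomp R (length (c1 T')) (cd T') h1) (mcomp R (length (c0 T)) h0 (cd T)))"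

definition presilting :: "'a ring \<Rightarrow> 'a \<Rightarrow> 'a \<Rightarrow> 'a cx \<Rightarrow> bool" where
  "presilting R e1 e2 T \<longleftrightarrow> wf_cx R e1 e2 T \<and> shift_hom_zero R e1 e2 T T"

text \<open>g-vector \<open>[T] = [T^0] - [T^{-1}]\<close> with \<open>[e_1 R] = (1,0)\<close>, \<open>[e_2 R] = (0,1)\<close>.\<close>
definition gvec :: "'a cx \<Rightarrow> real \<times> real" where
  "gvec T = (real (count_list (c0 T) 1) - real (count_list (c1 T) 1),
             real (count_list (c0 T) 2) - real (count_list (c1 T) 2))"

definition gcone :: "(real \<times> real) set \<Rightarrow> (real \<times> real) set" where
  "gcone S = {((\<Sum>v\<in>S. c v * fst v), (\<Sum>v\<in>S. c v * snd v)) | c. \<forall>v\<in>S. c v \<ge> 0}"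

definition gfan :: "'a ring \<Rightarrow> 'a \<Rightarrow> 'a \<Rightarrow> (real \<times> real) set set" where
  "gfan R e1 e2 = {gcone (set (map gvec Ts)) | Ts.
     (\<forall>T\<in>set Ts. indecK R e1 e2 T)
     \<and> (\<forall>i<length Ts. \<forall>j<length Ts. i \<noteq> j \<longrightarrow> \<not> isoK R e1 e2 (Ts!i) (Ts!j))
     \<and> presilting R e1 e2 (dsum_list R Ts)}"

definition is2d :: "(real \<times> real) set \<Rightarrow> bool" where
  "is2d C \<longleftrightarrow> (\<exists>u\<in>C. \<exists>v\<in>C. fst u * snd v - snd u * fst v \<noteq> 0)"

definition sigma_mp :: "(real \<times> real) set" where
  "sigma_mp = gcone {(-1, 0), (0, 1)}"

definition sigma_pm :: "(real \<times> real) set" where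
  "sigma_pm = gcone {(1, 0), (0, -1)}"

definition fan_star :: "(real \<times> real) set set \<Rightarrow> (real \<times> real) set set \<Rightarrow> (real \<times> real) set set" where
  "fan_star \<Sigma> \<Sigma>' = {C \<in> \<Sigma> \<union> \<Sigma>'. \<not> is2d C}
     \<union> {C \<in> \<Sigma>. is2d C \<and> C \<noteq> sigma_mp} \<union> {C \<in> \<Sigma>'. is2d C \<and> C \<noteq> sigma_pm}"

end

theory Submission
  imports "HOL-Algebra.UnivPoly" Defs
begin

text \<open>
  Let \<open>\<Gamma> = \<Lambda> \<times>\<^bsub>k\<times>k\<^esub> \<Lambda>'\<close> be the fibre product over the semisimple quotients. The map
  \<open>\<Gamma> \<rightarrow> \<Lambda>\<close> is split by \<open>x \<mapsto> (x, \<phi>\<^sub>1(x) e\<^sub>1' + \<phi>\<^sub>2(x) e\<^sub>2')\<close>, and since \<open>e\<^sub>1' \<Lambda>' e\<^sub>2' = 0\<close> the two maps are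
  mutually inverse on \<open>f\<^sub>1 \<Gamma> f\<^sub>2\<close>. Hence they identify the presilting complexes over \<open>\<Gamma>\<close> and \<open>\<Lambda>\<close>
  whose degree 0 part is a sum of copies of \<open>P\<^sub>1\<close> and whose degree -1 part is a sum of copies of
  \<open>P\<^sub>2\<close>; symmetrically for \<open>\<Lambda>'\<close> and the opposite quadrant. A presilting complex with radical
  differential has no common summand in degrees 0 and -1, so every cone lies in one of the four
  quadrants, and a quadrant in which all differentials vanish contributes just the faces of the
  cone spanned by its two unit vectors.
\<close>

section \<open>Matrices with entries in corners of a ring\<close>

text \<open>Indecomposability in K^b(proj) is tested against arbitrary decompositions up to
  homotopy, whose summands need not have the labels of a given quadrant. The two algebra maps are
  mutually inverse on one corner only, so such a decomposition, carried to the other algebra and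
  back, need not return. What makes the comparison possible is that contractibility is visible
  modulo the radical: eliminating invertible entries of the differential makes it radical without
  changing the class in K^b or the g-vector, and a complex with radical differential is contractible
  only if it is empty. The star product fits because the vanishing of e_2 Lambda e_1 puts
  \<open>sigma_mp\<close> itself into the fan of Lambda, and dually \<open>sigma_pm\<close> into
  that of Lambda'; these are the two cones that it deletes. The statement fixes the elements of
  Gamma to be sequences of scalars, so the fibre product is transported along an injection of pairs
  into sequences.\<close>

context ring
begin

lemma finsum_swap:
  assumes "finite A" "finite B" "\<And>i j. i \<in> A \<Longrightarrow> j \<in> B \<Longrightarrow> f i j \<in> carrier R"
  shows "(\<Oplus>i\<in>A. \<Oplus>j\<in>B. f i j) = (\<Oplus>j\<in>B. \<Oplus>i\<in>A. f i j)"
  using assms(1,3)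
proof (induction A rule: finite_induct)
  case empty
  then show ?case by simp
next
  case (insert a A)
  have "(\<Oplus>j\<in>B. \<Oplus>i\<in>insert a A. f i j) = (\<Oplus>j\<in>B. f a j \<oplus> (\<Oplus>i\<in>A. f i j))"
    by (rule finsum_cong') (use insert in \<open>auto simp: Pi_def\<close>)
  also have "\<dots> = (\<Oplus>j\<in>B. f a j) \<oplus> (\<Oplus>j\<in>B. \<Oplus>i\<in>A. f i j)"
    by (rule finsum_addf) (use insert in \<open>auto simp: Pi_def\<close>)
  also have "\<dots> = (\<Oplus>i\<in>insert a A. \<Oplus>j\<in>B. f i j)"
    using insert by (subst finsum_insert) (auto simp: Pi_def)
  finally show ?case by simp
qed

lemma finsum_zero_terms:
  "(\<And>j. j \<in> A \<Longrightarrow> f j = \<zero>) \<Longrightarrow> (\<Oplus>j\<in>A. f j) = \<zero>"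
  by (metis Pi_I finsum_cong' finsum_zero zero_closed)

lemma finsum_single_term:
  assumes "finite A" "a \<in> A" "f a \<in> carrier R" "\<And>j. j \<in> A \<Longrightarrow> j \<noteq> a \<Longrightarrow> f j = \<zero>"
  shows "(\<Oplus>j\<in>A. f j) = f a"
proof -
  have f: "f j \<in> carrier R" if "j \<in> A" for j
    using assms that by (cases "j = a") auto
  have "(\<Oplus>j\<in>A. f j) = (\<Oplus>j\<in>A. if a = j then f j else \<zero>)"
    by (rule finsum_cong') (use assms f in auto)
  also have "\<dots> = f a"
    by (rule finsum_singleton) (use assms f in auto)
  finally show ?thesis .
qed

lemma minus_eq_iff:
  assumes "a \<in> carrier R" "b \<in> carrier R" "c \<in> carrier R"
  shows "a \<oplus> \<ominus> b = c \<longleftrightarrow> b = a \<oplus> \<ominus> c"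
proof -
  have "a = b \<oplus> c" if "a \<oplus> \<ominus> b = c"
    using assms that[symmetric] by (simp add: r_neg r_neg1 a_ac)
  moreover have "a = b \<oplus> c" if "b = a \<oplus> \<ominus> c"
    using assms that by (simp add: a_assoc l_neg)
  moreover have "a \<oplus> \<ominus> b = c \<and> b = a \<oplus> \<ominus> c" if "a = b \<oplus> c"
    using assms that by (simp add: a_assoc r_neg) (metis a_comm a_closed a_inv_closed r_neg2 r_neg1 a_assoc l_neg r_zero r_neg)
  ultimately show ?thesis by blast
qed

end

locale idem2 = ring R for R :: "'a ring" (structure) +
  fixes e1 e2 :: 'a
  assumes e_closed: "e1 \<in> carrier R" "e2 \<in> carrier R"
    and e_idem: "e1 \<otimes> e1 = e1" "e2 \<otimes> e2 = e2"
begin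

abbreviation E :: "nat \<Rightarrow> 'a" where "E \<equiv> ev e1 e2"
abbreviation H :: "nat list \<Rightarrow> nat list \<Rightarrow> 'a mat set" where "H \<equiv> phom R e1 e2"
abbreviation mc :: "'a mat \<Rightarrow> nat \<Rightarrow> 'a mat \<Rightarrow> 'a mat" ("(_ \<star>\<^bsub>_\<^esub> _)" [71,0,70] 70)
  where "A \<star>\<^bsub>n\<^esub> B \<equiv> mcomp R n A B"
abbreviation ma :: "'a mat \<Rightarrow> 'a mat \<Rightarrow> 'a mat" (infixl "\<boxplus>" 65)
  where "A \<boxplus> B \<equiv> madd R A B"
abbreviation I :: "nat list \<Rightarrow> 'a mat" where "I \<equiv> mid R e1 e2"
abbreviation Z :: "'a mat" where "Z \<equiv> (\<lambda>i j. \<zero>)"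

text \<open>Matrices without typing or support conditions. The laws for \<open>mcomp\<close> and
  \<open>madd\<close> then hold for every inner size, and labels are tracked only where an identity
  matrix or a corner matters.\<close>

definition MC :: "'a mat set" where
  "MC = {M. \<forall>i j. M i j \<in> carrier R}"

lemma E_closed [simp]: "E i \<in> carrier R"
  by (simp add: ev_def e_closed)

lemma E_idem [simp]: "E i \<otimes> E i = E i"
  by (simp add: ev_def e_idem)

lemma E_idem_left [simp]: "x \<in> carrier R \<Longrightarrow> E i \<otimes> (E i \<otimes> x) = E i \<otimes> x"
  by (simp add: m_assoc[symmetric])

lemma MC_D [simp]: "M \<in> MC \<Longrightarrow> M i j \<in> carrier R"
  by (simp add: MC_def)

text \<open>An element of a corner e R f is one fixed by e on the left and by f on the right. The
  existential in \<open>phom\<close> thus becomes equations fit for rewriting; the entry is its own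
  witness.\<close>

lemma H_iff:
  "M \<in> H P Q \<longleftrightarrow> (\<forall>i j. M i j \<in> carrier R)
     \<and> (\<forall>i<length Q. \<forall>j<length P. E (Q!i) \<otimes> M i j = M i j \<and> M i j \<otimes> E (P!j) = M i j)
     \<and> (\<forall>i j. \<not> (i < length Q \<and> j < length P) \<longrightarrow> M i j = \<zero>)"
  (is "?l \<longleftrightarrow> ?r")
proof
  assume ?l
  then have l1: "\<forall>i<length Q. \<forall>j<length P. \<exists>x\<in>carrier R. M i j = E (Q!i) \<otimes> x \<otimes> E (P!j)"
    and l2: "\<forall>i j. \<not> (i < length Q \<and> j < length P) \<longrightarrow> M i j = \<zero>"
    unfolding phom_def mem_Collect_eq by (rule conjunct1, rule conjunct2)
  have 1: "M i j \<in> carrier R \<and> E (Q!i) \<otimes> M i j = M i j \<and> M i j \<otimes> E (P!j) = M i j"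
    if ij: "i<length Q" "j<length P" for i j
  proof -
    obtain x where "x \<in> carrier R" "M i j = E (Q!i) \<otimes> x \<otimes> E (P!j)"
      using l1 ij by blast
    then show ?thesis by (simp add: m_assoc)
  qed
  have 2: "M i j = \<zero>" if "\<not> (i < length Q \<and> j < length P)" for i j
    using l2 that by simp
  have "M i j \<in> carrier R" for i j
    using 1[of i j] 2[of i j] by (cases "i < length Q \<and> j < length P") auto
  then show ?r using 1 2 by simp
next
  assume r: ?r
  show ?l
    unfolding phom_def
  proof (intro CollectI conjI allI impI)
    fix i j assume "i<length Q" "j<length P"
    then have "E (Q!i) \<otimes> M i j \<otimes> E (P!j) = M i j" "M i j \<in> carrier R"
      using r by simp_all
    then show "\<exists>x\<in>carrier R. M i j = E (Q!i) \<otimes> x \<otimes> E (P!j)" by metis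
  next
    fix i j assume "\<not> (i < length Q \<and> j < length P)"
    then show "M i j = \<zero>" using r by simp
  qed
qed

lemma H_I:
  assumes "\<And>i j. M i j \<in> carrier R"
    and "\<And>i j. i<length Q \<Longrightarrow> j<length P \<Longrightarrow> E (Q!i) \<otimes> M i j = M i j"
    and "\<And>i j. i<length Q \<Longrightarrow> j<length P \<Longrightarrow> M i j \<otimes> E (P!j) = M i j"
    and "\<And>i j. \<not> (i < length Q \<and> j < length P) \<Longrightarrow> M i j = \<zero>"
  shows "M \<in> H P Q"
  unfolding H_iff using assms by simp

lemma H_closed: "M \<in> H P Q \<Longrightarrow> M i j \<in> carrier R"
  and H_left: "M \<in> H P Q \<Longrightarrow> i<length Q \<Longrightarrow> j<length P \<Longrightarrow> E (Q!i) \<otimes> M i j = M i j"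
  and H_right: "M \<in> H P Q \<Longrightarrow> i<length Q \<Longrightarrow> j<length P \<Longrightarrow> M i j \<otimes> E (P!j) = M i j"
  and H_zero: "M \<in> H P Q \<Longrightarrow> \<not> (i < length Q \<and> j < length P) \<Longrightarrow> M i j = \<zero>"
  unfolding H_iff by simp_all

lemma H_MC: "M \<in> H P Q \<Longrightarrow> M \<in> MC"
  unfolding MC_def using H_closed by blast

lemma mc_MC [simp]: "A \<in> MC \<Longrightarrow> B \<in> MC \<Longrightarrow> A \<star>\<^bsub>n\<^esub> B \<in> MC"
  unfolding MC_def mcomp_def by (auto intro!: finsum_closed)

lemma ma_MC [simp]: "A \<in> MC \<Longrightarrow> B \<in> MC \<Longrightarrow> A \<boxplus> B \<in> MC"
  unfolding MC_def madd_def by auto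

lemma mneg_MC [simp]: "A \<in> MC \<Longrightarrow> mneg R A \<in> MC"
  unfolding MC_def mneg_def by auto

lemma Z_MC [simp]: "Z \<in> MC"
  unfolding MC_def by auto

lemma mc_assoc:
  assumes "A \<in> MC" "B \<in> MC" "C \<in> MC"
  shows "(A \<star>\<^bsub>m\<^esub> B) \<star>\<^bsub>n\<^esub> C = A \<star>\<^bsub>m\<^esub> (B \<star>\<^bsub>n\<^esub> C)"
proof (intro ext)
  fix i k
  have "((A \<star>\<^bsub>m\<^esub> B) \<star>\<^bsub>n\<^esub> C) i k = (\<Oplus>l\<in>{..<n}. \<Oplus>j\<in>{..<m}. A i j \<otimes> B j l \<otimes> C l k)"
    unfolding mcomp_def
    by (rule finsum_cong') (use assms in \<open>auto simp: finsum_ldistr Pi_def\<close>)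
  also have "\<dots> = (\<Oplus>j\<in>{..<m}. \<Oplus>l\<in>{..<n}. A i j \<otimes> B j l \<otimes> C l k)"
    by (rule finsum_swap) (use assms in auto)
  also have "\<dots> = (A \<star>\<^bsub>m\<^esub> (B \<star>\<^bsub>n\<^esub> C)) i k"
    unfolding mcomp_def
    by (rule finsum_cong') (use assms in \<open>auto simp: finsum_rdistr Pi_def m_assoc\<close>)
  finally show "((A \<star>\<^bsub>m\<^esub> B) \<star>\<^bsub>n\<^esub> C) i k = (A \<star>\<^bsub>m\<^esub> (B \<star>\<^bsub>n\<^esub> C)) i k" .
qed

lemma mc_add_right:
  assumes "A \<in> MC" "B \<in> MC" "C \<in> MC"
  shows "A \<star>\<^bsub>n\<^esub> (B \<boxplus> C) = A \<star>\<^bsub>n\<^esub> B \<boxplus> A \<star>\<^bsub>n\<^esub> C"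
proof (intro ext)
  fix i k
  have "(A \<star>\<^bsub>n\<^esub> (B \<boxplus> C)) i k = (\<Oplus>j\<in>{..<n}. A i j \<otimes> B j k \<oplus> A i j \<otimes> C j k)"
    unfolding mcomp_def madd_def by (rule finsum_cong') (use assms in \<open>auto simp: r_distr\<close>)
  also have "\<dots> = (A \<star>\<^bsub>n\<^esub> B \<boxplus> A \<star>\<^bsub>n\<^esub> C) i k"
    unfolding mcomp_def madd_def by (rule finsum_addf) (use assms in auto)
  finally show "(A \<star>\<^bsub>n\<^esub> (B \<boxplus> C)) i k = (A \<star>\<^bsub>n\<^esub> B \<boxplus> A \<star>\<^bsub>n\<^esub> C) i k" .
qed

lemma mc_add_left:
  assumes "A \<in> MC" "B \<in> MC" "C \<in> MC"
  shows "(B \<boxplus> C) \<star>\<^bsub>n\<^esub> A = B \<star>\<^bsub>n\<^esub> A \<boxplus> C \<star>\<^bsub>n\<^esub> A"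
proof (intro ext)
  fix i k
  have "((B \<boxplus> C) \<star>\<^bsub>n\<^esub> A) i k = (\<Oplus>j\<in>{..<n}. B i j \<otimes> A j k \<oplus> C i j \<otimes> A j k)"
    unfolding mcomp_def madd_def by (rule finsum_cong') (use assms in \<open>auto simp: l_distr\<close>)
  also have "\<dots> = (B \<star>\<^bsub>n\<^esub> A \<boxplus> C \<star>\<^bsub>n\<^esub> A) i k"
    unfolding mcomp_def madd_def by (rule finsum_addf) (use assms in auto)
  finally show "((B \<boxplus> C) \<star>\<^bsub>n\<^esub> A) i k = (B \<star>\<^bsub>n\<^esub> A \<boxplus> C \<star>\<^bsub>n\<^esub> A) i k" .
qed

lemma mc_Z_right [simp]: "A \<in> MC \<Longrightarrow> A \<star>\<^bsub>n\<^esub> Z = Z"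
  and mc_Z_left [simp]: "A \<in> MC \<Longrightarrow> Z \<star>\<^bsub>n\<^esub> A = Z"
  unfolding mcomp_def by (auto intro!: ext finsum_zero_terms)

lemma ma_assoc: "A \<in> MC \<Longrightarrow> B \<in> MC \<Longrightarrow> C \<in> MC \<Longrightarrow> (A \<boxplus> B) \<boxplus> C = A \<boxplus> (B \<boxplus> C)"
  unfolding madd_def by (auto simp: a_assoc)

lemma ma_comm: "A \<in> MC \<Longrightarrow> B \<in> MC \<Longrightarrow> A \<boxplus> B = B \<boxplus> A"
  unfolding madd_def by (auto simp: a_comm)

lemma ma_Z_right [simp]: "A \<in> MC \<Longrightarrow> A \<boxplus> Z = A"
  and ma_Z_left [simp]: "A \<in> MC \<Longrightarrow> Z \<boxplus> A = A"
  unfolding madd_def by auto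

lemma ma_right_cancel:
  assumes "A \<in> MC" "B \<in> MC" "C \<in> MC" "A \<boxplus> C = B \<boxplus> C"
  shows "A = B"
proof (intro ext)
  fix i j
  have "A i j \<oplus> C i j = B i j \<oplus> C i j"
    using assms(4) unfolding madd_def by (auto dest: fun_cong)
  then show "A i j = B i j"
    using assms by (metis MC_D add.right_cancel)
qed

text \<open>Turns the homotopy relation g f - 1 = h d into 1 = g f - h d, after which the sign is
  absorbed into the homotopy.\<close>

lemma ma_mneg_eq_iff:
  assumes "A \<in> MC" "B \<in> MC" "C \<in> MC"
  shows "A \<boxplus> mneg R B = C \<longleftrightarrow> B = A \<boxplus> mneg R C"
  unfolding madd_def mneg_def using assms
  by (auto simp: minus_eq_iff fun_eq_iff)

lemma mc_mneg_left:
  assumes "A \<in> MC" "B \<in> MC" shows "mneg R A \<star>\<^bsub>n\<^esub> B = mneg R (A \<star>\<^bsub>n\<^esub> B)"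
proof (rule ma_right_cancel)
  have "mneg R A \<star>\<^bsub>n\<^esub> B \<boxplus> A \<star>\<^bsub>n\<^esub> B = (mneg R A \<boxplus> A) \<star>\<^bsub>n\<^esub> B"
    using assms by (simp add: mc_add_left)
  also have "mneg R A \<boxplus> A = Z"
    unfolding madd_def mneg_def using assms by (auto simp: l_neg)
  also have "Z \<star>\<^bsub>n\<^esub> B = mneg R (A \<star>\<^bsub>n\<^esub> B) \<boxplus> A \<star>\<^bsub>n\<^esub> B"
    using assms mc_MC[of A B n] by (auto simp: madd_def mneg_def l_neg simp del: mc_MC)
  finally show "mneg R A \<star>\<^bsub>n\<^esub> B \<boxplus> A \<star>\<^bsub>n\<^esub> B = mneg R (A \<star>\<^bsub>n\<^esub> B) \<boxplus> A \<star>\<^bsub>n\<^esub> B" .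
qed (use assms in auto)

lemma mc_mneg_right:
  assumes "A \<in> MC" "B \<in> MC" shows "A \<star>\<^bsub>n\<^esub> mneg R B = mneg R (A \<star>\<^bsub>n\<^esub> B)"
proof (rule ma_right_cancel)
  have "A \<star>\<^bsub>n\<^esub> mneg R B \<boxplus> A \<star>\<^bsub>n\<^esub> B = A \<star>\<^bsub>n\<^esub> (mneg R B \<boxplus> B)"
    using assms by (simp add: mc_add_right)
  also have "mneg R B \<boxplus> B = Z"
    unfolding madd_def mneg_def using assms by (auto simp: l_neg)
  also have "A \<star>\<^bsub>n\<^esub> Z = mneg R (A \<star>\<^bsub>n\<^esub> B) \<boxplus> A \<star>\<^bsub>n\<^esub> B"
    using assms mc_MC[of A B n] by (auto simp: madd_def mneg_def l_neg simp del: mc_MC)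
  finally show "A \<star>\<^bsub>n\<^esub> mneg R B \<boxplus> A \<star>\<^bsub>n\<^esub> B = mneg R (A \<star>\<^bsub>n\<^esub> B) \<boxplus> A \<star>\<^bsub>n\<^esub> B" .
qed (use assms in auto)

lemma Z_H [simp]: "Z \<in> H P Q"
  by (rule H_I) auto

lemma ma_H [simp]: "A \<in> H P Q \<Longrightarrow> B \<in> H P Q \<Longrightarrow> A \<boxplus> B \<in> H P Q"
  by (rule H_I) (auto simp: madd_def H_closed H_left H_right H_zero r_distr l_distr)

lemma mneg_H [simp]: "A \<in> H P Q \<Longrightarrow> mneg R A \<in> H P Q"
  by (rule H_I) (auto simp: mneg_def H_closed H_left H_right H_zero r_minus l_minus)

lemma I_H [simp]: "I P \<in> H P P"
  by (rule H_I) (auto simp: mid_def)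

lemma mc_H:
  assumes "A \<in> H Q S" "B \<in> H P Q"
  shows "A \<star>\<^bsub>length Q\<^esub> B \<in> H P S"
proof (rule H_I)
  note AB = H_closed[OF assms(1)] H_closed[OF assms(2)]
  show "(A \<star>\<^bsub>length Q\<^esub> B) i j \<in> carrier R" for i j
    unfolding mcomp_def using AB by auto
  show "E (S!i) \<otimes> (A \<star>\<^bsub>length Q\<^esub> B) i j = (A \<star>\<^bsub>length Q\<^esub> B) i j" if "i < length S" "j < length P" for i j
    unfolding mcomp_def using AB that
    by (auto simp: finsum_rdistr Pi_def m_assoc[symmetric] H_left[OF assms(1)] intro!: finsum_cong')
  show "(A \<star>\<^bsub>length Q\<^esub> B) i j \<otimes> E (P!j) = (A \<star>\<^bsub>length Q\<^esub> B) i j" if "i < length S" "j < length P" for i j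
    unfolding mcomp_def using AB that
    by (auto simp: finsum_ldistr Pi_def m_assoc H_right[OF assms(2)] intro!: finsum_cong')
  show "(A \<star>\<^bsub>length Q\<^esub> B) i j = \<zero>" if "\<not> (i < length S \<and> j < length P)" for i j
    unfolding mcomp_def
    by (rule finsum_zero_terms) (use that AB H_zero[OF assms(1)] H_zero[OF assms(2)] in auto)
qed

lemma mc_I_right:
  assumes "A \<in> H P Q" shows "A \<star>\<^bsub>length P\<^esub> I P = A"
proof (intro ext)
  fix i k
  show "(A \<star>\<^bsub>length P\<^esub> I P) i k = A i k"
  proof (cases "k < length P")
    case True
    have "A i k \<otimes> E (P!k) = A i k"
      using True H_right[OF assms, of i k] H_zero[OF assms, of i k] by (cases "i < length Q") auto
    moreover have "(A \<star>\<^bsub>length P\<^esub> I P) i k = A i k \<otimes> I P k k"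
      unfolding mcomp_def
      by (rule finsum_single_term) (use True H_closed[OF assms] in \<open>auto simp: mid_def\<close>)
    ultimately show ?thesis using True by (simp add: mid_def)
  next
    case False
    then show ?thesis
      using mc_H[OF assms I_H] H_zero[OF assms] by (simp add: H_zero)
  qed
qed

lemma mc_I_left:
  assumes "A \<in> H P Q" shows "I Q \<star>\<^bsub>length Q\<^esub> A = A"
proof (intro ext)
  fix i k
  show "(I Q \<star>\<^bsub>length Q\<^esub> A) i k = A i k"
  proof (cases "i < length Q")
    case True
    have "E (Q!i) \<otimes> A i k = A i k"
      using True H_left[OF assms, of i k] H_zero[OF assms, of i k] by (cases "k < length P") auto
    moreover have "(I Q \<star>\<^bsub>length Q\<^esub> A) i k = I Q i i \<otimes> A i k"
      unfolding mcomp_def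
      by (rule finsum_single_term) (use True H_closed[OF assms] in \<open>auto simp: mid_def\<close>)
    ultimately show ?thesis using True by (simp add: mid_def)
  next
    case False
    then show ?thesis
      using mc_H[OF I_H assms] H_zero[OF assms] by (simp add: H_zero)
  qed
qed

end

section \<open>Homotopy equivalences of 2-term complexes\<close>

context idem2
begin

abbreviation wf :: "'a cx \<Rightarrow> bool" where "wf \<equiv> wf_cx R e1 e2"
abbreviation iso :: "'a cx \<Rightarrow> 'a cx \<Rightarrow> bool" where "iso \<equiv> isoK R e1 e2"

lemma wf_cd: "wf T \<Longrightarrow> cd T \<in> H (c1 T) (c0 T)"
  by (simp add: wf_cx_def)

text \<open>The homotopy enters as \<open>1 = g f + h d\<close>, not \<open>g f - 1 = h d\<close>, so that compositions need no signs.\<close>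

definition htpy_inv ::
  "'a cx \<Rightarrow> 'a cx \<Rightarrow> 'a mat \<Rightarrow> 'a mat \<Rightarrow> 'a mat \<Rightarrow> 'a mat \<Rightarrow> 'a mat \<Rightarrow> bool" where
  "htpy_inv T T' f1 f0 g1 g0 h \<longleftrightarrow>
     f1 \<in> H (c1 T) (c1 T') \<and> f0 \<in> H (c0 T) (c0 T') \<and> g1 \<in> H (c1 T') (c1 T) \<and> g0 \<in> H (c0 T') (c0 T)
     \<and> h \<in> H (c0 T) (c1 T)
     \<and> cd T' \<star>\<^bsub>length (c1 T')\<^esub> f1 = f0 \<star>\<^bsub>length (c0 T)\<^esub> cd T
     \<and> cd T \<star>\<^bsub>length (c1 T)\<^esub> g1 = g0 \<star>\<^bsub>length (c0 T')\<^esub> cd T'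
     \<and> I (c1 T) = g1 \<star>\<^bsub>length (c1 T')\<^esub> f1 \<boxplus> h \<star>\<^bsub>length (c0 T)\<^esub> cd T
     \<and> I (c0 T) = g0 \<star>\<^bsub>length (c0 T')\<^esub> f0 \<boxplus> cd T \<star>\<^bsub>length (c1 T)\<^esub> h"

text \<open>The two forms of the relation correspond under h and its negative, and negation is an
  involution of the morphism space that contains h.\<close>

lemma homotopic_id_iff:
  assumes "wf T" "f1 \<in> H (c1 T) (c1 T)" "f0 \<in> H (c0 T) (c0 T)"
  shows "homotopic R e1 e2 T T (f1, f0) (cm_id R e1 e2 T) \<longleftrightarrow>
     (\<exists>h\<in>H (c0 T) (c1 T). I (c1 T) = f1 \<boxplus> h \<star>\<^bsub>length (c0 T)\<^esub> cd T
        \<and> I (c0 T) = f0 \<boxplus> cd T \<star>\<^bsub>length (c1 T)\<^esub> h)"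
    (is "?l \<longleftrightarrow> (\<exists>h\<in>_. ?P h)")
proof -
  note [simp] = H_MC[OF wf_cd[OF assms(1)]] H_MC[OF assms(2)] H_MC[OF assms(3)] H_MC[OF I_H]
  have *: "(f1 \<boxplus> mneg R (I (c1 T)) = h \<star>\<^bsub>length (c0 T)\<^esub> cd T
        \<and> f0 \<boxplus> mneg R (I (c0 T)) = cd T \<star>\<^bsub>length (c1 T)\<^esub> h) \<longleftrightarrow> ?P (mneg R h)"
    if "h \<in> H (c0 T) (c1 T)" for h
    using H_MC[OF that] by (simp add: ma_mneg_eq_iff mc_mneg_left mc_mneg_right)
  have nn: "mneg R (mneg R h) = h" if "h \<in> H (c0 T) (c1 T)" for h
    using H_MC[OF that] by (simp add: mneg_def)
  show ?thesis
    unfolding homotopic_def null_htpy_def cm_id_def fst_conv snd_conv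
    using * nn by (metis mneg_H)
qed

text \<open>Splits an isomorphism of K^b into two one-sided statements that differ by exchanging T
  with T' and f with g. Compositions and direct sums are treated for one side; the other follows by
  symmetry.\<close>

lemma iso_iff:
  assumes "wf T" "wf T'"
  shows "iso T T' \<longleftrightarrow> (\<exists>f1 f0 g1 g0 h h'. htpy_inv T T' f1 f0 g1 g0 h \<and> htpy_inv T' T g1 g0 f1 f0 h')"
proof -
  have m1: "mcomp R (length (c1 T')) g1 f1 \<in> H (c1 T) (c1 T)"
    if "f1 \<in> H (c1 T) (c1 T')" "g1 \<in> H (c1 T') (c1 T)" for f1 g1 T T'
    by (rule mc_H) (use that in auto)
  have m0: "mcomp R (length (c0 T')) g1 f1 \<in> H (c0 T) (c0 T)"
    if "f1 \<in> H (c0 T) (c0 T')" "g1 \<in> H (c0 T') (c0 T)" for f1 g1 T T'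
    by (rule mc_H) (use that in auto)
  have "chain_map R e1 e2 T T' (f1, f0) \<and> chain_map R e1 e2 T' T (g1, g0)
     \<and> homotopic R e1 e2 T T (cm_comp R T' (g1, g0) (f1, f0)) (cm_id R e1 e2 T)
     \<and> homotopic R e1 e2 T' T' (cm_comp R T (f1, f0) (g1, g0)) (cm_id R e1 e2 T')
    \<longleftrightarrow> (\<exists>h h'. htpy_inv T T' f1 f0 g1 g0 h \<and> htpy_inv T' T g1 g0 f1 f0 h')"
    (is "?l \<longleftrightarrow> ?r") for f1 f0 g1 g0
  proof (cases "f1 \<in> H (c1 T) (c1 T') \<and> f0 \<in> H (c0 T) (c0 T') \<and> g1 \<in> H (c1 T') (c1 T) \<and> g0 \<in> H (c0 T') (c0 T)")
    case True
    then have f: "f1 \<in> H (c1 T) (c1 T')" "f0 \<in> H (c0 T) (c0 T')" "g1 \<in> H (c1 T') (c1 T)" "g0 \<in> H (c0 T') (c0 T)"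
      by auto
    note * = homotopic_id_iff[OF assms(1) m1[OF f(1,3)] m0[OF f(2,4)]]
      homotopic_id_iff[OF assms(2) m1[OF f(3,1)] m0[OF f(4,2)]]
    show ?thesis
      unfolding chain_map_def cm_comp_def fst_conv snd_conv htpy_inv_def *
      by (simp only: f simp_thms Bex_def)
        (rule iffI; elim exE conjE; intro exI conjI; assumption)
  next
    case False
    then show ?thesis unfolding chain_map_def htpy_inv_def by simp blast
  qed
  then show ?thesis
    unfolding isoK_def split_paired_Ex by simp
qed

lemma iso_sym: "iso T T' \<Longrightarrow> iso T' T"
  unfolding isoK_def by blast

lemma iso_refl: assumes "wf T" shows "iso T T"
proof -
  have "htpy_inv T T (I (c1 T)) (I (c0 T)) (I (c1 T)) (I (c0 T)) Z"
    unfolding htpy_inv_def using H_MC[OF I_H] wf_cd[OF assms] H_MC[OF wf_cd[OF assms]]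
    by (simp add: mc_I_left mc_I_right mc_I_left[OF I_H])
  then show ?thesis using assms iso_iff by blast
qed

text \<open>Inserting 1 = g' f' + h' d' on T' gives g f = g (g' f') f + g h' d' f, and d' f = f d
  brings the last term into homotopy form. So g h' f + h is the homotopy of the composite.\<close>

lemma htpy_inv_comp:
  assumes wf: "wf T" "wf T'" "wf T''"
    and 1: "htpy_inv T T' f1 f0 g1 g0 h" and 2: "htpy_inv T' T'' f1' f0' g1' g0' h'"
  shows "htpy_inv T T'' (f1' \<star>\<^bsub>length (c1 T')\<^esub> f1) (f0' \<star>\<^bsub>length (c0 T')\<^esub> f0)
     (g1 \<star>\<^bsub>length (c1 T')\<^esub> g1') (g0 \<star>\<^bsub>length (c0 T')\<^esub> g0')
     (g1 \<star>\<^bsub>length (c1 T')\<^esub> (h' \<star>\<^bsub>length (c0 T')\<^esub> f0) \<boxplus> h)"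
    (is "htpy_inv T T'' ?F1 ?F0 ?G1 ?G0 ?K")
proof -
  define d d' d'' where "d = cd T" and "d' = cd T'" and "d'' = cd T''"
  define m n m' n' m'' n'' where defs: "m = length (c1 T)" "n = length (c0 T)"
    "m' = length (c1 T')" "n' = length (c0 T')" "m'' = length (c1 T'')" "n'' = length (c0 T'')"
  note D = d_def[symmetric] d'_def[symmetric] d''_def[symmetric] defs[symmetric]
  have d: "d \<in> H (c1 T) (c0 T)" "d' \<in> H (c1 T') (c0 T')" "d'' \<in> H (c1 T'') (c0 T'')"
    using wf wf_cd by (auto simp: d_def d'_def d''_def)
  note a = 1[unfolded htpy_inv_def D] and b = 2[unfolded htpy_inv_def D]
  have f: "f1 \<in> H (c1 T) (c1 T')" "f0 \<in> H (c0 T) (c0 T')" "g1 \<in> H (c1 T') (c1 T)"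
    "g0 \<in> H (c0 T') (c0 T)" "h \<in> H (c0 T) (c1 T)"
    and df: "d' \<star>\<^bsub>m'\<^esub> f1 = f0 \<star>\<^bsub>n\<^esub> d"
    and dg: "d \<star>\<^bsub>m\<^esub> g1 = g0 \<star>\<^bsub>n'\<^esub> d'"
    and I1: "I (c1 T) = g1 \<star>\<^bsub>m'\<^esub> f1 \<boxplus> h \<star>\<^bsub>n\<^esub> d" and I0: "I (c0 T) = g0 \<star>\<^bsub>n'\<^esub> f0 \<boxplus> d \<star>\<^bsub>m\<^esub> h"
    using a by blast+
  have f': "f1' \<in> H (c1 T') (c1 T'')" "f0' \<in> H (c0 T') (c0 T'')" "g1' \<in> H (c1 T'') (c1 T')"
    "g0' \<in> H (c0 T'') (c0 T')" "h' \<in> H (c0 T') (c1 T')"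
    and df': "d'' \<star>\<^bsub>m''\<^esub> f1' = f0' \<star>\<^bsub>n'\<^esub> d'"
    and dg': "d' \<star>\<^bsub>m'\<^esub> g1' = g0' \<star>\<^bsub>n''\<^esub> d''"
    and I1': "I (c1 T') = g1' \<star>\<^bsub>m''\<^esub> f1' \<boxplus> h' \<star>\<^bsub>n'\<^esub> d'"
    and I0': "I (c0 T') = g0' \<star>\<^bsub>n''\<^esub> f0' \<boxplus> d' \<star>\<^bsub>m'\<^esub> h'"
    using b by blast+
  note [simp] = f[THEN H_MC] f'[THEN H_MC] d[THEN H_MC] mc_assoc mc_add_left mc_add_right ma_assoc
  have memb: "?F1 \<in> H (c1 T) (c1 T'')" "?F0 \<in> H (c0 T) (c0 T'')"
    "?G1 \<in> H (c1 T'') (c1 T)" "?G0 \<in> H (c0 T'') (c0 T)" "?K \<in> H (c0 T) (c1 T)"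
    by (intro mc_H ma_H f f')+
  have "d'' \<star>\<^bsub>m''\<^esub> (f1' \<star>\<^bsub>m'\<^esub> f1) = (d'' \<star>\<^bsub>m''\<^esub> f1') \<star>\<^bsub>m'\<^esub> f1"
    by simp
  also have "\<dots> = f0' \<star>\<^bsub>n'\<^esub> (d' \<star>\<^bsub>m'\<^esub> f1)" unfolding df' by simp
  also have "\<dots> = (f0' \<star>\<^bsub>n'\<^esub> f0) \<star>\<^bsub>n\<^esub> d" unfolding df by simp
  finally have chain: "d'' \<star>\<^bsub>m''\<^esub> (f1' \<star>\<^bsub>m'\<^esub> f1) = (f0' \<star>\<^bsub>n'\<^esub> f0) \<star>\<^bsub>n\<^esub> d" .
  have "d \<star>\<^bsub>m\<^esub> (g1 \<star>\<^bsub>m'\<^esub> g1') = (d \<star>\<^bsub>m\<^esub> g1) \<star>\<^bsub>m'\<^esub> g1'"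
    by simp
  also have "\<dots> = g0 \<star>\<^bsub>n'\<^esub> (d' \<star>\<^bsub>m'\<^esub> g1')" unfolding dg by simp
  also have "\<dots> = (g0 \<star>\<^bsub>n'\<^esub> g0') \<star>\<^bsub>n''\<^esub> d''" unfolding dg' by simp
  finally have chain': "d \<star>\<^bsub>m\<^esub> (g1 \<star>\<^bsub>m'\<^esub> g1') = (g0 \<star>\<^bsub>n'\<^esub> g0') \<star>\<^bsub>n''\<^esub> d''" .
  have "g1 \<star>\<^bsub>m'\<^esub> f1 = g1 \<star>\<^bsub>m'\<^esub> (I (c1 T') \<star>\<^bsub>m'\<^esub> f1)"
    using mc_I_left[OF f(1)] by (simp add: defs)
  also have "\<dots> = g1 \<star>\<^bsub>m'\<^esub> (g1' \<star>\<^bsub>m''\<^esub> (f1' \<star>\<^bsub>m'\<^esub> f1)) \<boxplus> g1 \<star>\<^bsub>m'\<^esub> (h' \<star>\<^bsub>n'\<^esub> (d' \<star>\<^bsub>m'\<^esub> f1))"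
    unfolding I1' by simp
  finally have J1: "I (c1 T) = ?G1 \<star>\<^bsub>m''\<^esub> ?F1 \<boxplus> ?K \<star>\<^bsub>n\<^esub> d"
    unfolding I1 df defs[symmetric] by simp
  have "g0 \<star>\<^bsub>n'\<^esub> f0 = g0 \<star>\<^bsub>n'\<^esub> (I (c0 T') \<star>\<^bsub>n'\<^esub> f0)"
    using mc_I_left[OF f(2)] by (simp add: defs)
  also have "\<dots> = g0 \<star>\<^bsub>n'\<^esub> (g0' \<star>\<^bsub>n''\<^esub> (f0' \<star>\<^bsub>n'\<^esub> f0)) \<boxplus> (g0 \<star>\<^bsub>n'\<^esub> d') \<star>\<^bsub>m'\<^esub> (h' \<star>\<^bsub>n'\<^esub> f0)"
    unfolding I0' by simp
  finally have J0: "I (c0 T) = ?G0 \<star>\<^bsub>n''\<^esub> ?F0 \<boxplus> d \<star>\<^bsub>m\<^esub> ?K"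
    unfolding I0 dg[symmetric] defs[symmetric] by simp
  show ?thesis
    unfolding htpy_inv_def using memb chain chain' J1 J0 unfolding D by blast
qed

lemma iso_trans:
  assumes "wf T" "wf T'" "wf T''" "iso T T'" "iso T' T''"
  shows "iso T T''"
proof -
  obtain f1 f0 g1 g0 h k where 1: "htpy_inv T T' f1 f0 g1 g0 h" "htpy_inv T' T g1 g0 f1 f0 k"
    using assms iso_iff by blast
  obtain f1' f0' g1' g0' h' k' where 2: "htpy_inv T' T'' f1' f0' g1' g0' h'" "htpy_inv T'' T' g1' g0' f1' f0' k'"
    using assms iso_iff by blast
  show ?thesis
    using htpy_inv_comp[OF assms(1-3) 1(1) 2(1)] htpy_inv_comp[OF assms(3,2,1) 2(2) 1(2)]
      assms iso_iff by blast
qed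

lemma zeroK_iff:
  "zeroK R e1 e2 T \<longleftrightarrow> (\<exists>h\<in>H (c0 T) (c1 T). I (c1 T) = h \<star>\<^bsub>length (c0 T)\<^esub> cd T
      \<and> I (c0 T) = cd T \<star>\<^bsub>length (c1 T)\<^esub> h)"
  by (simp add: zeroK_def null_htpy_def cm_id_def)

text \<open>A contraction is the homotopy of a composite through zero: the formula is that of
  \<open>htpy_inv_comp\<close>, with the contraction k of T' in place of h'.\<close>

lemma zeroK_iso:
  assumes wf: "wf T" "wf T'" and iso: "iso T T'" and zero: "zeroK R e1 e2 T'"
  shows "zeroK R e1 e2 T"
proof -
  obtain f1 f0 g1 g0 h where 1: "htpy_inv T T' f1 f0 g1 g0 h"
    using assms iso_iff by blast
  obtain k where k: "k \<in> H (c0 T') (c1 T')"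
    and k1: "I (c1 T') = k \<star>\<^bsub>length (c0 T')\<^esub> cd T'" and k0: "I (c0 T') = cd T' \<star>\<^bsub>length (c1 T')\<^esub> k"
    using zero zeroK_iff by blast
  note [simp] = mc_assoc mc_add_left mc_add_right ma_assoc wf[THEN wf_cd, THEN H_MC] H_MC[OF k]
  note a = 1[unfolded htpy_inv_def]
  have f: "f1 \<in> H (c1 T) (c1 T')" "f0 \<in> H (c0 T) (c0 T')" "g1 \<in> H (c1 T') (c1 T)"
    "g0 \<in> H (c0 T') (c0 T)" "h \<in> H (c0 T) (c1 T)" using a by blast+
  note [simp] = f[THEN H_MC]
  let ?K = "g1 \<star>\<^bsub>length (c1 T')\<^esub> (k \<star>\<^bsub>length (c0 T')\<^esub> f0) \<boxplus> h"
  have K: "?K \<in> H (c0 T) (c1 T)" by (intro mc_H ma_H f k)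
  have "g1 \<star>\<^bsub>length (c1 T')\<^esub> f1 = g1 \<star>\<^bsub>length (c1 T')\<^esub> (I (c1 T') \<star>\<^bsub>length (c1 T')\<^esub> f1)"
    using mc_I_left[OF f(1)] by simp
  also have "\<dots> = g1 \<star>\<^bsub>length (c1 T')\<^esub> (k \<star>\<^bsub>length (c0 T')\<^esub> (cd T' \<star>\<^bsub>length (c1 T')\<^esub> f1))"
    unfolding k1 by simp
  also have "\<dots> = g1 \<star>\<^bsub>length (c1 T')\<^esub> (k \<star>\<^bsub>length (c0 T')\<^esub> (f0 \<star>\<^bsub>length (c0 T)\<^esub> cd T))"
    using a by simp
  finally have 3: "I (c1 T) = ?K \<star>\<^bsub>length (c0 T)\<^esub> cd T" using a by simp
  have "g0 \<star>\<^bsub>length (c0 T')\<^esub> f0 = g0 \<star>\<^bsub>length (c0 T')\<^esub> (I (c0 T') \<star>\<^bsub>length (c0 T')\<^esub> f0)"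
    using mc_I_left[OF f(2)] by simp
  also have "\<dots> = (g0 \<star>\<^bsub>length (c0 T')\<^esub> cd T') \<star>\<^bsub>length (c1 T')\<^esub> (k \<star>\<^bsub>length (c0 T')\<^esub> f0)"
    unfolding k0 by simp
  also have "\<dots> = (cd T \<star>\<^bsub>length (c1 T)\<^esub> g1) \<star>\<^bsub>length (c1 T')\<^esub> (k \<star>\<^bsub>length (c0 T')\<^esub> f0)"
    using a by presburger
  finally have e0: "g0 \<star>\<^bsub>length (c0 T')\<^esub> f0
      = (cd T \<star>\<^bsub>length (c1 T)\<^esub> g1) \<star>\<^bsub>length (c1 T')\<^esub> (k \<star>\<^bsub>length (c0 T')\<^esub> f0)" .
  have I0: "I (c0 T) = g0 \<star>\<^bsub>length (c0 T')\<^esub> f0 \<boxplus> cd T \<star>\<^bsub>length (c1 T)\<^esub> h"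
    using a by blast
  have 4: "I (c0 T) = cd T \<star>\<^bsub>length (c1 T)\<^esub> ?K" unfolding I0 e0 by simp
  show ?thesis using 3 4 K zeroK_iff by blast
qed

text \<open>Hom(T,T[1]) = 0 passes to a homotopy retract. A map u for T' is carried to f u g for T,
  decomposed there and carried back; the homotopy of the retraction supplies the correction
  terms.\<close>

lemma presilting_iso:
  assumes pre: "presilting R e1 e2 T" and wf': "wf T'" and iso: "iso T T'"
  shows "presilting R e1 e2 T'"
  unfolding presilting_def shift_hom_zero_def
proof (intro conjI ballI wf')
  have wf: "wf T" using pre by (simp add: presilting_def)
  obtain f1 f0 g1 g0 h where 1: "htpy_inv T' T f1 f0 g1 g0 h"
    using iso_iff[OF wf' wf] iso_sym[OF iso] by blast
  note a = 1[unfolded htpy_inv_def]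
  have f: "f1 \<in> H (c1 T') (c1 T)" "f0 \<in> H (c0 T') (c0 T)" "g1 \<in> H (c1 T) (c1 T')"
    "g0 \<in> H (c0 T) (c0 T')" "h \<in> H (c0 T') (c1 T')" using a by blast+
  fix u assume u: "u \<in> H (c1 T') (c0 T')"
  define m n m' n' where defs: "m = length (c1 T)" "n = length (c0 T)"
    "m' = length (c1 T')" "n' = length (c0 T')"
  define d d' where ds: "d = cd T" "d' = cd T'"
  note D = defs[symmetric] ds[symmetric]
  have d: "d \<in> H (c1 T) (c0 T)" "d' \<in> H (c1 T') (c0 T')"
    using wf wf' wf_cd by (auto simp: ds)
  note [simp] = mc_assoc mc_add_left mc_add_right ma_assoc d[THEN H_MC] f[THEN H_MC] H_MC[OF u]
  have "f0 \<star>\<^bsub>n'\<^esub> (u \<star>\<^bsub>m'\<^esub> g1) \<in> H (c1 T) (c0 T)"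
    unfolding defs by (intro mc_H f u)
  then obtain x y where x: "x \<in> H (c1 T) (c1 T)" and y: "y \<in> H (c0 T) (c0 T)"
    and xy: "f0 \<star>\<^bsub>n'\<^esub> (u \<star>\<^bsub>m'\<^esub> g1) = d \<star>\<^bsub>m\<^esub> x \<boxplus> y \<star>\<^bsub>n\<^esub> d"
    using pre unfolding presilting_def shift_hom_zero_def D by meson
  note [simp] = H_MC[OF x] H_MC[OF y]
  have df: "d \<star>\<^bsub>m\<^esub> f1 = f0 \<star>\<^bsub>n'\<^esub> d'" and dg: "d' \<star>\<^bsub>m'\<^esub> g1 = g0 \<star>\<^bsub>n\<^esub> d"
    and I1: "I (c1 T') = g1 \<star>\<^bsub>m\<^esub> f1 \<boxplus> h \<star>\<^bsub>n'\<^esub> d'" and I0: "I (c0 T') = g0 \<star>\<^bsub>n\<^esub> f0 \<boxplus> d' \<star>\<^bsub>m'\<^esub> h"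
    using a unfolding D by blast+
  have iu: "I (c0 T') \<star>\<^bsub>n'\<^esub> u = u" and ui: "u \<star>\<^bsub>m'\<^esub> I (c1 T') = u"
    using mc_I_left[OF u] mc_I_right[OF u] by (auto simp: defs)
  \<comment> \<open>Expand u by the identity of T'^0 on the left, then f0 u by the identity of T'^-1
    on the right: terms that begin with d' are collected in h1, those that end with d' in
    h0.\<close>
  let ?h1 = "g1 \<star>\<^bsub>m\<^esub> (x \<star>\<^bsub>m\<^esub> f1) \<boxplus> h \<star>\<^bsub>n'\<^esub> u"
  let ?h0 = "g0 \<star>\<^bsub>n\<^esub> (y \<star>\<^bsub>n\<^esub> f0) \<boxplus> g0 \<star>\<^bsub>n\<^esub> (f0 \<star>\<^bsub>n'\<^esub> (u \<star>\<^bsub>m'\<^esub> h))"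
  have "f0 \<star>\<^bsub>n'\<^esub> u = f0 \<star>\<^bsub>n'\<^esub> (u \<star>\<^bsub>m'\<^esub> I (c1 T'))" by (simp add: ui)
  also have "\<dots> = (f0 \<star>\<^bsub>n'\<^esub> (u \<star>\<^bsub>m'\<^esub> g1)) \<star>\<^bsub>m\<^esub> f1 \<boxplus> f0 \<star>\<^bsub>n'\<^esub> (u \<star>\<^bsub>m'\<^esub> (h \<star>\<^bsub>n'\<^esub> d'))"
    unfolding I1 by simp
  also have "\<dots> = d \<star>\<^bsub>m\<^esub> (x \<star>\<^bsub>m\<^esub> f1) \<boxplus> y \<star>\<^bsub>n\<^esub> (d \<star>\<^bsub>m\<^esub> f1) \<boxplus> f0 \<star>\<^bsub>n'\<^esub> (u \<star>\<^bsub>m'\<^esub> (h \<star>\<^bsub>n'\<^esub> d'))"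
    unfolding xy by simp
  finally have f0u: "f0 \<star>\<^bsub>n'\<^esub> u = d \<star>\<^bsub>m\<^esub> (x \<star>\<^bsub>m\<^esub> f1) \<boxplus> y \<star>\<^bsub>n\<^esub> (f0 \<star>\<^bsub>n'\<^esub> d')
      \<boxplus> f0 \<star>\<^bsub>n'\<^esub> (u \<star>\<^bsub>m'\<^esub> (h \<star>\<^bsub>n'\<^esub> d'))" unfolding df .
  have "u = I (c0 T') \<star>\<^bsub>n'\<^esub> u" by (simp add: iu)
  also have "\<dots> = g0 \<star>\<^bsub>n\<^esub> (f0 \<star>\<^bsub>n'\<^esub> u) \<boxplus> d' \<star>\<^bsub>m'\<^esub> (h \<star>\<^bsub>n'\<^esub> u)"
    unfolding I0 by simp
  also have "\<dots> = g0 \<star>\<^bsub>n\<^esub> (d \<star>\<^bsub>m\<^esub> (x \<star>\<^bsub>m\<^esub> f1) \<boxplus> y \<star>\<^bsub>n\<^esub> (f0 \<star>\<^bsub>n'\<^esub> d') \<boxplus> f0 \<star>\<^bsub>n'\<^esub> (u \<star>\<^bsub>m'\<^esub> (h \<star>\<^bsub>n'\<^esub> d')))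
      \<boxplus> d' \<star>\<^bsub>m'\<^esub> (h \<star>\<^bsub>n'\<^esub> u)"
    unfolding f0u ..
  also have "\<dots> = (g0 \<star>\<^bsub>n\<^esub> d) \<star>\<^bsub>m\<^esub> (x \<star>\<^bsub>m\<^esub> f1) \<boxplus> (?h0 \<star>\<^bsub>n'\<^esub> d' \<boxplus> d' \<star>\<^bsub>m'\<^esub> (h \<star>\<^bsub>n'\<^esub> u))"
    by simp
  also have "\<dots> = d' \<star>\<^bsub>m'\<^esub> ?h1 \<boxplus> ?h0 \<star>\<^bsub>n'\<^esub> d'"
    unfolding dg[symmetric] by (simp add: ma_comm[of "d' \<star>\<^bsub>m'\<^esub> (h \<star>\<^bsub>n'\<^esub> u)"])
  finally have eq: "u = d' \<star>\<^bsub>m'\<^esub> ?h1 \<boxplus> ?h0 \<star>\<^bsub>n'\<^esub> d'" .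
  have "?h1 \<in> H (c1 T') (c1 T')" "?h0 \<in> H (c0 T') (c0 T')"
    unfolding defs by (intro mc_H ma_H f u x y)+
  then show "\<exists>h1\<in>H (c1 T') (c1 T'). \<exists>h0\<in>H (c0 T') (c0 T').
       u = cd T' \<star>\<^bsub>length (c1 T')\<^esub> h1 \<boxplus> h0 \<star>\<^bsub>length (c0 T')\<^esub> cd T'"
    using eq unfolding D by meson
qed

end

section \<open>Direct sums\<close>

context idem2
begin

lemma finsum_lessThan_add:
  fixes m n :: nat
  assumes "\<And>j. f j \<in> carrier R"
  shows "(\<Oplus>j\<in>{..<m+n}. f j) = (\<Oplus>j\<in>{..<m}. f j) \<oplus> (\<Oplus>j\<in>{..<n}. f (m + j))"
  by (induction n) (use assms in \<open>auto simp: lessThan_Suc Pi_def a_ac\<close>)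

text \<open>\<open>r\<close> and \<open>c\<close> are the dimensions of the block \<open>A\<close>
  only; the block \<open>B\<close> is unbounded, and its support comes from
  \<open>phom\<close>.\<close>

definition bdiag :: "nat \<Rightarrow> nat \<Rightarrow> 'a mat \<Rightarrow> 'a mat \<Rightarrow> 'a mat" where
  "bdiag r c A B = (\<lambda>i j. if i < r \<and> j < c then A i j
     else if r \<le> i \<and> c \<le> j then B (i - r) (j - c) else \<zero>)"

lemma c_dsum [simp]:
  "c1 (dsum R X Y) = c1 X @ c1 Y" "c0 (dsum R X Y) = c0 X @ c0 Y"
  "cd (dsum R X Y) = bdiag (length (c0 X)) (length (c1 X)) (cd X) (cd Y)"
  unfolding dsum_def c1_def c0_def cd_def bdiag_def by simp_all

lemma bdiag_MC: "A \<in> MC \<Longrightarrow> B \<in> MC \<Longrightarrow> bdiag r c A B \<in> MC"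
  unfolding MC_def bdiag_def by auto

lemma bdiag_H:
  assumes "A \<in> H P Q" "B \<in> H P' Q'"
  shows "bdiag (length Q) (length P) A B \<in> H (P @ P') (Q @ Q')"
  by (rule H_I) (use H_closed[OF assms(1)] H_closed[OF assms(2)] H_left[OF assms(1)] H_left[OF assms(2)]
      H_right[OF assms(1)] H_right[OF assms(2)]
      in \<open>auto simp: bdiag_def nth_append intro!: H_zero[OF assms(2)]\<close>)

lemma bdiag_mc:
  assumes "A \<in> MC" "B \<in> MC" "A' \<in> MC" "B' \<in> MC"
  shows "bdiag r m A B \<star>\<^bsub>m + n\<^esub> bdiag m c A' B' = bdiag r c (A \<star>\<^bsub>m\<^esub> A') (B \<star>\<^bsub>n\<^esub> B')"
proof (intro ext)
  fix i k
  let ?f = "\<lambda>j. bdiag r m A B i j \<otimes> bdiag m c A' B' j k"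
  have cl: "?f j \<in> carrier R" for j
    using assms bdiag_MC by simp
  have 1: "(\<Oplus>j\<in>{..<m}. ?f j) = (if i < r \<and> k < c then (A \<star>\<^bsub>m\<^esub> A') i k else \<zero>)"
  proof (cases "i < r \<and> k < c")
    case True
    then show ?thesis
      by (simp add: mcomp_def, intro finsum_cong') (use assms in \<open>auto simp: bdiag_def\<close>)
  next
    case False
    have "(\<Oplus>j\<in>{..<m}. ?f j) = \<zero>"
      by (rule finsum_zero_terms) (use assms False in \<open>auto simp: bdiag_def\<close>)
    then show ?thesis using False by auto
  qed
  have 2: "(\<Oplus>j\<in>{..<n}. ?f (m + j)) = (if r \<le> i \<and> c \<le> k then (B \<star>\<^bsub>n\<^esub> B') (i - r) (k - c) else \<zero>)"
  proof (cases "r \<le> i \<and> c \<le> k")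
    case True
    then show ?thesis
      by (simp add: mcomp_def, intro finsum_cong') (use assms in \<open>auto simp: bdiag_def\<close>)
  next
    case False
    have "(\<Oplus>j\<in>{..<n}. ?f (m + j)) = \<zero>"
      by (rule finsum_zero_terms) (use assms False in \<open>auto simp: bdiag_def\<close>)
    then show ?thesis using False by auto
  qed
  have "(bdiag r m A B \<star>\<^bsub>m + n\<^esub> bdiag m c A' B') i k = (\<Oplus>j\<in>{..<m}. ?f j) \<oplus> (\<Oplus>j\<in>{..<n}. ?f (m + j))"
    unfolding mcomp_def by (rule finsum_lessThan_add) (rule cl)
  also have "\<dots> = bdiag r c (A \<star>\<^bsub>m\<^esub> A') (B \<star>\<^bsub>n\<^esub> B') i k"
    unfolding 1 2 using mc_MC[OF assms(1,3)] mc_MC[OF assms(2,4)] by (auto simp: bdiag_def)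
  finally show "(bdiag r m A B \<star>\<^bsub>m + n\<^esub> bdiag m c A' B') i k = bdiag r c (A \<star>\<^bsub>m\<^esub> A') (B \<star>\<^bsub>n\<^esub> B') i k" .
qed

lemma bdiag_ma: "bdiag r c A B \<boxplus> bdiag r c A' B' = bdiag r c (A \<boxplus> A') (B \<boxplus> B')"
  by (intro ext) (simp add: bdiag_def madd_def)

lemma bdiag_I: "I (P @ Q) = bdiag (length P) (length P) (I P) (I Q)"
  by (auto simp: bdiag_def mid_def nth_append intro!: ext)

lemma wf_dsum: "wf X \<Longrightarrow> wf Y \<Longrightarrow> wf (dsum R X Y)"
  using bdiag_H unfolding wf_cx_def c_dsum by simp

lemma htpy_inv_dsum:
  assumes wf: "wf X" "wf X'" "wf Y" "wf Y'"
    and X: "htpy_inv X X' f1 f0 g1 g0 h" and Y: "htpy_inv Y Y' f1' f0' g1' g0' h'"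
  shows "htpy_inv (dsum R X Y) (dsum R X' Y')
     (bdiag (length (c1 X')) (length (c1 X)) f1 f1') (bdiag (length (c0 X')) (length (c0 X)) f0 f0')
     (bdiag (length (c1 X)) (length (c1 X')) g1 g1') (bdiag (length (c0 X)) (length (c0 X')) g0 g0')
     (bdiag (length (c1 X)) (length (c0 X)) h h')"
proof -
  note x = X[unfolded htpy_inv_def] and y = Y[unfolded htpy_inv_def]
  have f: "f1 \<in> H (c1 X) (c1 X')" "f0 \<in> H (c0 X) (c0 X')" "g1 \<in> H (c1 X') (c1 X)"
    "g0 \<in> H (c0 X') (c0 X)" "h \<in> H (c0 X) (c1 X)" using x by blast+
  have f': "f1' \<in> H (c1 Y) (c1 Y')" "f0' \<in> H (c0 Y) (c0 Y')" "g1' \<in> H (c1 Y') (c1 Y)"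
    "g0' \<in> H (c0 Y') (c0 Y)" "h' \<in> H (c0 Y) (c1 Y)" using y by blast+
  have MC: "f1 \<in> MC" "f0 \<in> MC" "g1 \<in> MC" "g0 \<in> MC" "h \<in> MC"
     "f1' \<in> MC" "f0' \<in> MC" "g1' \<in> MC" "g0' \<in> MC" "h' \<in> MC"
     "cd X \<in> MC" "cd X' \<in> MC" "cd Y \<in> MC" "cd Y' \<in> MC"
    using f[THEN H_MC] f'[THEN H_MC] wf[THEN wf_cd, THEN H_MC] by auto
  have eqs: "cd X' \<star>\<^bsub>length (c1 X')\<^esub> f1 = f0 \<star>\<^bsub>length (c0 X)\<^esub> cd X"
     "cd Y' \<star>\<^bsub>length (c1 Y')\<^esub> f1' = f0' \<star>\<^bsub>length (c0 Y)\<^esub> cd Y"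
     "cd X \<star>\<^bsub>length (c1 X)\<^esub> g1 = g0 \<star>\<^bsub>length (c0 X')\<^esub> cd X'"
     "cd Y \<star>\<^bsub>length (c1 Y)\<^esub> g1' = g0' \<star>\<^bsub>length (c0 Y')\<^esub> cd Y'"
     "I (c1 X) = g1 \<star>\<^bsub>length (c1 X')\<^esub> f1 \<boxplus> h \<star>\<^bsub>length (c0 X)\<^esub> cd X"
     "I (c0 X) = g0 \<star>\<^bsub>length (c0 X')\<^esub> f0 \<boxplus> cd X \<star>\<^bsub>length (c1 X)\<^esub> h"
     "I (c1 Y) = g1' \<star>\<^bsub>length (c1 Y')\<^esub> f1' \<boxplus> h' \<star>\<^bsub>length (c0 Y)\<^esub> cd Y"
     "I (c0 Y) = g0' \<star>\<^bsub>length (c0 Y')\<^esub> f0' \<boxplus> cd Y \<star>\<^bsub>length (c1 Y)\<^esub> h'"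
    using x y by blast+
  show ?thesis
    unfolding htpy_inv_def c_dsum
    by (intro conjI bdiag_H f f'; simp only: length_append bdiag_mc MC bdiag_ma bdiag_I eqs)
qed

lemma iso_dsum:
  assumes wf: "wf X" "wf X'" "wf Y" "wf Y'" and "iso X X'" "iso Y Y'"
  shows "iso (dsum R X Y) (dsum R X' Y')"
proof -
  obtain f1 f0 g1 g0 h k where 1: "htpy_inv X X' f1 f0 g1 g0 h" "htpy_inv X' X g1 g0 f1 f0 k"
    using assms iso_iff by blast
  obtain f1' f0' g1' g0' h' k' where 2: "htpy_inv Y Y' f1' f0' g1' g0' h'" "htpy_inv Y' Y g1' g0' f1' f0' k'"
    using assms iso_iff by blast
  note 3 = iso_iff[OF wf_dsum[OF wf(1,3)] wf_dsum[OF wf(2,4)]]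
  show ?thesis
    unfolding 3
    by (intro exI conjI) (rule htpy_inv_dsum[OF wf 1(1) 2(1)], rule htpy_inv_dsum[OF wf(2,1,4,3) 1(2) 2(2)])
qed

lemma indecK_wf: "indecK R e1 e2 T \<Longrightarrow> wf T"
  and indecK_nonzero: "indecK R e1 e2 T \<Longrightarrow> \<not> zeroK R e1 e2 T"
  by (simp_all add: indecK_def)

lemma indecK_split:
  assumes "indecK R e1 e2 T" "wf X" "wf Y" "iso T (dsum R X Y)"
  shows "zeroK R e1 e2 X \<or> zeroK R e1 e2 Y"
  using assms(1)[unfolded indecK_def] assms(2-) by meson

lemma indecK_iso:
  assumes "indecK R e1 e2 T" "wf T'" "iso T T'"
  shows "indecK R e1 e2 T'"
  unfolding indecK_def
proof (intro conjI allI impI)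
  note T = indecK_wf[OF assms(1)]
  show "\<not> zeroK R e1 e2 T'"
    using zeroK_iso[OF T assms(2,3)] indecK_nonzero[OF assms(1)] by blast
  show "wf T'" by fact
  fix X Y assume XY: "wf X \<and> wf Y \<and> iso T' (dsum R X Y)"
  then have "iso T (dsum R X Y)"
    by (intro iso_trans[OF T assms(2) _ assms(3)] wf_dsum) auto
  then show "zeroK R e1 e2 X \<or> zeroK R e1 e2 Y"
    using indecK_split[OF assms(1)] XY by simp
qed

lemma wf_zero_cx: "wf (zero_cx R)"
  by (simp add: wf_cx_def zero_cx_def c1_def c0_def cd_def)

lemma wf_dsum_list: "(\<And>T. T \<in> set Ts \<Longrightarrow> wf T) \<Longrightarrow> wf (dsum_list R Ts)"
  by (induction Ts) (auto simp: dsum_list_def wf_zero_cx wf_dsum)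

lemma c_dsum_list:
  "set (c0 (dsum_list R Ts)) = (\<Union>T\<in>set Ts. set (c0 T))"
  "set (c1 (dsum_list R Ts)) = (\<Union>T\<in>set Ts. set (c1 T))"
  by (induction Ts) (auto simp: dsum_list_def zero_cx_def c0_def c1_def dsum_def)

lemma iso_dsum_list:
  assumes "\<And>T. T \<in> set Ts \<Longrightarrow> wf T \<and> wf (F T) \<and> iso T (F T)"
  shows "iso (dsum_list R Ts) (dsum_list R (map F Ts))"
  using assms
proof (induction Ts)
  case Nil
  then show ?case by (simp add: dsum_list_def iso_refl wf_zero_cx)
next
  case (Cons T Ts)
  have "wf (dsum_list R Ts)" "wf (dsum_list R (map F Ts))"
    by (rule wf_dsum_list; use Cons.prems in auto)+
  then show ?case
    using Cons iso_dsum[of T "F T" "dsum_list R Ts" "dsum_list R (map F Ts)"]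
    by (simp add: dsum_list_def)
qed

end

section \<open>Gaussian elimination\<close>

context idem2
begin

definition unit_mat :: "nat \<Rightarrow> nat \<Rightarrow> 'a \<Rightarrow> 'a mat" where
  "unit_mat a b x = (\<lambda>i j. if i = a \<and> j = b then x else \<zero>)"

lemma unit_mat_MC [simp]: "x \<in> carrier R \<Longrightarrow> unit_mat a b x \<in> MC"
  unfolding MC_def unit_mat_def by auto

lemma unit_mat_H:
  assumes "a < length Q" "b < length P" "x \<in> carrier R" "E (Q!a) \<otimes> x = x" "x \<otimes> E (P!b) = x"
  shows "unit_mat a b x \<in> H P Q"
  by (rule H_I) (use assms in \<open>auto simp: unit_mat_def\<close>)

lemma unit_mat_mc:
  assumes "b < n" "M \<in> MC" "x \<in> carrier R"
  shows "unit_mat a b x \<star>\<^bsub>n\<^esub> M = (\<lambda>i k. if i = a then x \<otimes> M b k else \<zero>)"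
proof (intro ext)
  fix i k
  have "(unit_mat a b x \<star>\<^bsub>n\<^esub> M) i k = unit_mat a b x i b \<otimes> M b k"
    unfolding mcomp_def
    by (rule finsum_single_term) (use assms in \<open>auto simp: unit_mat_def\<close>)
  then show "(unit_mat a b x \<star>\<^bsub>n\<^esub> M) i k = (if i = a then x \<otimes> M b k else \<zero>)"
    using assms by (simp add: unit_mat_def)
qed

lemma mc_unit_mat:
  assumes "a < n" "M \<in> MC" "x \<in> carrier R"
  shows "M \<star>\<^bsub>n\<^esub> unit_mat a b x = (\<lambda>i k. if k = b then M i a \<otimes> x else \<zero>)"
proof (intro ext)
  fix i k
  have "(M \<star>\<^bsub>n\<^esub> unit_mat a b x) i k = M i a \<otimes> unit_mat a b x a k"
    unfolding mcomp_def
    by (rule finsum_single_term) (use assms in \<open>auto simp: unit_mat_def\<close>)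
  then show "(M \<star>\<^bsub>n\<^esub> unit_mat a b x) i k = (if k = b then M i a \<otimes> x else \<zero>)"
    using assms by (simp add: unit_mat_def)
qed

definition del :: "nat \<Rightarrow> nat list \<Rightarrow> nat list" where
  "del i P = take i P @ drop (Suc i) P"

text \<open>The coface map omitting \<open>i\<close>: it sends a position in \<open>del i P\<close>
  to the position of the same summand in \<open>P\<close>.\<close>

definition skip :: "nat \<Rightarrow> nat \<Rightarrow> nat" where
  "skip i b = (if b < i then b else Suc b)"

text \<open>The inclusion of the summands other than the i-th; \<open>prj\<close> is the projection
  onto them.\<close>

definition inc :: "nat \<Rightarrow> nat list \<Rightarrow> 'a mat" where
  "inc i P = (\<lambda>a b. if b < length P - 1 \<and> a = skip i b then E (P!a) else \<zero>)"

definition prj :: "nat \<Rightarrow> nat list \<Rightarrow> 'a mat" where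
  "prj i P = (\<lambda>b a. if b < length P - 1 \<and> a = skip i b then E (P!a) else \<zero>)"

lemma length_del: "i < length P \<Longrightarrow> length (del i P) = length P - 1"
  by (simp add: del_def)

lemma nth_del: "i < length P \<Longrightarrow> b < length P - 1 \<Longrightarrow> del i P ! b = P ! skip i b"
  by (auto simp: del_def skip_def nth_append min_def)

lemma skip_less: "i < length P \<Longrightarrow> b < length P - 1 \<Longrightarrow> skip i b < length P"
  by (auto simp: skip_def)

lemma skip_inj: "skip i b = skip i b' \<longleftrightarrow> b = b'"
  by (auto simp: skip_def)

lemma skip_neq: "skip i b \<noteq> i" "i \<noteq> skip i b"
  by (auto simp: skip_def)

lemma skip_surj:
  assumes "i < length P" "a < length P" "a \<noteq> i"
  obtains b where "b < length P - 1" "a = skip i b"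
proof (cases "a < i")
  case True
  then show ?thesis using that[of a] assms by (auto simp: skip_def)
next
  case False
  then show ?thesis using that[of "a - 1"] assms by (auto simp: skip_def)
qed

lemma inc_H: assumes "i < length P" shows "inc i P \<in> H (del i P) P"
  by (rule H_I) (use assms skip_less[OF assms] in \<open>auto simp: inc_def length_del nth_del\<close>)

lemma prj_H: assumes "i < length P" shows "prj i P \<in> H P (del i P)"
  by (rule H_I) (use assms skip_less[OF assms] in \<open>auto simp: prj_def length_del nth_del\<close>)

lemma prj_inc:
  assumes "i < length P" shows "prj i P \<star>\<^bsub>length P\<^esub> inc i P = I (del i P)"
proof (intro ext)
  fix b b'
  note [simp] = prj_H[OF assms, THEN H_MC] inc_H[OF assms, THEN H_MC]
  show "(prj i P \<star>\<^bsub>length P\<^esub> inc i P) b b' = I (del i P) b b'"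
  proof (cases "b < length P - 1")
    case True
    have "(prj i P \<star>\<^bsub>length P\<^esub> inc i P) b b' = prj i P b (skip i b) \<otimes> inc i P (skip i b) b'"
      unfolding mcomp_def
      by (rule finsum_single_term) (use skip_less[OF assms True] in \<open>auto simp: prj_def\<close>)
    also have "\<dots> = I (del i P) b b'"
      using True assms by (auto simp: prj_def inc_def mid_def length_del nth_del skip_inj)
    finally show ?thesis .
  next
    case False
    have "(prj i P \<star>\<^bsub>length P\<^esub> inc i P) b b' = \<zero>"
      unfolding mcomp_def
      by (rule finsum_zero_terms) (use False in \<open>auto simp: prj_def\<close>)
    then show ?thesis using False assms by (simp add: mid_def length_del)
  qed
qed

lemma inc_prj:
  assumes "i < length P"
  shows "I P = inc i P \<star>\<^bsub>length (del i P)\<^esub> prj i P \<boxplus> unit_mat i i (E (P!i))"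
proof (intro ext)
  fix a a'
  note [simp] = prj_H[OF assms, THEN H_MC] inc_H[OF assms, THEN H_MC]
  consider "a < length P" "a \<noteq> i" | "a = i" | "\<not> a < length P" by blast
  then show "I P a a' = (inc i P \<star>\<^bsub>length (del i P)\<^esub> prj i P \<boxplus> unit_mat i i (E (P!i))) a a'"
  proof cases
    case 1
    then obtain b where b: "b < length P - 1" "a = skip i b" using skip_surj[OF assms] by blast
    have "(inc i P \<star>\<^bsub>length (del i P)\<^esub> prj i P) a a' = inc i P a b \<otimes> prj i P b a'"
      unfolding mcomp_def
      by (rule finsum_single_term) (use b assms in \<open>auto simp: inc_def length_del skip_inj\<close>)
    also have "\<dots> = (if a' = a then E (P!a) else \<zero>)"
      using b by (auto simp: inc_def prj_def)
    finally show ?thesis using 1 by (auto simp: madd_def unit_mat_def mid_def)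
  next
    case 2
    have "(inc i P \<star>\<^bsub>length (del i P)\<^esub> prj i P) a a' = \<zero>"
      unfolding mcomp_def
      by (rule finsum_zero_terms) (use 2 skip_neq in \<open>auto simp: inc_def\<close>)
    then show ?thesis using 2 assms by (auto simp: madd_def unit_mat_def mid_def)
  next
    case 3
    have "(inc i P \<star>\<^bsub>length (del i P)\<^esub> prj i P) a a' = \<zero>"
      unfolding mcomp_def
      by (rule finsum_zero_terms) (use 3 skip_less[OF assms] in \<open>auto simp: inc_def\<close>)
    then show ?thesis using 3 assms by (auto simp: madd_def unit_mat_def mid_def)
  qed
qed

text \<open>With \<open>U\<close> the matrix whose only entry is \<open>v\<close>, the complex splits off a contractible summand via the
  projections \<open>1 - d U\<close> and \<open>1 - U d\<close>.\<close>

lemma eliminate_unit_entry: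
  assumes wf: "wf T" and i: "i < length (c0 T)" and j: "j < length (c1 T)"
    and l: "c0 T ! i = l" "c1 T ! j = l"
    and v: "v \<in> carrier R" "E l \<otimes> v = v" "v \<otimes> E l = v"
      "cd T i j \<otimes> v = E l" "v \<otimes> cd T i j = E l"
  shows "\<exists>d. wf (del j (c1 T), del i (c0 T), d) \<and> iso T (del j (c1 T), del i (c0 T), d)"
proof -
  define P1 P0 d where defs: "P1 = c1 T" "P0 = c0 T" "d = cd T"
  define m n where mn: "m = length P1" "n = length P0"
  define m' n' where mn': "m' = length (del j P1)" "n' = length (del i P0)"
  have i': "i < length P0" and j': "j < length P1" using i j by (auto simp: defs)
  have d: "d \<in> H P1 P0" using wf_cd[OF wf] by (simp add: defs)
  define U where "U = unit_mat j i v"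
  have U: "U \<in> H P0 P1"
    unfolding U_def by (rule unit_mat_H) (use i j l v in \<open>auto simp: defs\<close>)
  define W0 W1 where W: "W0 = I P0 \<boxplus> mneg R (d \<star>\<^bsub>m\<^esub> U)" "W1 = I P1 \<boxplus> mneg R (U \<star>\<^bsub>n\<^esub> d)"
  have W0: "W0 \<in> H P0 P0" and W1: "W1 \<in> H P1 P1"
    unfolding W mn by (intro ma_H mneg_H mc_H I_H d U)+
  define i0 p0 i1 p1 where ip: "i0 = inc i P0" "p0 = prj i P0" "i1 = inc j P1" "p1 = prj j P1"
  have ipH: "i0 \<in> H (del i P0) P0" "p0 \<in> H P0 (del i P0)" "i1 \<in> H (del j P1) P1" "p1 \<in> H P1 (del j P1)"
    unfolding ip by (intro inc_H prj_H i' j')+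
  define E0 E1 where E01: "E0 = unit_mat i i (E l)" "E1 = unit_mat j j (E l)"
  have EH: "E0 \<in> H P0 P0" "E1 \<in> H P1 P1"
    unfolding E01 by (rule unit_mat_H; use i j l in \<open>auto simp: defs\<close>)+
  note [simp] = ipH[THEN H_MC] H_MC[OF d] H_MC[OF U] H_MC[OF W0] H_MC[OF W1] EH[THEN H_MC]
    H_MC[OF I_H]
  have one0: "I P0 = W0 \<boxplus> d \<star>\<^bsub>m\<^esub> U" and one1: "I P1 = W1 \<boxplus> U \<star>\<^bsub>n\<^esub> d"
  proof -
    have "A = A \<boxplus> mneg R B \<boxplus> B" if "A \<in> MC" "B \<in> MC" for A B
      using that by (simp add: madd_def mneg_def a_assoc l_neg)
    then show "I P0 = W0 \<boxplus> d \<star>\<^bsub>m\<^esub> U" "I P1 = W1 \<boxplus> U \<star>\<^bsub>n\<^esub> d"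
      unfolding W by simp_all
  qed
  have pi0: "p0 \<star>\<^bsub>n\<^esub> i0 = I (del i P0)" and pi1: "p1 \<star>\<^bsub>m\<^esub> i1 = I (del j P1)"
    unfolding ip mn by (rule prj_inc[OF i'], rule prj_inc[OF j'])
  have ip0: "I P0 = i0 \<star>\<^bsub>n'\<^esub> p0 \<boxplus> E0" and ip1: "I P1 = i1 \<star>\<^bsub>m'\<^esub> p1 \<boxplus> E1"
    using inc_prj[OF i'] inc_prj[OF j'] l unfolding ip mn' E01 by (simp_all add: defs)
  have dv: "d i j \<otimes> v = E l" "v \<otimes> d i j = E l" using v by (auto simp: defs)
  \<comment> \<open>Only column i of d U is nonzero, and its entry in row i is d i j v = e_l. Hence
    row i of W0 = 1 - d U vanishes.\<close>
  have E0dU: "E0 \<star>\<^bsub>n\<^esub> (d \<star>\<^bsub>m\<^esub> U) = E0"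
  proof -
    have "E0 \<star>\<^bsub>n\<^esub> (d \<star>\<^bsub>m\<^esub> U) = (\<lambda>a k. if a = i then E l \<otimes> (d \<star>\<^bsub>m\<^esub> U) i k else \<zero>)"
      unfolding E01 by (rule unit_mat_mc) (use i' mn in auto)
    moreover have "d \<star>\<^bsub>m\<^esub> U = (\<lambda>a k. if k = i then d a j \<otimes> v else \<zero>)"
      unfolding U_def by (rule mc_unit_mat) (use j' mn v in auto)
    ultimately show ?thesis unfolding E01 unit_mat_def using dv by (auto intro!: ext)
  qed
  have UdE1: "(U \<star>\<^bsub>n\<^esub> d) \<star>\<^bsub>m\<^esub> E1 = E1"
  proof -
    have "(U \<star>\<^bsub>n\<^esub> d) \<star>\<^bsub>m\<^esub> E1 = (\<lambda>a k. if k = j then (U \<star>\<^bsub>n\<^esub> d) a j \<otimes> E l else \<zero>)"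
      unfolding E01 by (rule mc_unit_mat) (use j' mn in auto)
    moreover have "U \<star>\<^bsub>n\<^esub> d = (\<lambda>a k. if a = j then v \<otimes> d i k else \<zero>)"
      unfolding U_def by (rule unit_mat_mc) (use i' mn v in auto)
    ultimately show ?thesis unfolding E01 unit_mat_def using dv by (auto intro!: ext)
  qed
  \<comment> \<open>U takes values in the j-th summand, which p1 kills. It also vanishes on the
    image of i0, which misses the i-th summand.\<close>
  have p1U: "p1 \<star>\<^bsub>m\<^esub> U = Z"
    unfolding U_def using v i' j' ipH[THEN H_MC]
    by (simp add: mc_unit_mat mn) (auto simp: ip prj_def skip_neq intro!: ext)
  have Ui0: "U \<star>\<^bsub>n\<^esub> i0 = Z"
    unfolding U_def using v i' j' ipH[THEN H_MC]
    by (simp add: unit_mat_mc mn) (auto simp: ip inc_def skip_neq intro!: ext)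
  note I0r = mc_I_right[where P=P0, folded mn] and I0l = mc_I_left[where Q=P0, folded mn]
    and I1r = mc_I_right[where P=P1, folded mn] and I1l = mc_I_left[where Q=P1, folded mn]
  \<comment> \<open>Both sides are d - d U d.\<close>
  have W0d: "W0 \<star>\<^bsub>n\<^esub> d = d \<star>\<^bsub>m\<^esub> W1"
  proof (rule ma_right_cancel[where C="d \<star>\<^bsub>m\<^esub> (U \<star>\<^bsub>n\<^esub> d)"])
    have "W0 \<star>\<^bsub>n\<^esub> d \<boxplus> d \<star>\<^bsub>m\<^esub> (U \<star>\<^bsub>n\<^esub> d) = I P0 \<star>\<^bsub>n\<^esub> d"
      unfolding one0 by (simp add: mc_add_left mc_assoc)
    also have "\<dots> = d \<star>\<^bsub>m\<^esub> I P1" using I0l[OF d] I1r[OF d] by simp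
    also have "\<dots> = d \<star>\<^bsub>m\<^esub> W1 \<boxplus> d \<star>\<^bsub>m\<^esub> (U \<star>\<^bsub>n\<^esub> d)"
      unfolding one1 by (simp add: mc_add_right)
    finally show "W0 \<star>\<^bsub>n\<^esub> d \<boxplus> d \<star>\<^bsub>m\<^esub> (U \<star>\<^bsub>n\<^esub> d) = d \<star>\<^bsub>m\<^esub> W1 \<boxplus> d \<star>\<^bsub>m\<^esub> (U \<star>\<^bsub>n\<^esub> d)" .
  qed auto
  have E0W0: "E0 \<star>\<^bsub>n\<^esub> W0 = Z"
  proof (rule ma_right_cancel[where C=E0])
    have "E0 \<star>\<^bsub>n\<^esub> I P0 = E0 \<star>\<^bsub>n\<^esub> W0 \<boxplus> E0"
      unfolding one0 by (simp add: mc_add_right E0dU)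
    then show "E0 \<star>\<^bsub>n\<^esub> W0 \<boxplus> E0 = Z \<boxplus> E0" using I0r[OF EH(1)] by simp
  qed auto
  have W1E1: "W1 \<star>\<^bsub>m\<^esub> E1 = Z"
  proof (rule ma_right_cancel[where C=E1])
    have "I P1 \<star>\<^bsub>m\<^esub> E1 = W1 \<star>\<^bsub>m\<^esub> E1 \<boxplus> E1"
      unfolding one1 by (simp add: mc_add_left UdE1)
    then show "W1 \<star>\<^bsub>m\<^esub> E1 \<boxplus> E1 = Z \<boxplus> E1" using I1l[OF EH(2)] by simp
  qed auto
  have ipW0: "i0 \<star>\<^bsub>n'\<^esub> (p0 \<star>\<^bsub>n\<^esub> W0) = W0"
  proof -
    have "W0 = I P0 \<star>\<^bsub>n\<^esub> W0" using I0l[OF W0] by simp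
    also have "\<dots> = i0 \<star>\<^bsub>n'\<^esub> (p0 \<star>\<^bsub>n\<^esub> W0)"
      unfolding ip0 by (simp add: mc_add_left E0W0 mc_assoc)
    finally show ?thesis by simp
  qed
  have W1ip: "W1 \<star>\<^bsub>m\<^esub> (i1 \<star>\<^bsub>m'\<^esub> p1) = W1"
  proof -
    have "W1 = W1 \<star>\<^bsub>m\<^esub> I P1" using I1r[OF W1] by simp
    also have "\<dots> = W1 \<star>\<^bsub>m\<^esub> (i1 \<star>\<^bsub>m'\<^esub> p1)"
      unfolding ip1 by (simp add: mc_add_right W1E1 mc_assoc)
    finally show ?thesis by simp
  qed
  have pWi1: "p1 \<star>\<^bsub>m\<^esub> (W1 \<star>\<^bsub>m\<^esub> i1) = I (del j P1)"
  proof -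
    have "I (del j P1) = p1 \<star>\<^bsub>m\<^esub> (I P1 \<star>\<^bsub>m\<^esub> i1)" using I1l[OF ipH(3)] pi1 by simp
    also have "\<dots> = p1 \<star>\<^bsub>m\<^esub> (W1 \<star>\<^bsub>m\<^esub> i1) \<boxplus> (p1 \<star>\<^bsub>m\<^esub> U) \<star>\<^bsub>n\<^esub> (d \<star>\<^bsub>m\<^esub> i1)"
      unfolding one1 by (simp add: mc_add_left mc_add_right mc_assoc)
    finally show ?thesis unfolding p1U by simp
  qed
  have pWi0: "p0 \<star>\<^bsub>n\<^esub> (W0 \<star>\<^bsub>n\<^esub> i0) = I (del i P0)"
  proof -
    have "I (del i P0) = p0 \<star>\<^bsub>n\<^esub> (I P0 \<star>\<^bsub>n\<^esub> i0)" using I0l[OF ipH(1)] pi0 by simp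
    also have "\<dots> = p0 \<star>\<^bsub>n\<^esub> (W0 \<star>\<^bsub>n\<^esub> i0) \<boxplus> p0 \<star>\<^bsub>n\<^esub> (d \<star>\<^bsub>m\<^esub> (U \<star>\<^bsub>n\<^esub> i0))"
      unfolding one0 by (simp add: mc_add_left mc_add_right mc_assoc)
    finally show ?thesis unfolding Ui0 by simp
  qed
  \<comment> \<open>The Schur complement of the invertible entry: for a other than i and b other
    than j, the entries are d a b - (d a j) v (d i b).\<close>
  define d' where "d' = p0 \<star>\<^bsub>n\<^esub> (W0 \<star>\<^bsub>n\<^esub> (d \<star>\<^bsub>m\<^esub> i1))"
  have d': "d' \<in> H (del j P1) (del i P0)"
    unfolding d'_def mn by (intro mc_H ipH W0 d)
  let ?T = "(del j P1, del i P0, d')"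
  have c: "c1 ?T = del j P1" "c0 ?T = del i P0" "cd ?T = d'" by (simp_all add: c1_def c0_def cd_def)
  have "set (del j P1) \<subseteq> set P1" "set (del i P0) \<subseteq> set P0"
    by (auto simp: del_def dest: in_set_takeD in_set_dropD)
  then have wf': "wf ?T" using wf d' unfolding wf_cx_def c by (auto simp: defs)
  have 1: "d' \<star>\<^bsub>m'\<^esub> p1 = (p0 \<star>\<^bsub>n\<^esub> W0) \<star>\<^bsub>n\<^esub> d"
  proof -
    have "d' \<star>\<^bsub>m'\<^esub> p1 = p0 \<star>\<^bsub>n\<^esub> ((W0 \<star>\<^bsub>n\<^esub> d) \<star>\<^bsub>m\<^esub> (i1 \<star>\<^bsub>m'\<^esub> p1))"
      unfolding d'_def by (simp add: mc_assoc)
    also have "\<dots> = p0 \<star>\<^bsub>n\<^esub> (d \<star>\<^bsub>m\<^esub> (W1 \<star>\<^bsub>m\<^esub> (i1 \<star>\<^bsub>m'\<^esub> p1)))"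
      unfolding W0d by (simp add: mc_assoc)
    also have "\<dots> = (p0 \<star>\<^bsub>n\<^esub> W0) \<star>\<^bsub>n\<^esub> d"
      unfolding W1ip W0d[symmetric] by (simp add: mc_assoc)
    finally show ?thesis .
  qed
  have 2: "d \<star>\<^bsub>m\<^esub> (W1 \<star>\<^bsub>m\<^esub> i1) = i0 \<star>\<^bsub>n'\<^esub> d'"
  proof -
    have "i0 \<star>\<^bsub>n'\<^esub> d' = (i0 \<star>\<^bsub>n'\<^esub> (p0 \<star>\<^bsub>n\<^esub> W0)) \<star>\<^bsub>n\<^esub> (d \<star>\<^bsub>m\<^esub> i1)"
      unfolding d'_def by (simp add: mc_assoc)
    also have "\<dots> = (W0 \<star>\<^bsub>n\<^esub> d) \<star>\<^bsub>m\<^esub> i1" unfolding ipW0 by (simp add: mc_assoc)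
    also have "\<dots> = d \<star>\<^bsub>m\<^esub> (W1 \<star>\<^bsub>m\<^esub> i1)" unfolding W0d by (simp add: mc_assoc)
    finally show ?thesis by simp
  qed
  have fg: "p0 \<star>\<^bsub>n\<^esub> W0 \<in> H P0 (del i P0)" "W1 \<star>\<^bsub>m\<^esub> i1 \<in> H (del j P1) P1"
    unfolding mn by (intro mc_H ipH W0 W1)+
  have 3: "I P1 = (W1 \<star>\<^bsub>m\<^esub> i1) \<star>\<^bsub>m'\<^esub> p1 \<boxplus> U \<star>\<^bsub>n\<^esub> d"
    unfolding one1 by (simp add: mc_assoc W1ip)
  have 4: "I P0 = i0 \<star>\<^bsub>n'\<^esub> (p0 \<star>\<^bsub>n\<^esub> W0) \<boxplus> d \<star>\<^bsub>m\<^esub> U"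
    unfolding one0 by (simp add: ipW0)
  \<comment> \<open>On the large complex the round trip is the identity up to the homotopy U; on the
    small one it is strictly the identity, hence the homotopy \<open>Z\<close> in the second
    half.\<close>
  have "htpy_inv T ?T p1 (p0 \<star>\<^bsub>n\<^esub> W0) (W1 \<star>\<^bsub>m\<^esub> i1) i0 U"
    unfolding htpy_inv_def c defs[symmetric] mn[symmetric] mn'[symmetric]
    using ipH fg U 1 2 3 4 by blast
  moreover have "htpy_inv ?T T (W1 \<star>\<^bsub>m\<^esub> i1) i0 p1 (p0 \<star>\<^bsub>n\<^esub> W0) Z"
    unfolding htpy_inv_def c defs[symmetric] mn[symmetric] mn'[symmetric]
    using ipH fg 1 2 pWi1 pWi0 H_MC[OF d'] by (simp add: mc_assoc)
  ultimately have "iso T ?T" using iso_iff[OF wf wf'] by blast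
  then show ?thesis using wf' unfolding defs by blast
qed

end

section \<open>Minimal complexes over an elementary algebra\<close>

text \<open>The last assumption expresses that the common kernel of the two characters lies in the Jacobson
  radical. \<open>\<chi> i\<close> matters only for \<open>i \<in> {1,2}\<close>.\<close>

locale elem2 = idem2 R e1 e2 for R :: "'a ring" (structure) and e1 e2 :: 'a +
  fixes \<chi> :: "nat \<Rightarrow> 'a \<Rightarrow> 'k::field"
  assumes \<chi>_add: "x \<in> carrier R \<Longrightarrow> y \<in> carrier R \<Longrightarrow> \<chi> i (x \<oplus> y) = \<chi> i x + \<chi> i y"
    and \<chi>_mult: "x \<in> carrier R \<Longrightarrow> y \<in> carrier R \<Longrightarrow> \<chi> i (x \<otimes> y) = \<chi> i x * \<chi> i y"
    and \<chi>_surj: "\<exists>y\<in>carrier R. \<chi> i y = c"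
    and \<chi>_E: "i \<in> {1,2} \<Longrightarrow> j \<in> {1,2} \<Longrightarrow> \<chi> i (ev e1 e2 j) = (if i = j then 1 else 0)"
    and quasi_regular: "x \<in> carrier R \<Longrightarrow> \<chi> 1 x = 0 \<Longrightarrow> \<chi> 2 x = 0 \<Longrightarrow> \<exists>y\<in>carrier R. (\<one> \<ominus> x) \<otimes> y = \<one>"
begin

lemma \<chi>_zero [simp]: "\<chi> i \<zero> = 0"
  using \<chi>_add[of \<zero> \<zero> i] by (metis add.right_neutral add_left_imp_eq l_zero zero_closed)

lemma \<chi>_minus: "x \<in> carrier R \<Longrightarrow> \<chi> i (\<ominus> x) = - \<chi> i x"
  using \<chi>_add[of x "\<ominus> x" i] by (simp add: r_neg eq_neg_iff_add_eq_0 add.commute)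

lemma \<chi>_finsum:
  "finite A \<Longrightarrow> (\<And>a. a \<in> A \<Longrightarrow> f a \<in> carrier R) \<Longrightarrow> \<chi> i (\<Oplus>a\<in>A. f a) = (\<Sum>a\<in>A. \<chi> i (f a))"
  by (induction A rule: finite_induct) (auto simp: \<chi>_add Pi_def)

lemma \<chi>_mc:
  assumes "A \<in> MC" "B \<in> MC"
  shows "\<chi> l ((A \<star>\<^bsub>n\<^esub> B) i k) = (\<Sum>j<n. \<chi> l (A i j) * \<chi> l (B j k))"
  unfolding mcomp_def using assms by (simp add: \<chi>_finsum \<chi>_mult)

lemma \<chi>_ma:
  assumes "A \<in> MC" "B \<in> MC"
  shows "\<chi> l ((A \<boxplus> B) i k) = \<chi> l (A i k) + \<chi> l (B i k)"
  unfolding madd_def using assms by (simp add: \<chi>_add)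

lemma \<chi>_I:
  assumes "set P \<subseteq> {1,2}" "l \<in> {1,2}"
  shows "\<chi> l (I P i j) = (if i = j \<and> i < length P \<and> P!i = l then 1 else 0)"
proof (cases "i = j \<and> i < length P")
  case True
  then have "P!i \<in> {1,2}" using assms(1) nth_mem by blast
  then show ?thesis using True \<chi>_E[OF assms(2), of "P!i"] by (auto simp: mid_def)
qed (auto simp: mid_def)

text \<open>The character of index l vanishes on e_m R and on R e_m for m other than l, so it sees
  only entries in e_l R e_l.\<close>

lemma \<chi>_entry:
  assumes "M \<in> H P Q" "set P \<subseteq> {1,2}" "set Q \<subseteq> {1,2}" "l \<in> {1,2}" "\<chi> l (M i j) \<noteq> 0"
  shows "i < length Q \<and> j < length P \<and> Q!i = l \<and> P!j = l"
proof -
  have ij: "i < length Q" "j < length P"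
    using H_zero[OF assms(1), of i j] assms(5) by (metis \<chi>_zero)+
  then have lab: "Q!i \<in> {1,2}" "P!j \<in> {1,2}" using assms(2,3) nth_mem by blast+
  have "\<chi> l (M i j) = \<chi> l (E (Q!i)) * \<chi> l (M i j)" "\<chi> l (M i j) = \<chi> l (M i j) * \<chi> l (E (P!j))"
    using H_left[OF assms(1) ij] H_right[OF assms(1) ij] H_closed[OF assms(1), of i j]
    by (metis E_closed \<chi>_mult)+
  then show ?thesis
    using ij lab assms(4,5) \<chi>_E[OF assms(4) lab(1)] \<chi>_E[OF assms(4) lab(2)] by (metis mult_zero_left mult_zero_right)
qed

text \<open>e_i R e_i is local with residue map \<open>\<chi> i\<close>: after multiplication by a
  suitable y, an element with nonzero residue differs from e_i by an element of the radical.\<close>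

lemma corner_right_unit:
  assumes i: "i \<in> {1,2}" and x: "x \<in> carrier R" "E i \<otimes> x = x" "x \<otimes> E i = x" and ne: "\<chi> i x \<noteq> 0"
  shows "\<exists>v\<in>carrier R. E i \<otimes> v = v \<and> v \<otimes> E i = v \<and> x \<otimes> v = E i"
proof -
  obtain y where y: "y \<in> carrier R" "\<chi> i y = 1 / \<chi> i x" using \<chi>_surj by blast
  \<comment> \<open>z is killed by both characters: by the i-th through the choice of y, by the
    other because z = e_i z. So 1 - z has a right inverse w, and e_i (1 - z) = x y e_i.\<close>
  define z where "z = E i \<ominus> x \<otimes> y \<otimes> E i"
  have z: "z \<in> carrier R" "E i \<otimes> z = z" "z \<otimes> E i = z"
    using x y unfolding z_def minus_eq
    by (simp_all add: r_distr l_distr r_minus l_minus m_assoc) (simp add: m_assoc[symmetric])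
  have Ei: "\<chi> i (E i) = 1" using \<chi>_E[OF i i] by simp
  have "\<chi> i z = 0"
    using x y ne unfolding z_def minus_eq by (simp add: \<chi>_add \<chi>_mult \<chi>_minus Ei)
  moreover have "\<chi> j z = 0" if "j \<in> {1,2}" "j \<noteq> i" for j
  proof -
    have "\<chi> j z = \<chi> j (E i) * \<chi> j z" using z by (metis E_closed \<chi>_mult)
    then show ?thesis using \<chi>_E[OF that(1) i] that by simp
  qed
  ultimately have "\<chi> 1 z = 0" "\<chi> 2 z = 0" by (metis insertCI)+
  then obtain w where w: "w \<in> carrier R" "(\<one> \<ominus> z) \<otimes> w = \<one>" using quasi_regular z(1) by blast
  have "E i \<otimes> (\<one> \<ominus> z) = E i \<ominus> z"
    using z by (simp add: minus_eq r_distr r_minus)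
  also have "\<dots> = x \<otimes> y \<otimes> E i"
    using x y unfolding z_def minus_eq by (simp add: minus_add a_assoc[symmetric] r_neg)
  finally have "x \<otimes> y \<otimes> E i \<otimes> w = E i \<otimes> ((\<one> \<ominus> z) \<otimes> w)"
    using x y z w by (metis E_closed m_assoc minus_closed one_closed)
  also have "\<dots> = E i" using w by simp
  finally have xyw: "x \<otimes> y \<otimes> E i \<otimes> w = E i" .
  show ?thesis
  proof (intro bexI[of _ "E i \<otimes> y \<otimes> E i \<otimes> w \<otimes> E i"] conjI)
    have "x \<otimes> (E i \<otimes> y \<otimes> E i \<otimes> w \<otimes> E i) = (x \<otimes> E i) \<otimes> y \<otimes> E i \<otimes> w \<otimes> E i"
      using x(1) y w by (simp add: m_assoc)
    then show "x \<otimes> (E i \<otimes> y \<otimes> E i \<otimes> w \<otimes> E i) = E i"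
      unfolding x(3) xyw by simp
  qed (use y w in \<open>simp_all add: m_assoc\<close>)
qed

text \<open>The right inverse v has nonzero residue too, so it has a right inverse u of its own, and
  then u = x v u = x.\<close>

lemma corner_unit:
  assumes i: "i \<in> {1,2}" and x: "x \<in> carrier R" "E i \<otimes> x = x" "x \<otimes> E i = x" and ne: "\<chi> i x \<noteq> 0"
  shows "\<exists>v\<in>carrier R. E i \<otimes> v = v \<and> v \<otimes> E i = v \<and> x \<otimes> v = E i \<and> v \<otimes> x = E i"
proof -
  obtain v where v: "v \<in> carrier R" "E i \<otimes> v = v" "v \<otimes> E i = v" "x \<otimes> v = E i"
    using corner_right_unit[OF assms] by blast
  have "\<chi> i x * \<chi> i v = 1" using \<chi>_mult[OF x(1) v(1), of i] v(4) \<chi>_E[OF i i] by simp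
  then have "\<chi> i v \<noteq> 0" by auto
  then obtain u where u: "u \<in> carrier R" "E i \<otimes> u = u" "v \<otimes> u = E i"
    using corner_right_unit[OF i v(1-3)] by blast
  have "x = x \<otimes> (v \<otimes> u)" using u x by simp
  also have "\<dots> = u" using m_assoc[OF x(1) v(1) u(1)] v u by simp
  finally show ?thesis using v u by blast
qed

text \<open>All entries of the differential lie in the radical. Testing this by the two characters
  turns the vanishing of products into a computation in the field.\<close>

definition minimal :: "'a cx \<Rightarrow> bool" where
  "minimal T \<longleftrightarrow> (\<forall>l\<in>{1,2}. \<forall>i j. \<chi> l (cd T i j) = 0)"

lemma minimal_D: "minimal T \<Longrightarrow> l \<in> {1,2} \<Longrightarrow> \<chi> l (cd T i j) = 0"
  unfolding minimal_def by blast

lemma count_list_del: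
  assumes "i < length P"
  shows "count_list P l = count_list (del i P) l + (if P!i = l then 1 else 0)"
  by (subst id_take_nth_drop[OF assms]) (simp add: del_def)

text \<open>An entry with nonzero residue lies in some e_l R e_l and is invertible there, so it can
  be eliminated. This cancels one copy of P_l in degree 0 against one in degree -1, which keeps the
  g-vector and shortens T^-1.\<close>

lemma exists_minimal:
  assumes "wf T"
  shows "\<exists>T'. wf T' \<and> iso T T' \<and> minimal T' \<and> gvec T' = gvec T"
  using assms
proof (induction "length (c1 T)" arbitrary: T rule: less_induct)
  case less
  show ?case
  proof (cases "minimal T")
    case True
    then show ?thesis using less.prems iso_refl by blast
  next
    case False
    then obtain l i j where l: "l \<in> {1,2}" and ne: "\<chi> l (cd T i j) \<noteq> 0"
      unfolding minimal_def by blast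
    have sets: "set (c1 T) \<subseteq> {1,2}" "set (c0 T) \<subseteq> {1,2}" using less.prems by (auto simp: wf_cx_def)
    note d = wf_cd[OF less.prems]
    have ij: "i < length (c0 T)" "j < length (c1 T)" "c0 T ! i = l" "c1 T ! j = l"
      using \<chi>_entry[OF d sets l ne] by auto
    obtain v where v: "v\<in>carrier R" "E l \<otimes> v = v" "v \<otimes> E l = v" "cd T i j \<otimes> v = E l" "v \<otimes> cd T i j = E l"
      using corner_unit[OF l H_closed[OF d] _ _ ne] H_left[OF d ij(1,2)] H_right[OF d ij(1,2)] ij(3,4) by auto
    obtain d' where T': "wf (del j (c1 T), del i (c0 T), d')" "iso T (del j (c1 T), del i (c0 T), d')"
      using eliminate_unit_entry[OF less.prems ij v] by blast
    let ?T = "(del j (c1 T), del i (c0 T), d')"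
    have "length (c1 ?T) < length (c1 T)" using ij by (simp add: c1_def length_del)
    then obtain T'' where T'': "wf T''" "iso ?T T''" "minimal T''" "gvec T'' = gvec ?T"
      using less.hyps T' by blast
    have "gvec ?T = gvec T"
      using count_list_del[OF ij(1)] count_list_del[OF ij(2)] ij(3,4)
      by (simp add: gvec_def c1_def c0_def)
    then show ?thesis
      using T'' iso_trans[OF less.prems T'(1) T''(1) T'(2) T''(2)] by metis
  qed
qed

text \<open>Applied to 1 = h d and 1 = d h with d radical, the characters give 0 on the right,
  whereas the identity entry of a summand P_l has residue 1.\<close>

lemma zero_minimal_empty:
  assumes "wf T" "minimal T" "zeroK R e1 e2 T"
  shows "c0 T = [] \<and> c1 T = []"
proof -
  have sets: "set (c1 T) \<subseteq> {1,2}" "set (c0 T) \<subseteq> {1,2}" using assms by (auto simp: wf_cx_def)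
  obtain h where h: "h \<in> H (c0 T) (c1 T)" and 1: "I (c1 T) = h \<star>\<^bsub>length (c0 T)\<^esub> cd T"
    and 0: "I (c0 T) = cd T \<star>\<^bsub>length (c1 T)\<^esub> h"
    using assms(3) unfolding zeroK_iff by blast
  note [simp] = H_MC[OF h] H_MC[OF wf_cd[OF assms(1)]]
  have "\<chi> l (I (c1 T) i k) = 0" "\<chi> l (I (c0 T) i k) = 0" if "l \<in> {1,2}" for l i k
    unfolding 0 1 using minimal_D[OF assms(2) that] by (simp_all add: \<chi>_mc)
  moreover have "P!0 \<in> {1,2} \<and> \<chi> (P!0) (I P 0 0) = 1" if "P \<noteq> []" "set P \<subseteq> {1,2}" for P
  proof -
    have "P!0 \<in> {1,2}" using that nth_mem[of 0 P] by blast
    then show ?thesis using \<chi>_I[OF that(2), of "P!0" 0 0] that(1) by simp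
  qed
  ultimately show ?thesis
    using sets by (metis zero_neq_one)
qed

lemma empty_zero:
  assumes "wf T" "c0 T = []" "c1 T = []" shows "zeroK R e1 e2 T"
  unfolding zeroK_iff using assms
  by (intro bexI[of _ Z]) (auto simp: mid_def mcomp_def)

text \<open>A common label would give a map with an entry \<open>e\<^sub>l\<close>, whereas every null-homotopic map
  vanishes modulo the radical.\<close>

lemma presilting_minimal_disjoint:
  assumes pre: "presilting R e1 e2 T" and min: "minimal T"
  shows "set (c0 T) \<inter> set (c1 T) = {}"
proof (rule ccontr)
  assume "set (c0 T) \<inter> set (c1 T) \<noteq> {}"
  then obtain i j where ij: "i < length (c0 T)" "j < length (c1 T)" "c0 T ! i = c1 T ! j"
    by (metis disjoint_iff in_set_conv_nth)
  have wf: "wf T" using pre by (simp add: presilting_def)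
  define l where "l = c1 T ! j"
  have l: "l \<in> {1,2}" using wf nth_mem[OF ij(2)] unfolding wf_cx_def l_def by blast
  have u: "unit_mat i j (E l) \<in> H (c1 T) (c0 T)"
    by (rule unit_mat_H) (use ij in \<open>auto simp: l_def\<close>)
  have "\<forall>f\<in>H (c1 T) (c0 T). \<exists>h1\<in>H (c1 T) (c1 T). \<exists>h0\<in>H (c0 T) (c0 T).
       f = cd T \<star>\<^bsub>length (c1 T)\<^esub> h1 \<boxplus> h0 \<star>\<^bsub>length (c0 T)\<^esub> cd T"
    using pre by (simp add: presilting_def shift_hom_zero_def)
  from bspec[OF this u] obtain h1 h0 where h: "h1 \<in> H (c1 T) (c1 T)" "h0 \<in> H (c0 T) (c0 T)"
    and eq: "unit_mat i j (E l) = cd T \<star>\<^bsub>length (c1 T)\<^esub> h1 \<boxplus> h0 \<star>\<^bsub>length (c0 T)\<^esub> cd T" by blast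
  note [simp] = h[THEN H_MC] H_MC[OF wf_cd[OF wf]]
  have "\<chi> l (unit_mat i j (E l) i j) = 0"
    unfolding eq using minimal_D[OF min l] by (simp add: \<chi>_ma \<chi>_mc)
  moreover have "\<chi> l (unit_mat i j (E l) i j) = 1"
    using \<chi>_E[OF l l] by (simp add: unit_mat_def)
  ultimately show False by simp
qed

end

section \<open>Quadrants of the g-fan\<close>

definition silting_list :: "'a ring \<Rightarrow> 'a \<Rightarrow> 'a \<Rightarrow> 'a cx list \<Rightarrow> bool" where
  "silting_list R e1 e2 Ts \<longleftrightarrow> (\<forall>T\<in>set Ts. indecK R e1 e2 T)
     \<and> (\<forall>i<length Ts. \<forall>j<length Ts. i \<noteq> j \<longrightarrow> \<not> isoK R e1 e2 (Ts!i) (Ts!j))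
     \<and> presilting R e1 e2 (dsum_list R Ts)"

text \<open>The contribution of one sign pattern: labels \<open>{1}\<close> and \<open>{2}\<close>
  belong to the quadrant of \<open>sigma_pm\<close>, labels \<open>{2}\<close> and
  \<open>{1}\<close> to that of \<open>sigma_mp\<close>. The conditions are on the given
  representatives, not on isomorphism classes.\<close>

definition fan_part :: "'a ring \<Rightarrow> 'a \<Rightarrow> 'a \<Rightarrow> nat set \<Rightarrow> nat set \<Rightarrow> (real \<times> real) set set" where
  "fan_part R e1 e2 A0 A1 = {gcone (set (map gvec Ts)) | Ts. silting_list R e1 e2 Ts
     \<and> (\<forall>T\<in>set Ts. set (c0 T) \<subseteq> A0 \<and> set (c1 T) \<subseteq> A1)}"

lemma gfan_silting_list: "gfan R e1 e2 = {gcone (set (map gvec Ts)) | Ts. silting_list R e1 e2 Ts}"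
  unfolding gfan_def silting_list_def ..

text \<open>P_i in degree 0; \<open>stalk1\<close> is P_i in degree -1, that is, P_i[1].\<close>

definition stalk0 :: "'a ring \<Rightarrow> nat \<Rightarrow> 'a cx" where "stalk0 R i = ([], [i], \<lambda>_ _. \<zero>\<^bsub>R\<^esub>)"
definition stalk1 :: "'a ring \<Rightarrow> nat \<Rightarrow> 'a cx" where "stalk1 R i = ([i], [], \<lambda>_ _. \<zero>\<^bsub>R\<^esub>)"

definition svec :: "real \<Rightarrow> nat \<Rightarrow> real \<times> real" where
  "svec s i = (if i = 1 then s else 0, if i = 2 then s else 0)"

lemma c_stalk [simp]:
  "c0 (stalk0 R i) = [i]" "c1 (stalk0 R i) = []" "cd (stalk0 R i) = (\<lambda>_ _. \<zero>\<^bsub>R\<^esub>)"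
  "c0 (stalk1 R i) = []" "c1 (stalk1 R i) = [i]" "cd (stalk1 R i) = (\<lambda>_ _. \<zero>\<^bsub>R\<^esub>)"
  by (simp_all add: stalk0_def stalk1_def c0_def c1_def cd_def)

lemma gvec_stalk: "gvec (stalk0 R i) = svec 1 i" "gvec (stalk1 R i) = svec (- 1) i"
  by (simp_all add: gvec_def svec_def)

context elem2
begin

section \<open>Reduction to minimal representatives and four sign patterns\<close>

lemma minimal_dsum: "minimal X \<Longrightarrow> minimal Y \<Longrightarrow> minimal (dsum R X Y)"
  unfolding minimal_def c_dsum bdiag_def by simp

lemma minimal_dsum_list: "(\<And>T. T \<in> set Ts \<Longrightarrow> minimal T) \<Longrightarrow> minimal (dsum_list R Ts)"
proof (induction Ts)
  case Nil
  show ?case by (simp add: dsum_list_def minimal_def zero_cx_def cd_def)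
qed (simp add: dsum_list_def minimal_dsum)

text \<open>Indecomposability, pairwise non-isomorphism and presilting of the sum are invariant
  under isomorphism in K^b, so each summand may be replaced by a minimal representative with the
  same g-vector.\<close>

lemma silting_list_minimal:
  assumes "silting_list R e1 e2 Ts"
  shows "\<exists>Ts'. silting_list R e1 e2 Ts' \<and> (\<forall>T\<in>set Ts'. minimal T) \<and> map gvec Ts' = map gvec Ts"
proof -
  have "\<forall>T. \<exists>T'. wf T \<longrightarrow> wf T' \<and> iso T T' \<and> minimal T' \<and> gvec T' = gvec T"
    using exists_minimal by blast
  then obtain F where F: "wf T \<longrightarrow> wf (F T) \<and> iso T (F T) \<and> minimal (F T) \<and> gvec (F T) = gvec T" for T
    by metis
  have ind: "indecK R e1 e2 T" if "T \<in> set Ts" for T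
    using assms that by (simp add: silting_list_def)
  have wf: "wf T" if "T \<in> set Ts" for T using ind[OF that] indecK_wf by blast
  have noniso: "\<not> iso (Ts!i) (Ts!j)" if "i < length Ts" "j < length Ts" "i \<noteq> j" for i j
    using assms that by (simp add: silting_list_def)
  have "silting_list R e1 e2 (map F Ts)"
    unfolding silting_list_def
  proof (intro conjI ballI allI impI)
    fix T assume "T \<in> set (map F Ts)"
    then obtain X where "X \<in> set Ts" "T = F X" by auto
    then show "indecK R e1 e2 T" using indecK_iso[OF ind] F wf by blast
  next
    fix i j assume ij: "i < length (map F Ts)" "j < length (map F Ts)" "i \<noteq> j"
    show "\<not> iso (map F Ts ! i) (map F Ts ! j)"
    proof
      assume iso: "iso (map F Ts ! i) (map F Ts ! j)"
      let ?X = "Ts!i" and ?Y = "Ts!j"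
      have XY: "wf ?X" "wf ?Y" using ij wf by auto
      have 1: "iso (F ?X) (F ?Y)" using iso ij by simp
      have "iso ?X (F ?Y)"
        using iso_trans[of ?X "F ?X" "F ?Y"] XY F 1 by blast
      then have "iso ?X ?Y"
        using iso_trans[of ?X "F ?Y" ?Y] XY F iso_sym by blast
      then show False using noniso ij by simp
    qed
  next
    have "wf (dsum_list R (map F Ts))" by (rule wf_dsum_list) (use F wf in auto)
    moreover have "iso (dsum_list R Ts) (dsum_list R (map F Ts))"
      by (rule iso_dsum_list) (use F wf in blast)
    ultimately show "presilting R e1 e2 (dsum_list R (map F Ts))"
      using presilting_iso assms unfolding silting_list_def by blast
  qed
  moreover have "\<forall>T\<in>set (map F Ts). minimal T" using F wf by auto
  moreover have "map gvec (map F Ts) = map gvec Ts" using F wf by auto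
  ultimately show ?thesis by blast
qed

text \<open>A direct sum of minimal complexes is minimal, so the disjointness of labels applies to
  the sum of the whole list. All summands therefore share one sign pattern, which is why no cone
  crosses a coordinate axis.\<close>

lemma gfan_eq_parts:
  "gfan R e1 e2 = fan_part R e1 e2 {1} {2} \<union> fan_part R e1 e2 {2} {1}
     \<union> fan_part R e1 e2 {1,2} {} \<union> fan_part R e1 e2 {} {1,2}" (is "?l = ?r")
proof
  have "fan_part R e1 e2 A0 A1 \<subseteq> ?l" for A0 A1
    unfolding fan_part_def gfan_silting_list by blast
  then show "?r \<subseteq> ?l" by simp
  show "?l \<subseteq> ?r"
  proof
    fix C assume "C \<in> ?l"
    then obtain Ts where Ts: "C = gcone (set (map gvec Ts))" "silting_list R e1 e2 Ts"
      unfolding gfan_silting_list by blast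
    then obtain Ts' where Ts': "silting_list R e1 e2 Ts'" "\<forall>T\<in>set Ts'. minimal T" "map gvec Ts' = map gvec Ts"
      using silting_list_minimal by blast
    let ?D = "dsum_list R Ts'"
    have pre: "presilting R e1 e2 ?D" using Ts'(1) by (simp add: silting_list_def)
    have "set (c0 ?D) \<inter> set (c1 ?D) = {}"
      using presilting_minimal_disjoint[OF pre minimal_dsum_list] Ts'(2) by blast
    moreover have "set (c0 ?D) \<subseteq> {1,2}" "set (c1 ?D) \<subseteq> {1,2}"
      using pre by (auto simp: presilting_def wf_cx_def)
    moreover have "(X \<subseteq> {1} \<and> Y \<subseteq> {2}) \<or> (X \<subseteq> {2} \<and> Y \<subseteq> {1}) \<or> (X \<subseteq> {1,2} \<and> Y \<subseteq> {}) \<or> (X \<subseteq> {} \<and> Y \<subseteq> {1,2})"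
      if "X \<inter> Y = {}" "X \<subseteq> {1,2}" "Y \<subseteq> {1,2}" for X Y :: "nat set"
    proof -
      have "Y \<subseteq> {}" if "1 \<in> X" "2 \<in> X" using that \<open>X \<inter> Y = {}\<close> \<open>Y \<subseteq> {1,2}\<close> by auto
      moreover have "X \<subseteq> {1} \<and> Y \<subseteq> {2}" if "1 \<in> X" "2 \<notin> X"
        using that \<open>X \<inter> Y = {}\<close> \<open>Y \<subseteq> {1,2}\<close> \<open>X \<subseteq> {1,2}\<close> by auto
      moreover have "X \<subseteq> {2} \<and> Y \<subseteq> {1}" if "1 \<notin> X" "2 \<in> X"
        using that \<open>X \<inter> Y = {}\<close> \<open>Y \<subseteq> {1,2}\<close> \<open>X \<subseteq> {1,2}\<close> by auto
      moreover have "X \<subseteq> {}" if "1 \<notin> X" "2 \<notin> X" using that \<open>X \<subseteq> {1,2}\<close> by auto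
      ultimately show ?thesis using that(2,3) by metis
    qed
    ultimately have
      "(set (c0 ?D) \<subseteq> {1} \<and> set (c1 ?D) \<subseteq> {2}) \<or> (set (c0 ?D) \<subseteq> {2} \<and> set (c1 ?D) \<subseteq> {1})
        \<or> (set (c0 ?D) \<subseteq> {1,2} \<and> set (c1 ?D) \<subseteq> {}) \<or> (set (c0 ?D) \<subseteq> {} \<and> set (c1 ?D) \<subseteq> {1,2})"
      by presburger
    moreover have "C \<in> fan_part R e1 e2 A0 A1" if "set (c0 ?D) \<subseteq> A0 \<and> set (c1 ?D) \<subseteq> A1" for A0 A1
      using Ts' Ts that unfolding fan_part_def c_dsum_list by (intro CollectI exI[of _ Ts']) auto
    ultimately show "C \<in> ?r" by blast
  qed
qed

text \<open>Modulo the radical the identity of P factors through Q, separately for each label, so P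
  has no label that Q lacks. The second claim is a rank bound in the case of rank at most 1: a
  column times a row is never the identity of size 2.\<close>

lemma factor_through:
  assumes f: "f \<in> H P Q" and g: "g \<in> H Q P" and sets: "set P \<subseteq> {1,2}" "set Q \<subseteq> {1,2}"
    and eq: "\<And>l a b. l \<in> {1,2} \<Longrightarrow> \<chi> l ((g \<star>\<^bsub>length Q\<^esub> f) a b) = \<chi> l (I P a b)"
  shows "set P \<subseteq> set Q" "length Q \<le> 1 \<Longrightarrow> length P \<le> length Q"
proof -
  note [simp] = H_MC[OF f] H_MC[OF g]
  have eq': "(\<Sum>j<length Q. \<chi> l (g a j) * \<chi> l (f j b)) = (if a = b \<and> a < length P \<and> P!a = l then 1 else 0)"
    if "l \<in> {1,2}" for l a b
    using eq[OF that, of a b] \<chi>_I[OF sets(1) that, of a b] by (simp add: \<chi>_mc)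
  show sub: "set P \<subseteq> set Q"
  proof
    fix l assume "l \<in> set P"
    then obtain a where a: "a < length P" "P!a = l" by (meson in_set_conv_nth)
    have l: "l \<in> {1,2}" using sets \<open>l \<in> set P\<close> by blast
    have "(\<Sum>j<length Q. \<chi> l (g a j) * \<chi> l (f j a)) \<noteq> 0" using eq'[OF l, of a a] a by simp
    then obtain j where "j < length Q" "\<chi> l (g a j) \<noteq> 0"
      by (metis (no_types, lifting) lessThan_iff mult_zero_left sum.neutral)
    then show "l \<in> set Q" using \<chi>_entry[OF g sets(2,1) l] by (metis nth_mem)
  qed
  show "length P \<le> length Q" if Q: "length Q \<le> 1"
  proof (rule ccontr)
    assume P: "\<not> length P \<le> length Q"
    then have "P \<noteq> []" by auto
    then have "Q \<noteq> []" using sub by auto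
    then have Q1: "length Q = 1" using Q by (cases Q) auto
    then have P2: "0 < length P" "1 < length P" using P by auto
    obtain l where l: "Q = [l]" using Q1 by (cases Q) auto
    have Pl: "P!0 = l" "P!1 = l" using sub l nth_mem[OF P2(1)] nth_mem[OF P2(2)] by auto
    have l12: "l \<in> {1,2}" using sets l by auto
    have "\<chi> l (g 0 0) * \<chi> l (f 0 0) = 1" "\<chi> l (g 0 0) * \<chi> l (f 0 1) = 0" "\<chi> l (g 1 0) * \<chi> l (f 0 1) = 1"
      using eq'[OF l12, of 0 0] eq'[OF l12, of 0 1] eq'[OF l12, of 1 1] l Pl P2 by simp_all
    then show False by auto
  qed
qed

text \<open>For minimal T the terms h d and d h have residue 0, so in each degree the identity of T
  factors through T' modulo the radical.\<close>

lemma htpy_inv_minimal: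
  assumes wf: "wf T" "wf T'" and min: "minimal T" and hi: "htpy_inv T T' f1 f0 g1 g0 h"
  shows "set (c0 T) \<subseteq> set (c0 T')" "length (c0 T') \<le> 1 \<Longrightarrow> length (c0 T) \<le> length (c0 T')"
    "set (c1 T) \<subseteq> set (c1 T')" "length (c1 T') \<le> 1 \<Longrightarrow> length (c1 T) \<le> length (c1 T')"
proof -
  note a = hi[unfolded htpy_inv_def]
  have f: "f1 \<in> H (c1 T) (c1 T')" "f0 \<in> H (c0 T) (c0 T')" "g1 \<in> H (c1 T') (c1 T)"
    "g0 \<in> H (c0 T') (c0 T)" "h \<in> H (c0 T) (c1 T)" using a by blast+
  have eqs: "I (c1 T) = g1 \<star>\<^bsub>length (c1 T')\<^esub> f1 \<boxplus> h \<star>\<^bsub>length (c0 T)\<^esub> cd T"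
    "I (c0 T) = g0 \<star>\<^bsub>length (c0 T')\<^esub> f0 \<boxplus> cd T \<star>\<^bsub>length (c1 T)\<^esub> h"
    using a by blast+
  have sets: "set (c1 T) \<subseteq> {1,2}" "set (c0 T) \<subseteq> {1,2}" "set (c1 T') \<subseteq> {1,2}" "set (c0 T') \<subseteq> {1,2}"
    using wf by (auto simp: wf_cx_def)
  note [simp] = f[THEN H_MC] H_MC[OF wf_cd[OF wf(1)]]
  have z: "\<chi> l ((h \<star>\<^bsub>length (c0 T)\<^esub> cd T) i j) = 0" "\<chi> l ((cd T \<star>\<^bsub>length (c1 T)\<^esub> h) i j) = 0"
    if "l \<in> {1,2}" for l i j
    using minimal_D[OF min that] by (simp_all add: \<chi>_mc)
  have e1: "\<chi> l ((g1 \<star>\<^bsub>length (c1 T')\<^esub> f1) i j) = \<chi> l (I (c1 T) i j)" if "l \<in> {1,2}" for l i j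
    unfolding eqs using z[OF that] by (simp add: \<chi>_ma)
  have e0: "\<chi> l ((g0 \<star>\<^bsub>length (c0 T')\<^esub> f0) i j) = \<chi> l (I (c0 T) i j)" if "l \<in> {1,2}" for l i j
    unfolding eqs using z[OF that] by (simp add: \<chi>_ma)
  show "set (c0 T) \<subseteq> set (c0 T')" "length (c0 T') \<le> 1 \<Longrightarrow> length (c0 T) \<le> length (c0 T')"
    using factor_through[OF f(2,4) sets(2,4) e0] by blast+
  show "set (c1 T) \<subseteq> set (c1 T')" "length (c1 T') \<le> 1 \<Longrightarrow> length (c1 T) \<le> length (c1 T')"
    using factor_through[OF f(1,3) sets(1,3) e1] by blast+
qed

text \<open>Sets of labels are a coarse invariant, but they separate the stalk complexes, to which
  this is applied.\<close>

lemma iso_minimal_labels: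
  assumes "wf T" "wf T'" "minimal T" "minimal T'" "iso T T'"
  shows "set (c0 T) = set (c0 T')" "set (c1 T) = set (c1 T')"
proof -
  obtain f1 f0 g1 g0 h k where 1: "htpy_inv T T' f1 f0 g1 g0 h" "htpy_inv T' T g1 g0 f1 f0 k"
    using assms iso_iff by blast
  show "set (c0 T) = set (c0 T')" "set (c1 T) = set (c1 T')"
    using htpy_inv_minimal(1,3)[OF assms(1,2,3) 1(1)] htpy_inv_minimal(1,3)[OF assms(2,1,4) 1(2)] by blast+
qed

section \<open>Complexes with zero differential\<close>

lemma wf_zero_diff: "cd T = Z \<Longrightarrow> set (c0 T) \<subseteq> {1,2} \<Longrightarrow> set (c1 T) \<subseteq> {1,2} \<Longrightarrow> wf T"
  by (simp add: wf_cx_def)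

lemma minimal_zero_cd: "cd T = Z \<Longrightarrow> minimal T"
  by (simp add: minimal_def)

text \<open>For minimal representatives X' and Y' of the two summands, X' + Y' has in each degree at
  most as many terms as T, hence at most one in all. So X' or Y' is empty.\<close>

lemma indecK_one_term:
  assumes cd: "cd T = Z" and sets: "set (c0 T) \<subseteq> {1,2}" "set (c1 T) \<subseteq> {1,2}"
    and one: "length (c0 T) + length (c1 T) = 1"
  shows "indecK R e1 e2 T"
  unfolding indecK_def
proof (intro conjI allI impI)
  show wf: "wf T" using wf_zero_diff cd sets by blast
  note min = minimal_zero_cd[OF cd]
  show "\<not> zeroK R e1 e2 T"
    using zero_minimal_empty[OF wf min] one by auto
  fix X Y assume "wf X \<and> wf Y \<and> iso T (dsum R X Y)"
  then have XY: "wf X" "wf Y" "iso T (dsum R X Y)" by auto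
  obtain X' where X': "wf X'" "iso X X'" "minimal X'" using exists_minimal[OF XY(1)] by blast
  obtain Y' where Y': "wf Y'" "iso Y Y'" "minimal Y'" using exists_minimal[OF XY(2)] by blast
  note D = wf_dsum[OF X'(1) Y'(1)]
  have "iso T (dsum R X' Y')"
    by (rule iso_trans[OF wf wf_dsum[OF XY(1,2)] D XY(3)])
      (rule iso_dsum[OF XY(1) X'(1) XY(2) Y'(1) X'(2) Y'(2)])
  then obtain f1 f0 g1 g0 k where 1: "htpy_inv (dsum R X' Y') T g1 g0 f1 f0 k"
    using iso_iff[OF wf D] by blast
  have "length (c0 (dsum R X' Y')) \<le> length (c0 T)" "length (c1 (dsum R X' Y')) \<le> length (c1 T)"
    using htpy_inv_minimal(2,4)[OF D wf minimal_dsum[OF X'(3) Y'(3)] 1] one by linarith+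
  then have "length (c0 X') + length (c0 Y') + length (c1 X') + length (c1 Y') \<le> 1"
    using one by simp
  then have "(c0 X' = [] \<and> c1 X' = []) \<or> (c0 Y' = [] \<and> c1 Y' = [])"
    by (cases "c0 X'"; cases "c1 X'"; cases "c0 Y'"; cases "c1 Y'") auto
  then show "zeroK R e1 e2 X \<or> zeroK R e1 e2 Y"
    using empty_zero[OF X'(1)] empty_zero[OF Y'(1)] zeroK_iso[OF XY(1) X'(1,2)] zeroK_iso[OF XY(2) Y'(1,2)]
    by blast
qed

text \<open>With zero differential, every splitting of the two label lists splits the complex, so an
  indecomposable one has a single label in all.\<close>

lemma indecK_zero_diff:
  assumes ind: "indecK R e1 e2 T" and cd: "cd T = Z"
  shows "(\<exists>i. T = stalk0 R i) \<or> (\<exists>i. T = stalk1 R i)"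
proof -
  note wf = indecK_wf[OF ind]
  have T: "T = (c1 T, c0 T, Z)" using cd by (simp add: c1_def c0_def cd_def prod_eq_iff)
  have sets: "set (c0 T) \<subseteq> {1,2}" "set (c1 T) \<subseteq> {1,2}" using wf by (auto simp: wf_cx_def)
  have split: "(P = [] \<and> Q = []) \<or> (P' = [] \<and> Q' = [])" if PQ: "c1 T = P @ P'" "c0 T = Q @ Q'" for P P' Q Q'
  proof -
    let ?X = "(P, Q, Z)" and ?Y = "(P', Q', Z)"
    have "dsum R ?X ?Y = T"
      by (subst T, simp add: PQ dsum_def) (auto simp: c1_def c0_def cd_def intro!: ext)
    moreover have w: "wf ?X" "wf ?Y"
      by (rule wf_zero_diff; use sets PQ in \<open>auto simp: c1_def c0_def cd_def\<close>)+
    ultimately have "zeroK R e1 e2 ?X \<or> zeroK R e1 e2 ?Y"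
      using indecK_split[OF ind w] iso_refl[OF wf] by simp
    moreover have "minimal ?X" "minimal ?Y" by (auto intro!: minimal_zero_cd simp: cd_def)
    ultimately show ?thesis
      using zero_minimal_empty[OF w(1)] zero_minimal_empty[OF w(2)] by (auto simp: c1_def c0_def)
  qed
  have "\<not> (c0 T = [] \<and> c1 T = [])"
    using empty_zero[OF wf] indecK_nonzero[OF ind] by blast
  moreover have "c0 T = [] \<and> length (c1 T) = 1" if "c1 T = x # xs" for x xs
    using split[of "[x]" xs "[]" "c0 T"] that by simp
  moreover have "length (c0 T) = 1" if "c0 T = x # xs" "c1 T = []" for x xs
    using split[of "[]" "[]" "[x]" xs] that by simp
  ultimately consider "c0 T = []" "length (c1 T) = 1" | "c1 T = []" "length (c0 T) = 1"
    by (metis neq_Nil_conv)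
  then show ?thesis
  proof cases
    case 1
    then obtain i where "c1 T = [i]" by (metis One_nat_def length_0_conv length_Suc_conv)
    then show ?thesis using T 1 by (metis stalk1_def)
  next
    case 2
    then obtain i where "c0 T = [i]" by (metis One_nat_def length_0_conv length_Suc_conv)
    then show ?thesis using T 2 by (metis stalk0_def)
  qed
qed

text \<open>All maps from summands labelled by \<open>A1\<close> to summands labelled by
  \<open>A0\<close> are zero here. So differentials vanish, indecomposables are stalks, and
  Hom(T,T[1]) = 0 for every sum of such stalks; each subset of the signed unit vectors spans a cone
  of the fan.\<close>

lemma fan_part_trivial:
  assumes A: "A0 \<subseteq> {1,2}" "A1 \<subseteq> {1,2}"
    and zero: "\<And>i j x. i \<in> A0 \<Longrightarrow> j \<in> A1 \<Longrightarrow> x \<in> carrier R \<Longrightarrow> E i \<otimes> x \<otimes> E j = \<zero>"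
  shows "fan_part R e1 e2 A0 A1 = gcone ` Pow (svec 1 ` A0 \<union> svec (- 1) ` A1)" (is "?l = ?r")
proof
  have H0: "M = Z" if "M \<in> H P Q" "set P \<subseteq> A1" "set Q \<subseteq> A0" for M P Q
  proof (intro ext)
    fix i j
    show "M i j = \<zero>"
    proof (cases "i < length Q \<and> j < length P")
      case True
      then have "Q!i \<in> A0" "P!j \<in> A1" using that by auto
      moreover have "M i j = E (Q!i) \<otimes> M i j \<otimes> E (P!j)"
        using True H_left[OF that(1)] H_right[OF that(1)] by simp
      ultimately show ?thesis using zero H_closed[OF that(1)] by metis
    qed (use H_zero[OF that(1)] in blast)
  qed
  show "?l \<subseteq> ?r"
  proof
    fix C assume "C \<in> ?l"
    then obtain Ts where Ts: "C = gcone (set (map gvec Ts))" "silting_list R e1 e2 Ts"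
      and lab: "\<And>T. T\<in>set Ts \<Longrightarrow> set (c0 T) \<subseteq> A0 \<and> set (c1 T) \<subseteq> A1"
      unfolding fan_part_def by blast
    have "gvec T \<in> svec 1 ` A0 \<union> svec (- 1) ` A1" if "T \<in> set Ts" for T
    proof -
      have ind: "indecK R e1 e2 T" using Ts(2) that by (simp add: silting_list_def)
      have "cd T = Z" using H0 wf_cd[OF indecK_wf[OF ind]] lab[OF that] by blast
      then consider i where "T = stalk0 R i" | i where "T = stalk1 R i" using indecK_zero_diff[OF ind] by blast
      then show ?thesis using lab[OF that] by cases (auto simp: gvec_stalk)
    qed
    then have "gvec ` set Ts \<subseteq> svec 1 ` A0 \<union> svec (- 1) ` A1" by blast
    then show "C \<in> ?r" unfolding Ts by simp
  qed
  show "?r \<subseteq> ?l"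
  proof
    fix C assume "C \<in> ?r"
    then obtain S where S: "C = gcone S" "S \<subseteq> svec 1 ` A0 \<union> svec (- 1) ` A1" by blast
    \<comment> \<open>S is realised by the stalks with g-vector in S. Each label is listed once per
      degree, so that different entries are not isomorphic.\<close>
    define B0 where "B0 = {i\<in>A0. svec 1 i \<in> S}"
    define B1 where "B1 = {i\<in>A1. svec (- 1) i \<in> S}"
    have fin: "finite B0" "finite B1"
      using A finite_subset[of B0 "{1,2}"] finite_subset[of B1 "{1,2}"] by (auto simp: B0_def B1_def)
    define Ts where "Ts = map (stalk0 R) (sorted_list_of_set B0) @ map (stalk1 R) (sorted_list_of_set B1)"
    have set_Ts: "set Ts = stalk0 R ` B0 \<union> stalk1 R ` B1" using fin by (simp add: Ts_def)
    have dist: "distinct Ts"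
      unfolding Ts_def using fin
      by (auto simp: distinct_map inj_on_def stalk0_def stalk1_def)
    have gS: "set (map gvec Ts) = S"
      using S(2) by (auto simp: set_Ts gvec_stalk B0_def B1_def image_Un image_image)
    have lab: "set (c0 T) \<subseteq> A0 \<and> set (c1 T) \<subseteq> A1" if "T \<in> set Ts" for T
      using that by (auto simp: set_Ts B0_def B1_def)
    have ind: "indecK R e1 e2 T" and min: "minimal T" if "T \<in> set Ts" for T
    proof -
      have "cd T = Z" "length (c0 T) + length (c1 T) = 1" using that by (auto simp: set_Ts)
      then show "indecK R e1 e2 T" "minimal T"
        using indecK_one_term minimal_zero_cd lab[OF that] A by blast+
    qed
    have eqI: "T = T'" if "T \<in> set Ts" "T' \<in> set Ts" "iso T T'" for T T'
    proof -
      have "set (c0 T) = set (c0 T')" "set (c1 T) = set (c1 T')"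
        by (rule iso_minimal_labels[OF ind[OF that(1), THEN indecK_wf] ind[OF that(2), THEN indecK_wf]
            min[OF that(1)] min[OF that(2)] that(3)])+
      then show ?thesis using that(1,2) by (auto simp: set_Ts)
    qed
    have wf: "wf (dsum_list R Ts)" using wf_dsum_list ind[THEN indecK_wf] by blast
    have "presilting R e1 e2 (dsum_list R Ts)"
      unfolding presilting_def shift_hom_zero_def
    proof (intro conjI wf ballI)
      let ?D = "dsum_list R Ts"
      fix f assume "f \<in> H (c1 ?D) (c0 ?D)"
      moreover have "set (c0 ?D) \<subseteq> A0" "set (c1 ?D) \<subseteq> A1" using lab unfolding c_dsum_list by blast+
      ultimately have "f = Z" using H0 by blast
      then have "f = cd ?D \<star>\<^bsub>length (c1 ?D)\<^esub> Z \<boxplus> Z \<star>\<^bsub>length (c0 ?D)\<^esub> cd ?D"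
        using H_MC[OF wf_cd[OF wf]] by simp
      then show "\<exists>h1\<in>H (c1 ?D) (c1 ?D). \<exists>h0\<in>H (c0 ?D) (c0 ?D).
         f = cd ?D \<star>\<^bsub>length (c1 ?D)\<^esub> h1 \<boxplus> h0 \<star>\<^bsub>length (c0 ?D)\<^esub> cd ?D"
        by (intro bexI[of _ Z] Z_H)
    qed
    then have "silting_list R e1 e2 Ts"
      unfolding silting_list_def using ind eqI dist by (metis nth_eq_iff_index_eq nth_mem)
    then show "C \<in> ?l"
      unfolding fan_part_def using S(1) gS lab by blast
  qed
qed

end

section \<open>Transfer along a split surjection\<close>

definition mapm :: "('a \<Rightarrow> 'b) \<Rightarrow> 'a mat \<Rightarrow> 'b mat" where
  "mapm p M = (\<lambda>i j. p (M i j))"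

definition mapcx :: "('a \<Rightarrow> 'b) \<Rightarrow> 'a cx \<Rightarrow> 'b cx" where
  "mapcx p T = (c1 T, c0 T, mapm p (cd T))"

lemma c_mapcx [simp]: "c1 (mapcx p T) = c1 T" "c0 (mapcx p T) = c0 T" "cd (mapcx p T) = mapm p (cd T)"
  by (simp_all add: mapcx_def c1_def c0_def cd_def)

lemma gvec_mapcx [simp]: "gvec (mapcx p T) = gvec T"
  by (simp add: gvec_def)

lemma cx_eqI: "c1 T = c1 T' \<Longrightarrow> c0 T = c0 T' \<Longrightarrow> cd T = cd T' \<Longrightarrow> T = T'"
  by (simp add: c1_def c0_def cd_def prod_eq_iff)

section \<open>Functoriality under homomorphisms of rings with two idempotents\<close>

locale idem2_hom = A: idem2 R e1 e2 + B: idem2 S d1 d2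
  for R :: "'a ring" and e1 e2 and S :: "'b ring" and d1 d2 +
  fixes p :: "'a \<Rightarrow> 'b"
  assumes hom: "p \<in> ring_hom R S" and p_e: "p e1 = d1" "p e2 = d2"
begin

sublocale ring_hom_ring R S p
  by (intro ring_hom_ring.intro ring_hom_ring_axioms.intro A.ring_axioms B.ring_axioms hom)

lemma p_ev: "p (ev e1 e2 i) = ev d1 d2 i"
  by (simp add: ev_def p_e)

lemma mapm_H:
  assumes "M \<in> phom R e1 e2 P Q" shows "mapm p M \<in> phom S d1 d2 P Q"
proof (rule B.H_I)
  fix i j assume ij: "i < length Q" "j < length P"
  show "ev d1 d2 (Q!i) \<otimes>\<^bsub>S\<^esub> mapm p M i j = mapm p M i j"
    using A.H_left[OF assms ij] A.H_closed[OF assms, of i j]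
    unfolding mapm_def p_ev[symmetric] by (metis A.E_closed hom_mult)
  show "mapm p M i j \<otimes>\<^bsub>S\<^esub> ev d1 d2 (P!j) = mapm p M i j"
    using A.H_right[OF assms ij] A.H_closed[OF assms, of i j]
    unfolding mapm_def p_ev[symmetric] by (metis A.E_closed hom_mult)
qed (use A.H_closed[OF assms] A.H_zero[OF assms] in \<open>simp_all add: mapm_def\<close>)

lemma mapm_mc:
  assumes "M \<in> A.MC" "N \<in> A.MC"
  shows "mapm p (mcomp R n M N) = mcomp S n (mapm p M) (mapm p N)"
proof (intro ext)
  fix i k
  have "p (\<Oplus>\<^bsub>R\<^esub>j\<in>{..<n}. M i j \<otimes>\<^bsub>R\<^esub> N j k) = (\<Oplus>\<^bsub>S\<^esub>j\<in>{..<n}. p (M i j \<otimes>\<^bsub>R\<^esub> N j k))"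
    using hom_finsum[of "\<lambda>j. M i j \<otimes>\<^bsub>R\<^esub> N j k" "{..<n}"] assms by (simp add: Pi_def o_def)
  also have "\<dots> = (\<Oplus>\<^bsub>S\<^esub>j\<in>{..<n}. p (M i j) \<otimes>\<^bsub>S\<^esub> p (N j k))"
    by (rule B.finsum_cong') (use assms in auto)
  finally show "mapm p (mcomp R n M N) i k = mcomp S n (mapm p M) (mapm p N) i k"
    by (simp add: mapm_def mcomp_def)
qed

lemma mapm_ma:
  assumes "M \<in> A.MC" "N \<in> A.MC"
  shows "mapm p (madd R M N) = madd S (mapm p M) (mapm p N)"
  using assms by (auto simp: mapm_def madd_def)

lemma mapm_I: "mapm p (mid R e1 e2 P) = mid S d1 d2 P"
  by (auto simp: mapm_def mid_def p_ev intro!: ext)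

lemma wf_map: "wf_cx R e1 e2 T \<Longrightarrow> wf_cx S d1 d2 (mapcx p T)"
  using mapm_H by (simp add: wf_cx_def)

lemma htpy_inv_map:
  assumes wf: "A.wf T" "A.wf T'" and hi: "A.htpy_inv T T' f1 f0 g1 g0 h"
  shows "B.htpy_inv (mapcx p T) (mapcx p T') (mapm p f1) (mapm p f0) (mapm p g1) (mapm p g0) (mapm p h)"
proof -
  note a = hi[unfolded A.htpy_inv_def]
  have f: "f1 \<in> A.H (c1 T) (c1 T')" "f0 \<in> A.H (c0 T) (c0 T')" "g1 \<in> A.H (c1 T') (c1 T)"
    "g0 \<in> A.H (c0 T') (c0 T)" "h \<in> A.H (c0 T) (c1 T)" using a by blast+
  note MC = f[THEN A.H_MC] wf[THEN A.wf_cd, THEN A.H_MC]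
  have e: "mcomp R (length (c1 T')) (cd T') f1 = mcomp R (length (c0 T)) f0 (cd T)"
    "mcomp R (length (c1 T)) (cd T) g1 = mcomp R (length (c0 T')) g0 (cd T')"
    "A.I (c1 T) = madd R (mcomp R (length (c1 T')) g1 f1) (mcomp R (length (c0 T)) h (cd T))"
    "A.I (c0 T) = madd R (mcomp R (length (c0 T')) g0 f0) (mcomp R (length (c1 T)) (cd T) h)"
    using a by blast+
  note e' = e[THEN arg_cong[of _ _ "mapm p"]]
  show ?thesis
    unfolding B.htpy_inv_def c_mapcx
    using f[THEN mapm_H] e' by (simp only: mapm_mc mapm_ma mapm_I MC A.mc_MC simp_thms)
qed

lemma iso_map:
  assumes "A.wf T" "A.wf T'" "A.iso T T'"
  shows "B.iso (mapcx p T) (mapcx p T')"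
proof -
  obtain f1 f0 g1 g0 h k where 1: "A.htpy_inv T T' f1 f0 g1 g0 h" "A.htpy_inv T' T g1 g0 f1 f0 k"
    using assms A.iso_iff by blast
  show ?thesis
    unfolding B.iso_iff[OF wf_map[OF assms(1)] wf_map[OF assms(2)]]
    using htpy_inv_map[OF assms(1,2) 1(1)] htpy_inv_map[OF assms(2,1) 1(2)] by blast
qed

lemma zeroK_map:
  assumes "A.wf T" "zeroK R e1 e2 T"
  shows "zeroK S d1 d2 (mapcx p T)"
proof -
  obtain h where h: "h \<in> A.H (c0 T) (c1 T)" and e: "A.I (c1 T) = mcomp R (length (c0 T)) h (cd T)"
    "A.I (c0 T) = mcomp R (length (c1 T)) (cd T) h"
    using assms(2) unfolding A.zeroK_iff by blast
  note MC = A.H_MC[OF h] assms(1)[THEN A.wf_cd, THEN A.H_MC]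
  note e' = e[THEN arg_cong[of _ _ "mapm p"], unfolded mapm_I mapm_mc[OF MC(1,2)] mapm_mc[OF MC(2,1)]]
  show ?thesis
    unfolding B.zeroK_iff c_mapcx using mapm_H[OF h] e' by blast
qed

lemma dsum_map: "mapcx p (dsum R X Y) = dsum S (mapcx p X) (mapcx p Y)"
proof -
  have "mapm p (cd (dsum R X Y)) = cd (dsum S (mapcx p X) (mapcx p Y))"
    unfolding A.c_dsum B.c_dsum c_mapcx A.bdiag_def B.bdiag_def mapm_def by (intro ext) simp
  then show ?thesis by (intro cx_eqI) simp_all
qed

lemma dsum_list_map: "mapcx p (dsum_list R Ts) = dsum_list S (map (mapcx p) Ts)"
proof (induction Ts)
  case Nil
  show ?case by (simp add: dsum_list_def zero_cx_def mapcx_def c1_def c0_def cd_def mapm_def)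
next
  case (Cons T Ts)
  then show ?case by (simp add: dsum_list_def dsum_map)
qed

end

text \<open>\<open>s_p\<close> makes \<open>s\<close> invert \<open>p\<close> on the corners f_i G
  f_j with i in \<open>A0\<close> and j in \<open>A1\<close>. For a complex with labels
  \<open>A0\<close> in degree 0 and \<open>A1\<close> in degree -1, these contain all maps from T^-1
  to T^0, in particular the differential.\<close>

locale elem2_retract =
  G: elem2 G f1 f2 \<chi>G + L: elem2 L e1 e2 \<chi>L +
  p: idem2_hom G f1 f2 L e1 e2 p + s: idem2_hom L e1 e2 G f1 f2 s
  for G :: "'a ring" and f1 f2 and L :: "'b ring" and e1 e2 and p and s
    and \<chi>G :: "nat \<Rightarrow> 'a \<Rightarrow> 'k::field" and \<chi>L :: "nat \<Rightarrow> 'b \<Rightarrow> 'k" +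
  fixes A0 A1 :: "nat set"
  assumes p_s: "y \<in> carrier L \<Longrightarrow> p (s y) = y"
    and \<chi>_p: "x \<in> carrier G \<Longrightarrow> \<chi>L l (p x) = \<chi>G l x"
    and s_p: "i \<in> A0 \<Longrightarrow> j \<in> A1 \<Longrightarrow> x \<in> carrier G \<Longrightarrow> ev f1 f2 i \<otimes>\<^bsub>G\<^esub> x = x
        \<Longrightarrow> x \<otimes>\<^bsub>G\<^esub> ev f1 f2 j = x \<Longrightarrow> s (p x) = x"
begin

definition typed :: "'c cx \<Rightarrow> bool" where
  "typed T \<longleftrightarrow> set (c0 T) \<subseteq> A0 \<and> set (c1 T) \<subseteq> A1"

lemma typed_mapcx [simp]: "typed (mapcx q T) = typed T"
  by (simp add: typed_def)

lemma mapm_s_p: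
  assumes "M \<in> G.H P Q" "set Q \<subseteq> A0" "set P \<subseteq> A1"
  shows "mapm s (mapm p M) = M"
proof (intro ext)
  fix i j
  show "mapm s (mapm p M) i j = M i j"
  proof (cases "i < length Q \<and> j < length P")
    case True
    then have ij: "i < length Q" "j < length P" by auto
    then have "Q!i \<in> A0" "P!j \<in> A1" using assms(2,3) nth_mem by blast+
    then show ?thesis
      using s_p G.H_closed[OF assms(1)] G.H_left[OF assms(1) ij] G.H_right[OF assms(1) ij]
      by (simp add: mapm_def)
  next
    case False
    then show ?thesis using G.H_zero[OF assms(1) False] by (simp add: mapm_def)
  qed
qed

lemma mapm_p_s: "M \<in> L.MC \<Longrightarrow> mapm p (mapm s M) = M"
  by (auto simp: mapm_def p_s)

lemma mapcx_s_p: "G.wf T \<Longrightarrow> typed T \<Longrightarrow> mapcx s (mapcx p T) = T"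
  unfolding mapcx_def[of s] c_mapcx using mapm_s_p[OF G.wf_cd, of T]
  by (simp add: typed_def c1_def c0_def cd_def)

lemma mapcx_p_s: "L.wf T \<Longrightarrow> mapcx p (mapcx s T) = T"
  unfolding mapcx_def[of p] c_mapcx using mapm_p_s[OF L.H_MC[OF L.wf_cd], of T]
  by (simp add: c1_def c0_def cd_def)

lemma iso_p_iff:
  assumes "G.wf T" "G.wf T'" "typed T" "typed T'"
  shows "L.iso (mapcx p T) (mapcx p T') \<longleftrightarrow> G.iso T T'"
  using p.iso_map[OF assms(1,2)] s.iso_map[OF p.wf_map[OF assms(1)] p.wf_map[OF assms(2)]]
    mapcx_s_p assms by metis

text \<open>Reflection of contractibility uses that a minimal contractible complex is empty, and \<open>p\<close>
  preserves minimality.\<close>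

lemma zeroK_p_iff:
  assumes "G.wf T"
  shows "zeroK L e1 e2 (mapcx p T) \<longleftrightarrow> zeroK G f1 f2 T"
proof
  assume z: "zeroK L e1 e2 (mapcx p T)"
  obtain T' where T': "G.wf T'" "G.iso T T'" "G.minimal T'" using G.exists_minimal[OF assms] by blast
  have "L.iso (mapcx p T') (mapcx p T)"
    using L.iso_sym[OF p.iso_map[OF assms T'(1,2)]] .
  then have "zeroK L e1 e2 (mapcx p T')"
    using L.zeroK_iso[OF p.wf_map[OF T'(1)] p.wf_map[OF assms] _ z] by blast
  moreover have "L.minimal (mapcx p T')"
    unfolding L.minimal_def c_mapcx mapm_def
    using G.minimal_D[OF T'(3)] \<chi>_p G.H_closed[OF G.wf_cd[OF T'(1)]] by simp
  ultimately have "c0 T' = [] \<and> c1 T' = []"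
    using L.zero_minimal_empty[OF p.wf_map[OF T'(1)]] by simp
  then show "zeroK G f1 f2 T"
    using G.zeroK_iso[OF assms T'(1,2)] G.empty_zero[OF T'(1)] by blast
qed (rule p.zeroK_map[OF assms])

text \<open>X and Y carry arbitrary labels, so \<open>s\<close> need not undo \<open>p\<close> on
  them. Decompositions over \<open>G\<close> are pushed along \<open>p\<close>, those over
  \<open>L\<close> along \<open>s\<close>, and \<open>zeroK_p_iff\<close>, which covers all labels,
  brings the conclusion back.\<close>

lemma indecK_p_iff:
  assumes wf: "G.wf T" and ty: "typed T"
  shows "indecK L e1 e2 (mapcx p T) \<longleftrightarrow> indecK G f1 f2 T"
proof
  assume ind: "indecK L e1 e2 (mapcx p T)"
  show "indecK G f1 f2 T"
    unfolding indecK_def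
  proof (intro conjI allI impI)
    show "\<not> zeroK G f1 f2 T" using L.indecK_nonzero[OF ind] zeroK_p_iff[OF wf] by blast
    fix X Y assume XY: "G.wf X \<and> G.wf Y \<and> G.iso T (dsum G X Y)"
    then have "L.iso (mapcx p T) (dsum L (mapcx p X) (mapcx p Y))"
      using p.iso_map[OF wf G.wf_dsum] p.dsum_map by metis
    then show "zeroK G f1 f2 X \<or> zeroK G f1 f2 Y"
      using L.indecK_split[OF ind p.wf_map p.wf_map] XY zeroK_p_iff by blast
  qed (rule wf)
next
  assume ind: "indecK G f1 f2 T"
  show "indecK L e1 e2 (mapcx p T)"
    unfolding indecK_def
  proof (intro conjI allI impI)
    show "\<not> zeroK L e1 e2 (mapcx p T)" using G.indecK_nonzero[OF ind] zeroK_p_iff[OF wf] by blast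
    fix X Y assume XY: "L.wf X \<and> L.wf Y \<and> L.iso (mapcx p T) (dsum L X Y)"
    then have "G.iso T (dsum G (mapcx s X) (mapcx s Y))"
      using s.iso_map[OF p.wf_map[OF wf] L.wf_dsum] s.dsum_map mapcx_s_p[OF wf ty] by metis
    then have "zeroK G f1 f2 (mapcx s X) \<or> zeroK G f1 f2 (mapcx s Y)"
      using G.indecK_split[OF ind s.wf_map s.wf_map] XY by blast
    then show "zeroK L e1 e2 X \<or> zeroK L e1 e2 Y"
      using XY zeroK_p_iff[OF s.wf_map] mapcx_p_s by metis
  qed (rule p.wf_map[OF wf])
qed

text \<open>The differential and the map to be decomposed lie in the corners where \<open>p\<close>
  and \<open>s\<close> are mutually inverse. The maps \<open>h1\<close> and \<open>h0\<close> are
  endomorphisms of T^-1 and T^0 and lie in other corners, but they only have to be pushed forward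
  along one homomorphism.\<close>

lemma presilting_p_iff:
  assumes wf: "G.wf T" and ty: "typed T"
  shows "presilting L e1 e2 (mapcx p T) \<longleftrightarrow> presilting G f1 f2 T"
proof
  have sub: "set (c0 T) \<subseteq> A0" "set (c1 T) \<subseteq> A1" using ty by (auto simp: typed_def)
  note d = G.wf_cd[OF wf]
  assume "presilting L e1 e2 (mapcx p T)"
  then have L: "\<forall>f\<in>L.H (c1 T) (c0 T). \<exists>h1\<in>L.H (c1 T) (c1 T). \<exists>h0\<in>L.H (c0 T) (c0 T).
      f = madd L (mcomp L (length (c1 T)) (mapm p (cd T)) h1) (mcomp L (length (c0 T)) h0 (mapm p (cd T)))"
    by (simp add: presilting_def shift_hom_zero_def)
  show "presilting G f1 f2 T"
    unfolding presilting_def shift_hom_zero_def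
  proof (intro conjI wf ballI)
    fix f assume f: "f \<in> G.H (c1 T) (c0 T)"
    from bspec[OF L p.mapm_H[OF f]] obtain h1 h0 where h: "h1 \<in> L.H (c1 T) (c1 T)" "h0 \<in> L.H (c0 T) (c0 T)"
      and eq: "mapm p f = madd L (mcomp L (length (c1 T)) (mapm p (cd T)) h1) (mcomp L (length (c0 T)) h0 (mapm p (cd T)))"
      by blast
    note MC = h[THEN L.H_MC] L.H_MC[OF p.mapm_H[OF d]]
    have "f = madd G (mcomp G (length (c1 T)) (cd T) (mapm s h1)) (mcomp G (length (c0 T)) (mapm s h0) (cd T))"
      using arg_cong[OF eq, of "mapm s"] mapm_s_p[OF f sub] mapm_s_p[OF d sub]
      by (simp only: s.mapm_ma s.mapm_mc MC L.mc_MC)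
    then show "\<exists>h1\<in>G.H (c1 T) (c1 T). \<exists>h0\<in>G.H (c0 T) (c0 T).
       f = madd G (mcomp G (length (c1 T)) (cd T) h1) (mcomp G (length (c0 T)) h0 (cd T))"
      by (intro bexI[OF _ s.mapm_H[OF h(1)]] bexI[OF _ s.mapm_H[OF h(2)]])
  qed
next
  note d = G.wf_cd[OF wf]
  assume "presilting G f1 f2 T"
  then have G: "\<forall>f\<in>G.H (c1 T) (c0 T). \<exists>h1\<in>G.H (c1 T) (c1 T). \<exists>h0\<in>G.H (c0 T) (c0 T).
      f = madd G (mcomp G (length (c1 T)) (cd T) h1) (mcomp G (length (c0 T)) h0 (cd T))"
    by (simp add: presilting_def shift_hom_zero_def)
  show "presilting L e1 e2 (mapcx p T)"
    unfolding presilting_def shift_hom_zero_def c_mapcx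
  proof (intro conjI p.wf_map[OF wf] ballI)
    fix f assume f: "f \<in> L.H (c1 T) (c0 T)"
    from bspec[OF G s.mapm_H[OF f]] obtain h1 h0 where h: "h1 \<in> G.H (c1 T) (c1 T)" "h0 \<in> G.H (c0 T) (c0 T)"
      and eq: "mapm s f = madd G (mcomp G (length (c1 T)) (cd T) h1) (mcomp G (length (c0 T)) h0 (cd T))"
      by blast
    note MC = h[THEN G.H_MC] G.H_MC[OF d]
    have "f = madd L (mcomp L (length (c1 T)) (mapm p (cd T)) (mapm p h1)) (mcomp L (length (c0 T)) (mapm p h0) (mapm p (cd T)))"
      using arg_cong[OF eq, of "mapm p"] mapm_p_s[OF L.H_MC[OF f]]
      by (simp only: p.mapm_ma p.mapm_mc MC G.mc_MC)
    then show "\<exists>h1\<in>L.H (c1 T) (c1 T). \<exists>h0\<in>L.H (c0 T) (c0 T).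
       f = madd L (mcomp L (length (c1 T)) (mapm p (cd T)) h1) (mcomp L (length (c0 T)) h0 (mapm p (cd T)))"
      by (intro bexI[OF _ p.mapm_H[OF h(1)]] bexI[OF _ p.mapm_H[OF h(2)]])
  qed
qed

lemma silting_list_p_iff:
  assumes wf: "\<And>T. T \<in> set Ts \<Longrightarrow> G.wf T" and ty: "\<And>T. T \<in> set Ts \<Longrightarrow> typed T"
  shows "silting_list L e1 e2 (map (mapcx p) Ts) \<longleftrightarrow> silting_list G f1 f2 Ts"
proof -
  have "typed (dsum_list G Ts)"
    using ty unfolding typed_def G.c_dsum_list by blast
  moreover have "G.wf (dsum_list G Ts)" using wf G.wf_dsum_list by blast
  ultimately have "presilting L e1 e2 (dsum_list L (map (mapcx p) Ts)) \<longleftrightarrow> presilting G f1 f2 (dsum_list G Ts)"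
    using presilting_p_iff p.dsum_list_map by metis
  moreover have "(\<forall>T\<in>set (map (mapcx p) Ts). indecK L e1 e2 T) \<longleftrightarrow> (\<forall>T\<in>set Ts. indecK G f1 f2 T)"
    using indecK_p_iff wf ty by simp
  moreover have "L.iso (map (mapcx p) Ts ! i) (map (mapcx p) Ts ! j) \<longleftrightarrow> G.iso (Ts!i) (Ts!j)"
    if "i < length Ts" "j < length Ts" for i j
    using iso_p_iff wf ty that by simp
  ultimately show ?thesis unfolding silting_list_def by simp
qed

lemma fan_part_retract: "fan_part G f1 f2 A0 A1 = fan_part L e1 e2 A0 A1"
proof (intro equalityI subsetI)
  fix C assume "C \<in> fan_part G f1 f2 A0 A1"
  then obtain Ts where Ts: "C = gcone (set (map gvec Ts))" "silting_list G f1 f2 Ts"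
    and ty: "\<And>T. T \<in> set Ts \<Longrightarrow> typed T"
    unfolding fan_part_def typed_def by blast
  have "G.wf T" if "T \<in> set Ts" for T
    using Ts(2) that G.indecK_wf by (simp add: silting_list_def)
  then have "silting_list L e1 e2 (map (mapcx p) Ts)"
    using silting_list_p_iff ty Ts(2) by blast
  moreover have "map gvec (map (mapcx p) Ts) = map gvec Ts" by simp
  moreover have "\<forall>T\<in>set (map (mapcx p) Ts). set (c0 T) \<subseteq> A0 \<and> set (c1 T) \<subseteq> A1"
    using ty by (auto simp: typed_def)
  ultimately show "C \<in> fan_part L e1 e2 A0 A1"
    unfolding fan_part_def Ts(1) by (intro CollectI exI[of _ "map (mapcx p) Ts"]) simp
next
  fix C assume "C \<in> fan_part L e1 e2 A0 A1"
  then obtain Ts where Ts: "C = gcone (set (map gvec Ts))" "silting_list L e1 e2 Ts"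
    and ty: "\<And>T. T \<in> set Ts \<Longrightarrow> typed T"
    unfolding fan_part_def typed_def by blast
  have wf: "L.wf T" if "T \<in> set Ts" for T
    using Ts(2) that L.indecK_wf by (simp add: silting_list_def)
  then have id: "map (mapcx p) (map (mapcx s) Ts) = Ts"
    using mapcx_p_s by (simp add: map_idI)
  have "G.wf T \<and> typed T" if T: "T \<in> set (map (mapcx s) Ts)" for T
  proof -
    obtain X where "X \<in> set Ts" "T = mapcx s X" using T unfolding set_map by blast
    then show ?thesis using s.wf_map wf ty by simp
  qed
  then have "silting_list G f1 f2 (map (mapcx s) Ts)"
    using silting_list_p_iff[of "map (mapcx s) Ts"] Ts(2) id by simp
  moreover have "map gvec (map (mapcx s) Ts) = map gvec Ts" by simp
  moreover have "\<forall>T\<in>set (map (mapcx s) Ts). set (c0 T) \<subseteq> A0 \<and> set (c1 T) \<subseteq> A1"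
    using ty by (auto simp: typed_def)
  ultimately show "C \<in> fan_part G f1 f2 A0 A1"
    unfolding fan_part_def Ts(1) by (intro CollectI exI[of _ "map (mapcx s) Ts"]) simp
qed

end

section \<open>The Jacobson radical\<close>

lemma right_idealD:
  fixes R :: "'a ring" (structure)
  assumes "right_ideal R I"
  shows "I \<subseteq> carrier R" "\<zero> \<in> I" "x \<in> I \<Longrightarrow> y \<in> I \<Longrightarrow> x \<oplus> y \<in> I"
    "x \<in> I \<Longrightarrow> \<ominus> x \<in> I" "x \<in> I \<Longrightarrow> a \<in> carrier R \<Longrightarrow> x \<otimes> a \<in> I"
  using assms by (simp_all add: right_ideal_def)

lemma right_ideal_one_full:
  fixes S :: "'c ring"
  assumes "ring S" "right_ideal S I" "\<one>\<^bsub>S\<^esub> \<in> I"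
  shows "I = carrier S"
proof
  show "I \<subseteq> carrier S" using right_idealD(1)[OF assms(2)] .
  show "carrier S \<subseteq> I"
  proof
    fix x assume x: "x \<in> carrier S"
    then have "\<one>\<^bsub>S\<^esub> \<otimes>\<^bsub>S\<^esub> x \<in> I" using right_idealD(5)[OF assms(2,3)] by blast
    then show "x \<in> I" using x ring.ring_simprules(12)[OF assms(1)] by simp
  qed
qed

lemma max_right_idealD: "max_right_ideal R M \<Longrightarrow> right_ideal R M" "max_right_ideal R M \<Longrightarrow> M \<noteq> carrier R"
  by (simp_all add: max_right_ideal_def)

lemma max_right_ideal_maximal:
  "max_right_ideal R M \<Longrightarrow> right_ideal R J \<Longrightarrow> M \<subseteq> J \<Longrightarrow> J = M \<or> J = carrier R"
  by (simp add: max_right_ideal_def)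

context
  fixes R :: "'a ring" (structure)
  assumes R: "ring R"
begin

interpretation ring R by (rule R)

text \<open>Zorn's lemma, with properness expressed as not containing 1, a condition that survives
  unions of chains.\<close>

lemma ex_max_right_ideal:
  assumes I: "right_ideal R I" "\<one> \<notin> I"
  shows "\<exists>M. max_right_ideal R M \<and> I \<subseteq> M"
proof -
  define A where "A = {J. right_ideal R J \<and> \<one> \<notin> J \<and> I \<subseteq> J}"
  have "\<Union>C \<in> A" if C: "C \<noteq> {}" "subset.chain A C" for C
  proof -
    have CA: "\<And>J. J \<in> C \<Longrightarrow> right_ideal R J \<and> \<one> \<notin> J \<and> I \<subseteq> J"
      using C(2) unfolding subset.chain_def A_def by blast
    obtain J0 where J0: "J0 \<in> C" using C(1) by blast
    have tot: "J \<subseteq> K \<or> K \<subseteq> J" if "J \<in> C" "K \<in> C" for J K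
      using C(2) that unfolding subset.chain_def by blast
    have "right_ideal R (\<Union>C)"
      unfolding right_ideal_def
    proof (intro conjI ballI)
      show "\<Union>C \<subseteq> carrier R" using CA right_idealD(1) by blast
      show "\<zero> \<in> \<Union>C" using CA[OF J0] J0 right_idealD(2)[of R] by blast
    next
      fix x y assume "x \<in> \<Union>C" "y \<in> \<Union>C"
      then obtain J K where JK: "J \<in> C" "K \<in> C" "x \<in> J" "y \<in> K" by blast
      then obtain M where "M \<in> C" "x \<in> M" "y \<in> M" using tot[OF JK(1,2)] by blast
      then show "x \<oplus> y \<in> \<Union>C" using CA right_idealD(3)[of R M] by blast
    next
      fix x assume "x \<in> \<Union>C"
      then obtain J where J: "J \<in> C" "x \<in> J" by blast
      then have "right_ideal R J" using CA by simp
      from right_idealD(4)[OF this J(2)] show "\<ominus> x \<in> \<Union>C" using J(1) by blast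
    next
      fix x a assume "x \<in> \<Union>C" and a: "a \<in> carrier R"
      then obtain J where J: "J \<in> C" "x \<in> J" by blast
      then have "right_ideal R J" using CA by simp
      from right_idealD(5)[OF this J(2) a] show "x \<otimes> a \<in> \<Union>C" using J(1) by blast
    qed
    then show ?thesis using CA J0 unfolding A_def by blast
  qed
  moreover have "I \<in> A" using I by (simp add: A_def)
  ultimately obtain M where M: "M \<in> A" "\<And>X. X \<in> A \<Longrightarrow> M \<subseteq> X \<Longrightarrow> X = M"
    using subset_Zorn_nonempty[of A] by blast
  have "max_right_ideal R M"
    unfolding max_right_ideal_def
  proof (intro conjI allI impI)
    show "right_ideal R M" using M(1) by (simp add: A_def)
    show "M \<noteq> carrier R" using M(1) one_closed by (auto simp: A_def)
    fix J assume J: "right_ideal R J \<and> M \<subseteq> J"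
    show "J = M \<or> J = carrier R"
    proof (cases "\<one> \<in> J")
      case True
      then show ?thesis using right_ideal_one_full[OF R] J by blast
    next
      case False
      then show ?thesis using M J by (auto simp: A_def)
    qed
  qed
  then show ?thesis using M(1) by (auto simp: A_def)
qed

text \<open>If 1 - x had no right inverse, the right ideal (1 - x) R would lie in a maximal one.
  That one contains x as well, hence 1.\<close>

lemma jacobson_quasi_regular:
  assumes x: "x \<in> jacobson R"
  shows "\<exists>y\<in>carrier R. (\<one> \<ominus> x) \<otimes> y = \<one>"
proof (rule ccontr)
  have xR: "x \<in> carrier R" using x by (simp add: jacobson_def)
  define u where "u = \<one> \<ominus> x"
  have u: "u \<in> carrier R" using xR by (simp add: u_def)
  assume "\<not> ?thesis"
  then have nu: "\<not> (\<exists>y\<in>carrier R. u \<otimes> y = \<one>)" by (simp add: u_def)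
  let ?I = "(\<lambda>y. u \<otimes> y) ` carrier R"
  have "right_ideal R ?I"
    unfolding right_ideal_def
  proof (intro conjI ballI)
    show "?I \<subseteq> carrier R" using u by auto
    show "\<zero> \<in> ?I" using u by (intro image_eqI[of _ _ \<zero>]) auto
  next
    fix a b assume "a \<in> ?I" "b \<in> ?I"
    then obtain y z where "y \<in> carrier R" "z \<in> carrier R" "a = u \<otimes> y" "b = u \<otimes> z" by blast
    then show "a \<oplus> b \<in> ?I" using u by (intro image_eqI[of _ _ "y \<oplus> z"]) (auto simp: r_distr)
  next
    fix a assume "a \<in> ?I"
    then obtain y where "y \<in> carrier R" "a = u \<otimes> y" by blast
    then show "\<ominus> a \<in> ?I" using u by (intro image_eqI[of _ _ "\<ominus> y"]) (auto simp: r_minus)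
  next
    fix a b assume "a \<in> ?I" "b \<in> carrier R"
    then obtain y where "y \<in> carrier R" "b \<in> carrier R" "a = u \<otimes> y" by blast
    then show "a \<otimes> b \<in> ?I" using u by (intro image_eqI[of _ _ "y \<otimes> b"]) (auto simp: m_assoc)
  qed
  moreover have "\<one> \<notin> ?I" using nu by (metis imageE)
  ultimately obtain M where M: "max_right_ideal R M" "?I \<subseteq> M" using ex_max_right_ideal by blast
  have "x \<in> M" using x M(1) by (simp add: jacobson_def)
  moreover have "u \<in> M" using M(2) u by (metis image_eqI one_closed r_one subsetD)
  ultimately have "u \<oplus> x \<in> M" using right_idealD(3)[OF max_right_idealD(1)[OF M(1)]] by blast
  moreover have "u \<oplus> x = \<one>" using xR by (simp add: u_def minus_eq a_assoc l_neg)
  ultimately have "\<one> \<in> M" by simp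
  then show False using right_ideal_one_full[OF R max_right_idealD(1)[OF M(1)]] max_right_idealD(2)[OF M(1)] by blast
qed

end

section \<open>From a pair of characters back to primitive idempotents and the radical\<close>

lemma (in elem2) idempotent_in_kernel:
  assumes "a \<in> carrier R" "a \<otimes> a = a" "\<chi> 1 a = 0" "\<chi> 2 a = 0" shows "a = \<zero>"
proof -
  obtain y where y: "y \<in> carrier R" "(\<one> \<ominus> a) \<otimes> y = \<one>" using quasi_regular assms by blast
  \<comment> \<open>a annihilates 1 - a, which has a right inverse because both characters kill
    a.\<close>
  have "a \<otimes> (\<one> \<ominus> a) = \<zero>" using assms(1,2) by (simp add: minus_eq r_distr r_minus r_neg)
  then have "a \<otimes> ((\<one> \<ominus> a) \<otimes> y) = \<zero>" using assms(1) y(1) by (simp add: m_assoc[symmetric])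
  then show ?thesis using y assms(1) by simp
qed

text \<open>If e_i = a + b with orthogonal idempotents a and b, then \<open>\<chi> i\<close> kills
  one of them because a b = 0, and the other character kills both. An idempotent killed by both
  characters is 0.\<close>

lemma (in elem2) prim_idem_E:
  assumes i: "i \<in> {1,2}" shows "prim_idem R (E i)"
  unfolding prim_idem_def
proof (intro conjI allI impI)
  show "idem R (E i)" by (simp add: idem_def)
  show "E i \<noteq> \<zero>" using \<chi>_E[OF i i] by auto
  fix a b assume "idem R a \<and> idem R b \<and> a \<otimes> b = \<zero> \<and> b \<otimes> a = \<zero> \<and> a \<oplus> b = E i"
  then have a: "a \<in> carrier R" "a \<otimes> a = a" and b: "b \<in> carrier R" "b \<otimes> b = b"
    and ab: "a \<otimes> b = \<zero>" "b \<otimes> a = \<zero>" "a \<oplus> b = E i" by (auto simp: idem_def)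
  have aE: "a \<otimes> E i = a" unfolding ab(3)[symmetric] using a b ab(1,2) by (simp add: r_distr)
  have bE: "b \<otimes> E i = b" unfolding ab(3)[symmetric] using a b ab(1,2) by (simp add: r_distr)
  have other: "\<chi> j a = 0 \<and> \<chi> j b = 0" if j: "j \<in> {1,2}" "j \<noteq> i" for j
  proof -
    have "\<chi> j a = \<chi> j a * \<chi> j (E i)" "\<chi> j b = \<chi> j b * \<chi> j (E i)"
      using a b aE bE by (metis E_closed \<chi>_mult)+
    then show ?thesis using \<chi>_E[OF j(1) i] j(2) by simp
  qed
  have "\<chi> i a * \<chi> i b = 0" using \<chi>_mult[OF a(1) b(1), of i] ab by simp
  then consider "\<chi> i a = 0" | "\<chi> i b = 0" by auto
  then show "a = \<zero> \<or> b = \<zero>"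
  proof cases
    case 1
    have "\<chi> j a = 0" if "j \<in> {1,2}" for j using 1 other[OF that] by blast
    then show ?thesis using idempotent_in_kernel[OF a] by blast
  next
    case 2
    have "\<chi> j b = 0" if "j \<in> {1,2}" for j using 2 other[OF that] by blast
    then show ?thesis using idempotent_in_kernel[OF b] by blast
  qed
qed

lemma (in elem2) \<chi>_one: "\<chi> i \<one> = 1"
proof -
  obtain y where y: "y \<in> carrier R" "\<chi> i y = 1" using \<chi>_surj by blast
  then show ?thesis using \<chi>_mult[OF y(1) one_closed, of i] by simp
qed

text \<open>The kernel has codimension one. For z outside it and y with
  \<open>\<chi> i y = 1 / \<chi> i z\<close>, the element 1 - z y is in the kernel, so a right ideal
  that contains z and the kernel contains 1.\<close>

lemma (in elem2) max_right_ideal_kernel: "max_right_ideal R {x \<in> carrier R. \<chi> i x = 0}"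
  unfolding max_right_ideal_def
proof (intro conjI allI impI)
  let ?K = "{x \<in> carrier R. \<chi> i x = 0}"
  show "right_ideal R ?K"
    unfolding right_ideal_def by (auto simp: \<chi>_add \<chi>_mult \<chi>_minus)
  have "\<one> \<notin> ?K" using \<chi>_one[of i] by simp
  then show "?K \<noteq> carrier R" using one_closed by metis
  fix J assume J: "right_ideal R J \<and> ?K \<subseteq> J"
  show "J = ?K \<or> J = carrier R"
  proof (cases "J \<subseteq> ?K")
    case False
    then obtain z where z: "z \<in> J" "\<chi> i z \<noteq> 0" "z \<in> carrier R" using J right_idealD(1)[of R J] by blast
    obtain y where y: "y \<in> carrier R" "\<chi> i y = 1 / \<chi> i z" using \<chi>_surj by blast
    have "\<chi> i (\<one> \<ominus> z \<otimes> y) = 0"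
      using z y by (simp add: minus_eq \<chi>_add \<chi>_minus \<chi>_mult \<chi>_one)
    then have "\<one> \<ominus> z \<otimes> y \<in> J" using J z y by auto
    moreover have "z \<otimes> y \<in> J" using J z y right_idealD(5)[of R J] by blast
    ultimately have "(\<one> \<ominus> z \<otimes> y) \<oplus> z \<otimes> y \<in> J" using J right_idealD(3)[of R J] by blast
    then have "\<one> \<in> J" using z y by (simp add: minus_eq a_assoc l_neg)
    then show ?thesis using right_ideal_one_full[OF ring_axioms] J by blast
  qed (use J in blast)
qed

text \<open>The radical lies in the two kernels because these are maximal. Conversely, if both
  characters kill x and x is not in a maximal M, then M + x R = R gives 1 = m + x a, and m = 1 - x a
  is a right invertible element of M.\<close>

lemma (in elem2) jacobson_eq: "{x \<in> carrier R. \<chi> 1 x = 0 \<and> \<chi> 2 x = 0} = jacobson R" (is "?K = _")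
proof
  show "jacobson R \<subseteq> ?K"
    using max_right_ideal_kernel[of 1] max_right_ideal_kernel[of 2] unfolding jacobson_def by blast
  show "?K \<subseteq> jacobson R"
  proof
    fix x assume x: "x \<in> ?K"
    have "x \<in> M" if M: "max_right_ideal R M" for M
    proof (rule ccontr)
      assume xM: "x \<notin> M"
      have rM: "right_ideal R M" using max_right_idealD(1)[OF M] .
      note sub = right_idealD(1)[OF rM]
      let ?J = "{m \<oplus> x \<otimes> a | m a. m \<in> M \<and> a \<in> carrier R}"
      have rJ: "right_ideal R ?J"
        unfolding right_ideal_def
      proof (intro conjI ballI)
        show "?J \<subseteq> carrier R" using sub x by auto
        have "\<zero> = \<zero> \<oplus> x \<otimes> \<zero>" "\<zero> \<in> M" using x right_idealD(2)[OF rM] by auto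
        then show "\<zero> \<in> ?J" by blast
      next
        fix u v assume "u \<in> ?J" "v \<in> ?J"
        then obtain m a n b where h: "m \<in> M" "a \<in> carrier R" "n \<in> M" "b \<in> carrier R"
          "u = m \<oplus> x \<otimes> a" "v = n \<oplus> x \<otimes> b" by blast
        then have mn: "m \<in> carrier R" "n \<in> carrier R" using sub by auto
        have "u \<oplus> v = (m \<oplus> n) \<oplus> x \<otimes> (a \<oplus> b)"
          using h mn x by (simp add: r_distr a_ac)
        moreover have "m \<oplus> n \<in> M" using h right_idealD[OF rM] by blast
        ultimately show "u \<oplus> v \<in> ?J" using h by blast
      next
        fix u assume "u \<in> ?J"
        then obtain m a where h: "m \<in> M" "a \<in> carrier R" "u = m \<oplus> x \<otimes> a" by blast
        then have "m \<in> carrier R" using sub by auto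
        then have "\<ominus> u = \<ominus> m \<oplus> x \<otimes> (\<ominus> a)"
          using h x by (simp add: r_minus minus_add)
        moreover have "\<ominus> m \<in> M" using h right_idealD[OF rM] by blast
        ultimately show "\<ominus> u \<in> ?J" using h by blast
      next
        fix u c assume "u \<in> ?J" and c: "c \<in> carrier R"
        then obtain m a where h: "m \<in> M" "a \<in> carrier R" "u = m \<oplus> x \<otimes> a" by blast
        then have "m \<in> carrier R" using sub by auto
        then have "u \<otimes> c = m \<otimes> c \<oplus> x \<otimes> (a \<otimes> c)"
          using h x c by (simp add: l_distr m_assoc)
        moreover have "m \<otimes> c \<in> M" using h c right_idealD(5)[OF rM] by blast
        ultimately show "u \<otimes> c \<in> ?J" using h c by blast
      qed
      have MJ: "M \<subseteq> ?J"
      proof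
        fix m assume m: "m \<in> M"
        then have "m = m \<oplus> x \<otimes> \<zero>" using x sub by auto
        then show "m \<in> ?J" using m by blast
      qed
      have xJ: "x \<in> ?J"
      proof -
        have "x = \<zero> \<oplus> x \<otimes> \<one>" "\<zero> \<in> M" using x right_idealD(2)[OF rM] by auto
        then show ?thesis by blast
      qed
      have "?J \<noteq> M" using xJ xM by metis
      then have "?J = carrier R" using max_right_ideal_maximal[OF M rJ MJ] by simp
      then have "\<one> \<in> ?J" by simp
      then obtain m a where h: "m \<in> M" "a \<in> carrier R" "\<one> = m \<oplus> x \<otimes> a" by blast
      have mR: "m \<in> carrier R" using h sub by auto
      have m: "m = \<one> \<ominus> x \<otimes> a"
        unfolding h(3) using mR h(2) x by (simp add: minus_eq a_assoc r_neg)
      have "\<exists>y\<in>carrier R. (\<one> \<ominus> x \<otimes> a) \<otimes> y = \<one>"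
        by (rule quasi_regular) (use x h in \<open>auto simp: \<chi>_mult\<close>)
      then obtain y where "y \<in> carrier R" "m \<otimes> y = \<one>" unfolding m by blast
      then have "\<one> \<in> M" using right_idealD(5)[OF rM h(1)] by metis
      then show False using right_ideal_one_full[OF ring_axioms rM] max_right_idealD(2)[OF M] by blast
    qed
    then show "x \<in> jacobson R" using x unfolding jacobson_def by blast
  qed
qed

text \<open>\<open>elementary2\<close> supplies the two characters in no particular order. Their
  values on e1 are 0 or 1, and as neither e1 nor e2 is killed by both, exactly one of them is 1 on
  e1; that one receives the index 1.\<close>

lemma elem2_of_elementary2:
  fixes R :: "'a ring" (structure) and sm :: "'k::field \<Rightarrow> 'a \<Rightarrow> 'a"
  assumes alg: "kalg R sm" and el: "elementary2 R sm" and cp: "cpoi R e1 e2"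
  shows "\<exists>\<chi> :: nat \<Rightarrow> 'a \<Rightarrow> 'k. elem2 R e1 e2 \<chi> \<and> (\<forall>i c. \<forall>x\<in>carrier R. \<chi> i (sm c x) = c * \<chi> i x)"
proof -
  have ring: "ring R" using alg by (simp add: kalg_def)
  interpret ring R by (rule ring)
  obtain \<phi> \<psi> where h: "khom R sm \<phi>" "khom R sm \<psi>"
    and surj: "(\<lambda>x. (\<phi> x, \<psi> x)) ` carrier R = UNIV"
    and ker: "{x\<in>carrier R. \<phi> x = 0 \<and> \<psi> x = 0} = jacobson R"
    using el unfolding elementary2_def by blast
  have add: "\<phi> (x \<oplus> y) = \<phi> x + \<phi> y" "\<psi> (x \<oplus> y) = \<psi> x + \<psi> y"
    and mult: "\<phi> (x \<otimes> y) = \<phi> x * \<phi> y" "\<psi> (x \<otimes> y) = \<psi> x * \<psi> y"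
    if "x \<in> carrier R" "y \<in> carrier R" for x y
    using h that by (simp_all add: khom_def)
  have one: "\<phi> \<one> = 1" "\<psi> \<one> = 1" using h by (simp_all add: khom_def)
  have sm: "\<phi> (sm c x) = c * \<phi> x" "\<psi> (sm c x) = c * \<psi> x" if "x \<in> carrier R" for c x
    using h that by (simp_all add: khom_def)
  have e: "e1 \<in> carrier R" "e2 \<in> carrier R" "e1 \<otimes> e1 = e1" "e2 \<otimes> e2 = e2" "e1 \<noteq> \<zero>" "e2 \<noteq> \<zero>"
    "e1 \<oplus> e2 = \<one>"
    using cp by (simp_all add: cpoi_def prim_idem_def idem_def)
  have qr: "\<exists>y\<in>carrier R. (\<one> \<ominus> x) \<otimes> y = \<one>" if "x \<in> carrier R" "\<phi> x = 0" "\<psi> x = 0" for x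
    by (rule jacobson_quasi_regular[OF ring]) (use that ker in blast)
  have nz: "\<not> (\<phi> x = 0 \<and> \<psi> x = 0)" if x: "x \<in> carrier R" "x \<otimes> x = x" "x \<noteq> \<zero>" for x
  proof
    assume "\<phi> x = 0 \<and> \<psi> x = 0"
    then obtain y where y: "y \<in> carrier R" "(\<one> \<ominus> x) \<otimes> y = \<one>" using qr x(1) by blast
    have "x \<otimes> (\<one> \<ominus> x) = \<zero>" using x by (simp add: minus_eq r_distr r_minus r_neg)
    then have "x \<otimes> ((\<one> \<ominus> x) \<otimes> y) = \<zero>" using x y(1) by (simp add: m_assoc[symmetric])
    then show False using y x by simp
  qed
  have id01: "t = 0 \<or> t = 1" if "t * t = t" for t :: 'k using that by auto
  have vals: "\<phi> e1 = 0 \<or> \<phi> e1 = 1" "\<psi> e1 = 0 \<or> \<psi> e1 = 1"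
    using mult[OF e(1,1)] e(3) id01 by metis+
  have sum: "\<phi> e1 + \<phi> e2 = 1" "\<psi> e1 + \<psi> e2 = 1"
    using add[OF e(1,2)] e(7) one by metis+
  have mk: "elem2 R e1 e2 (\<lambda>i::nat. if i = 1 then \<alpha> else \<beta>)
      \<and> (\<forall>i c. \<forall>x\<in>carrier R. (if (i::nat) = 1 then \<alpha> else \<beta>) (sm c x) = c * (if i = 1 then \<alpha> else \<beta>) x)"
    if ab: "(\<alpha> = \<phi> \<and> \<beta> = \<psi>) \<or> (\<alpha> = \<psi> \<and> \<beta> = \<phi>)" and v: "\<alpha> e1 = 1" "\<beta> e1 = 0" "\<alpha> e2 = 0" "\<beta> e2 = 1" for \<alpha> \<beta>
  proof (intro conjI allI ballI)
    show "(if i = 1 then \<alpha> else \<beta>) (sm c x) = c * (if i = 1 then \<alpha> else \<beta>) x" if "x \<in> carrier R" for i :: nat and c x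
      using ab sm[OF that] by auto
    show "elem2 R e1 e2 (\<lambda>i::nat. if i = 1 then \<alpha> else \<beta>)"
    proof unfold_locales
      fix i :: nat and c
      have "(c, c) \<in> (\<lambda>x. (\<phi> x, \<psi> x)) ` carrier R" unfolding surj by simp
      then show "\<exists>y\<in>carrier R. (if i = 1 then \<alpha> else \<beta>) y = c" using ab by auto
    next
      fix x y and i :: nat assume "x \<in> carrier R" "y \<in> carrier R"
      then show "(if i = 1 then \<alpha> else \<beta>) (x \<oplus> y) = (if i = 1 then \<alpha> else \<beta>) x + (if i = 1 then \<alpha> else \<beta>) y"
        "(if i = 1 then \<alpha> else \<beta>) (x \<otimes> y) = (if i = 1 then \<alpha> else \<beta>) x * (if i = 1 then \<alpha> else \<beta>) y"
        using ab add mult by auto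
    next
      fix x assume "x \<in> carrier R" "(if (1::nat) = 1 then \<alpha> else \<beta>) x = 0" "(if (2::nat) = 1 then \<alpha> else \<beta>) x = 0"
      then show "\<exists>y\<in>carrier R. (\<one> \<ominus> x) \<otimes> y = \<one>" using ab qr by auto
    qed (use e v in \<open>auto simp: ev_def\<close>)
  qed
  consider "\<phi> e1 = 1" "\<psi> e1 = 0" | "\<phi> e1 = 0" "\<psi> e1 = 1"
    using vals nz[OF e(1,3,5)] nz[OF e(2,4,6)] sum by fastforce
  then show ?thesis
  proof cases
    case 1
    then have "\<phi> e2 = 0" "\<psi> e2 = 1" using sum by auto
    then show ?thesis using mk[of \<phi> \<psi>] 1 by blast
  next
    case 2
    then have "\<phi> e2 = 1" "\<psi> e2 = 0" using sum by auto
    then show ?thesis using mk[of \<psi> \<phi>] 2 by blast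
  qed
qed

section \<open>The fibre product\<close>

locale kelem2 = elem2 R e1 e2 \<chi> for R :: "'a ring" (structure) and e1 e2 :: 'a and \<chi> :: "nat \<Rightarrow> 'a \<Rightarrow> 'k::field" +
  fixes sm :: "'k \<Rightarrow> 'a \<Rightarrow> 'a"
  assumes alg: "kalg R sm"
    and \<chi>_sm: "x \<in> carrier R \<Longrightarrow> \<chi> i (sm c x) = c * \<chi> i x"
    and e_orth: "e1 \<otimes> e2 = \<zero>" "e2 \<otimes> e1 = \<zero>" and e_sum: "e1 \<oplus> e2 = \<one>"
begin

lemma sm_closed [simp]: "x \<in> carrier R \<Longrightarrow> sm c x \<in> carrier R"
  and sm_add: "x \<in> carrier R \<Longrightarrow> y \<in> carrier R \<Longrightarrow> sm c (x \<oplus> y) = sm c x \<oplus> sm c y"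
  and sm_plus: "x \<in> carrier R \<Longrightarrow> sm (c + d) x = sm c x \<oplus> sm d x"
  and sm_times: "x \<in> carrier R \<Longrightarrow> sm (c * d) x = sm c (sm d x)"
  and sm_one: "x \<in> carrier R \<Longrightarrow> sm 1 x = x"
  and sm_mult_left: "x \<in> carrier R \<Longrightarrow> y \<in> carrier R \<Longrightarrow> sm c x \<otimes> y = sm c (x \<otimes> y)"
  and sm_mult_right: "x \<in> carrier R \<Longrightarrow> y \<in> carrier R \<Longrightarrow> x \<otimes> sm c y = sm c (x \<otimes> y)"
  using alg unfolding kalg_def by metis+

lemma sm_zero_left [simp]: assumes "x \<in> carrier R" shows "sm 0 x = \<zero>"
proof -
  have "sm 0 x \<oplus> sm 0 x = \<zero> \<oplus> sm 0 x" using sm_plus[OF assms, of 0 0] assms by simp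
  then show ?thesis using assms by (metis add.right_cancel sm_closed zero_closed)
qed

lemma sm_zero_right [simp]: "sm c \<zero> = \<zero>"
  using sm_mult_right[of \<zero> \<zero> c] sm_closed[of \<zero> c] by simp

lemma sm_minus: assumes "x \<in> carrier R" shows "sm c (\<ominus> x) = \<ominus> sm c x"
proof -
  have "sm c (\<ominus> x) \<oplus> sm c x = \<zero>" using sm_add[of "\<ominus> x" x c] assms by (simp add: l_neg)
  then show ?thesis using assms by (simp add: minus_equality)
qed

text \<open>The k-algebra section k x k -> R of the pair of characters; its image is the semisimple
  subalgebra k e1 + k e2.\<close>

definition diag :: "'k \<Rightarrow> 'k \<Rightarrow> 'a" where "diag a b = sm a e1 \<oplus> sm b e2"

lemma diag_closed [simp]: "diag a b \<in> carrier R"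
  by (simp add: diag_def e_closed)

lemma diag_add: "diag (a + c) (b + d) = diag a b \<oplus> diag c d"
  by (simp add: diag_def e_closed sm_plus a_ac)

lemma diag_mult: "diag (a * c) (b * d) = diag a b \<otimes> diag c d"
  by (simp add: diag_def e_closed sm_mult_left sm_mult_right l_distr r_distr e_orth e_idem sm_times[symmetric] mult.commute)

lemma diag_one: "diag 1 1 = \<one>"
  by (simp add: diag_def e_closed sm_one e_sum)

lemma diag_zero [simp]: "diag 0 0 = \<zero>"
  by (simp add: diag_def e_closed)

lemma diag_e1: "diag 1 0 = e1" and diag_e2: "diag 0 1 = e2"
  by (simp_all add: diag_def e_closed sm_one)

lemma diag_sm: "diag (c * a) (c * b) = sm c (diag a b)"
  by (simp add: diag_def e_closed sm_times sm_add)

lemma \<chi>_e [simp]: "\<chi> (Suc 0) e1 = 1" "\<chi> (Suc 0) e2 = 0" "\<chi> 2 e1 = 0" "\<chi> 2 e2 = 1"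
  using \<chi>_E[of 1 1] \<chi>_E[of 1 2] \<chi>_E[of 2 1] \<chi>_E[of 2 2] by (simp_all add: ev_def)

lemma \<chi>_diag [simp]: "\<chi> (Suc 0) (diag a b) = a" "\<chi> 2 (diag a b) = b"
  by (simp_all add: diag_def e_closed \<chi>_add \<chi>_sm)

lemma cpoi: "cpoi R e1 e2"
  unfolding cpoi_def using prim_idem_E[of 1] prim_idem_E[of 2] e_orth e_sum by (simp add: ev_def)

lemma elementary: "elementary2 R sm"
  unfolding elementary2_def
proof (rule exI[of _ "\<chi> 1"], rule exI[of _ "\<chi> 2"], intro conjI)
  show "khom R sm (\<chi> 1)" "khom R sm (\<chi> 2)"
    unfolding khom_def by (simp_all add: \<chi>_add \<chi>_mult \<chi>_one \<chi>_sm)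
  have "(a, b) \<in> (\<lambda>x. (\<chi> 1 x, \<chi> 2 x)) ` carrier R" for a b
    by (rule image_eqI[of _ _ "diag a b"]) simp_all
  then show "(\<lambda>x. (\<chi> 1 x, \<chi> 2 x)) ` carrier R = UNIV" by auto
qed (rule jacobson_eq)

definition kspan :: "'a set \<Rightarrow> 'a set" where
  "kspan B = {x. \<exists>f. x = (\<Oplus>b\<in>B. sm (f b) b)}"

lemma kspan_zero: "B \<subseteq> carrier R \<Longrightarrow> \<zero> \<in> kspan B"
  unfolding kspan_def by (intro CollectI exI[of _ "\<lambda>_. 0"] finsum_zero_terms[symmetric]) auto

lemma kspan_add:
  assumes "B \<subseteq> carrier R" "x \<in> kspan B" "y \<in> kspan B" shows "x \<oplus> y \<in> kspan B"
proof -
  obtain f g where "x = (\<Oplus>b\<in>B. sm (f b) b)" "y = (\<Oplus>b\<in>B. sm (g b) b)"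
    using assms(2,3) unfolding kspan_def by blast
  moreover have "(\<Oplus>b\<in>B. sm (f b) b) \<oplus> (\<Oplus>b\<in>B. sm (g b) b) = (\<Oplus>b\<in>B. sm (f b) b \<oplus> sm (g b) b)"
    by (rule finsum_addf[symmetric]) (use assms(1) in auto)
  moreover have "\<dots> = (\<Oplus>b\<in>B. sm (f b + g b) b)"
    by (rule finsum_cong') (use assms(1) in \<open>auto simp: sm_plus\<close>)
  ultimately show ?thesis unfolding kspan_def by (intro CollectI exI[of _ "\<lambda>b. f b + g b"]) simp
qed

lemma kspan_sm:
  assumes "finite B" "B \<subseteq> carrier R" "b \<in> B" shows "sm c b \<in> kspan B"
proof -
  have "(\<Oplus>a\<in>B. sm (if a = b then c else 0) a) = sm (if b = b then c else 0) b"
    by (rule finsum_single_term) (use assms in auto)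
  then show ?thesis unfolding kspan_def by (intro CollectI exI[of _ "\<lambda>a. if a = b then c else 0"]) simp
qed

end

text \<open>Induction over B instead of carrying the coefficients over to \<open>W\<close>, because
  \<open>F\<close> may identify elements of B.\<close>

lemma linear_image_kspan:
  assumes L: "kelem2 L e1 e2 \<chi> sm" and G: "kelem2 G f1 f2 \<xi> tm"
    and cl: "\<And>x. x \<in> carrier L \<Longrightarrow> F x \<in> carrier G"
    and add: "\<And>x y. x \<in> carrier L \<Longrightarrow> y \<in> carrier L \<Longrightarrow> F (x \<oplus>\<^bsub>L\<^esub> y) = F x \<oplus>\<^bsub>G\<^esub> F y"
    and sc: "\<And>c x. x \<in> carrier L \<Longrightarrow> F (sm c x) = tm c (F x)"
    and W: "finite W" "W \<subseteq> carrier G" and B: "finite B" "B \<subseteq> carrier L" "F ` B \<subseteq> W"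
  shows "F (finsum L (\<lambda>b. sm (f b) b) B) \<in> kelem2.kspan G tm W"
proof -
  interpret L: kelem2 L e1 e2 \<chi> sm by (rule L)
  interpret G: kelem2 G f1 f2 \<xi> tm by (rule G)
  show ?thesis
    using B
  proof (induction B rule: finite_induct)
    case empty
    have "F \<zero>\<^bsub>L\<^esub> = \<zero>\<^bsub>G\<^esub>" using sc[of "\<zero>\<^bsub>L\<^esub>" 0] cl[of "\<zero>\<^bsub>L\<^esub>"] by simp
    then show ?case using G.kspan_zero[OF W(2)] by simp
  next
    case (insert b B)
    then have fb: "F (sm (f b) b) \<in> G.kspan W"
      using G.kspan_sm[OF W] sc by auto
    have "F (finsum L (\<lambda>b. sm (f b) b) (insert b B)) = F (sm (f b) b) \<oplus>\<^bsub>G\<^esub> F (finsum L (\<lambda>b. sm (f b) b) B)"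
      using insert by (subst L.finsum_insert) (auto simp: Pi_def subset_iff intro!: add)
    then show ?case using G.kspan_add[OF W(2) fb] insert by simp
  qed
qed

text \<open>\<open>\<psi>\<close> encodes pairs injectively in the type \<open>'c\<close>, so that
  the fibre product can live on a prescribed type whatever the types of its factors;
  \<open>p\<close> and \<open>q\<close> decode the coordinates.\<close>

locale glue = L: kelem2 L e1 e2 \<chi> sm + M: kelem2 M d1 d2 \<xi> tm
  for L :: "'a ring" and e1 e2 and \<chi> :: "nat \<Rightarrow> 'a \<Rightarrow> 'k::field" and sm
    and M :: "'b ring" and d1 d2 and \<xi> :: "nat \<Rightarrow> 'b \<Rightarrow> 'k" and tm +
  fixes \<psi> :: "'a \<times> 'b \<Rightarrow> 'c"
  assumes inj: "inj_on \<psi> (carrier L \<times> carrier M)"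
begin

definition fib :: "('a \<times> 'b) set" where
  "fib = {(x, y). x \<in> carrier L \<and> y \<in> carrier M \<and> \<chi> 1 x = \<xi> 1 y \<and> \<chi> 2 x = \<xi> 2 y}"

definition p :: "'c \<Rightarrow> 'a" where "p g = fst (inv_into fib \<psi> g)"
definition q :: "'c \<Rightarrow> 'b" where "q g = snd (inv_into fib \<psi> g)"

definition G :: "'c ring" where
  "G = \<lparr>carrier = \<psi> ` fib, mult = (\<lambda>a b. \<psi> (p a \<otimes>\<^bsub>L\<^esub> p b, q a \<otimes>\<^bsub>M\<^esub> q b)), one = \<psi> (\<one>\<^bsub>L\<^esub>, \<one>\<^bsub>M\<^esub>),
     zero = \<psi> (\<zero>\<^bsub>L\<^esub>, \<zero>\<^bsub>M\<^esub>), add = (\<lambda>a b. \<psi> (p a \<oplus>\<^bsub>L\<^esub> p b, q a \<oplus>\<^bsub>M\<^esub> q b))\<rparr>"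

definition smG :: "'k \<Rightarrow> 'c \<Rightarrow> 'c" where "smG c g = \<psi> (sm c (p g), tm c (q g))"

lemma inj_fib: "inj_on \<psi> fib"
  using inj by (rule inj_on_subset) (auto simp: fib_def)

text \<open>The conditions are written with \<open>Suc 0\<close>, the form to which the simplifier
  rewrites the index 1, so that they match as rewrite rules.\<close>

lemma pq_\<psi> [simp]:
  assumes "x \<in> carrier L" "y \<in> carrier M" "\<chi> (Suc 0) x = \<xi> (Suc 0) y" "\<chi> 2 x = \<xi> 2 y"
  shows "\<psi> (x, y) \<in> carrier G" "p (\<psi> (x, y)) = x" "q (\<psi> (x, y)) = y"
proof -
  have m: "(x, y) \<in> fib" using assms by (simp add: fib_def)
  then show "\<psi> (x, y) \<in> carrier G" by (simp add: G_def)
  show "p (\<psi> (x, y)) = x" "q (\<psi> (x, y)) = y"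
    unfolding p_def q_def using inv_into_f_f[OF inj_fib m] by simp_all
qed

lemma carrier_G:
  assumes "g \<in> carrier G"
  shows "p g \<in> carrier L" "q g \<in> carrier M" "\<chi> (Suc 0) (p g) = \<xi> (Suc 0) (q g)" "\<chi> 2 (p g) = \<xi> 2 (q g)"
    "\<psi> (p g, q g) = g"
proof -
  obtain x y where "(x, y) \<in> fib" and g: "g = \<psi> (x, y)" using assms by (auto simp: G_def)
  then have xy: "x \<in> carrier L" "y \<in> carrier M" "\<chi> (Suc 0) x = \<xi> (Suc 0) y" "\<chi> 2 x = \<xi> 2 y"
    by (auto simp: fib_def)
  show "p g \<in> carrier L" "q g \<in> carrier M" "\<chi> (Suc 0) (p g) = \<xi> (Suc 0) (q g)" "\<chi> 2 (p g) = \<xi> 2 (q g)"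
    "\<psi> (p g, q g) = g"
    unfolding g pq_\<psi>[OF xy] by (rule xy refl)+
qed

lemma G_eqI: "g \<in> carrier G \<Longrightarrow> h \<in> carrier G \<Longrightarrow> p g = p h \<Longrightarrow> q g = q h \<Longrightarrow> g = h"
  by (metis carrier_G(5))

lemma G_add [simp]:
  assumes "g \<in> carrier G" "h \<in> carrier G"
  shows "g \<oplus>\<^bsub>G\<^esub> h \<in> carrier G" "p (g \<oplus>\<^bsub>G\<^esub> h) = p g \<oplus>\<^bsub>L\<^esub> p h" "q (g \<oplus>\<^bsub>G\<^esub> h) = q g \<oplus>\<^bsub>M\<^esub> q h"
proof -
  have "g \<oplus>\<^bsub>G\<^esub> h = \<psi> (p g \<oplus>\<^bsub>L\<^esub> p h, q g \<oplus>\<^bsub>M\<^esub> q h)" by (simp add: G_def)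
  then show "g \<oplus>\<^bsub>G\<^esub> h \<in> carrier G" "p (g \<oplus>\<^bsub>G\<^esub> h) = p g \<oplus>\<^bsub>L\<^esub> p h" "q (g \<oplus>\<^bsub>G\<^esub> h) = q g \<oplus>\<^bsub>M\<^esub> q h"
    using carrier_G[OF assms(1)] carrier_G[OF assms(2)] by (simp_all add: L.\<chi>_add M.\<chi>_add)
qed

lemma G_mult [simp]:
  assumes "g \<in> carrier G" "h \<in> carrier G"
  shows "g \<otimes>\<^bsub>G\<^esub> h \<in> carrier G" "p (g \<otimes>\<^bsub>G\<^esub> h) = p g \<otimes>\<^bsub>L\<^esub> p h" "q (g \<otimes>\<^bsub>G\<^esub> h) = q g \<otimes>\<^bsub>M\<^esub> q h"
proof -
  have "g \<otimes>\<^bsub>G\<^esub> h = \<psi> (p g \<otimes>\<^bsub>L\<^esub> p h, q g \<otimes>\<^bsub>M\<^esub> q h)" by (simp add: G_def)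
  then show "g \<otimes>\<^bsub>G\<^esub> h \<in> carrier G" "p (g \<otimes>\<^bsub>G\<^esub> h) = p g \<otimes>\<^bsub>L\<^esub> p h" "q (g \<otimes>\<^bsub>G\<^esub> h) = q g \<otimes>\<^bsub>M\<^esub> q h"
    using carrier_G[OF assms(1)] carrier_G[OF assms(2)] by (simp_all add: L.\<chi>_mult M.\<chi>_mult)
qed

lemma G_one [simp]: "\<one>\<^bsub>G\<^esub> \<in> carrier G" "p \<one>\<^bsub>G\<^esub> = \<one>\<^bsub>L\<^esub>" "q \<one>\<^bsub>G\<^esub> = \<one>\<^bsub>M\<^esub>"
proof -
  have "\<one>\<^bsub>G\<^esub> = \<psi> (\<one>\<^bsub>L\<^esub>, \<one>\<^bsub>M\<^esub>)" by (simp add: G_def)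
  then show "\<one>\<^bsub>G\<^esub> \<in> carrier G" "p \<one>\<^bsub>G\<^esub> = \<one>\<^bsub>L\<^esub>" "q \<one>\<^bsub>G\<^esub> = \<one>\<^bsub>M\<^esub>"
    by (simp_all add: L.\<chi>_one M.\<chi>_one)
qed

lemma G_zero [simp]: "\<zero>\<^bsub>G\<^esub> \<in> carrier G" "p \<zero>\<^bsub>G\<^esub> = \<zero>\<^bsub>L\<^esub>" "q \<zero>\<^bsub>G\<^esub> = \<zero>\<^bsub>M\<^esub>"
proof -
  have "\<zero>\<^bsub>G\<^esub> = \<psi> (\<zero>\<^bsub>L\<^esub>, \<zero>\<^bsub>M\<^esub>)" by (simp add: G_def)
  then show "\<zero>\<^bsub>G\<^esub> \<in> carrier G" "p \<zero>\<^bsub>G\<^esub> = \<zero>\<^bsub>L\<^esub>" "q \<zero>\<^bsub>G\<^esub> = \<zero>\<^bsub>M\<^esub>" by simp_all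
qed

lemma smG [simp]:
  assumes "g \<in> carrier G"
  shows "smG c g \<in> carrier G" "p (smG c g) = sm c (p g)" "q (smG c g) = tm c (q g)"
  unfolding smG_def using carrier_G[OF assms] by (simp_all add: L.\<chi>_sm M.\<chi>_sm)

lemma p_closed [simp]: "g \<in> carrier G \<Longrightarrow> p g \<in> carrier L"
  and q_closed [simp]: "g \<in> carrier G \<Longrightarrow> q g \<in> carrier M"
  by (simp_all add: carrier_G)

lemma ring_G: "ring G"
proof (rule ringI)
  show "abelian_group G"
  proof (rule abelian_groupI)
    fix x assume x: "x \<in> carrier G"
    let ?y = "\<psi> (\<ominus>\<^bsub>L\<^esub> p x, \<ominus>\<^bsub>M\<^esub> q x)"
    have y: "?y \<in> carrier G" "p ?y = \<ominus>\<^bsub>L\<^esub> p x" "q ?y = \<ominus>\<^bsub>M\<^esub> q x"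
      using carrier_G[OF x] by (simp_all add: L.\<chi>_minus M.\<chi>_minus)
    have "?y \<oplus>\<^bsub>G\<^esub> x = \<zero>\<^bsub>G\<^esub>"
      by (rule G_eqI) (use x y in \<open>simp_all add: L.l_neg M.l_neg\<close>)
    then show "\<exists>y\<in>carrier G. y \<oplus>\<^bsub>G\<^esub> x = \<zero>\<^bsub>G\<^esub>" using y(1) by blast
  qed (auto intro!: G_eqI simp: L.a_ac M.a_ac)
  show "monoid G"
    by (rule monoidI) (auto intro!: G_eqI simp: L.m_assoc M.m_assoc)
qed (auto intro!: G_eqI simp: L.l_distr M.l_distr L.r_distr M.r_distr)

definition f1 :: 'c where "f1 = \<psi> (e1, d1)"
definition f2 :: 'c where "f2 = \<psi> (e2, d2)"

lemma f_simps [simp]: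
  "f1 \<in> carrier G" "p f1 = e1" "q f1 = d1" "f2 \<in> carrier G" "p f2 = e2" "q f2 = d2"
  unfolding f1_def f2_def by (simp_all add: L.e_closed M.e_closed)

text \<open>Read off the first factor. For the indices 1 and 2 the fibre condition makes it agree
  with \<open>\<xi> i (q g)\<close>; other indices carry no such guarantee.\<close>

definition \<chi>G :: "nat \<Rightarrow> 'c \<Rightarrow> 'k" where "\<chi>G i g = \<chi> i (p g)"

definition s :: "'a \<Rightarrow> 'c" where "s x = \<psi> (x, M.diag (\<chi> 1 x) (\<chi> 2 x))"
definition t :: "'b \<Rightarrow> 'c" where "t y = \<psi> (L.diag (\<xi> 1 y) (\<xi> 2 y), y)"

lemma s_simps [simp]:
  assumes "x \<in> carrier L"
  shows "s x \<in> carrier G" "p (s x) = x" "q (s x) = M.diag (\<chi> 1 x) (\<chi> 2 x)"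
  unfolding s_def using assms by simp_all

lemma t_simps [simp]:
  assumes "y \<in> carrier M"
  shows "t y \<in> carrier G" "q (t y) = y" "p (t y) = L.diag (\<xi> 1 y) (\<xi> 2 y)"
  unfolding t_def using assms by simp_all

interpretation G: ring G by (rule ring_G)

text \<open>Subtraction in \<open>G\<close> is derived from the ring structure, so its coordinates
  are found by solving (x - y) + y = x in each factor.\<close>

lemma minus_G:
  assumes "x \<in> carrier G" "y \<in> carrier G"
  shows "p (x \<ominus>\<^bsub>G\<^esub> y) = p x \<ominus>\<^bsub>L\<^esub> p y" "q (x \<ominus>\<^bsub>G\<^esub> y) = q x \<ominus>\<^bsub>M\<^esub> q y"
proof -
  have "(x \<ominus>\<^bsub>G\<^esub> y) \<oplus>\<^bsub>G\<^esub> y = x" using assms by (simp add: G.minus_eq G.a_assoc G.l_neg)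
  then have "p (x \<ominus>\<^bsub>G\<^esub> y) \<oplus>\<^bsub>L\<^esub> p y = p x" "q (x \<ominus>\<^bsub>G\<^esub> y) \<oplus>\<^bsub>M\<^esub> q y = q x"
    using G_add(2,3)[of "x \<ominus>\<^bsub>G\<^esub> y" y] assms by simp_all
  moreover have "a = (a \<oplus>\<^bsub>L\<^esub> b) \<ominus>\<^bsub>L\<^esub> b" if "a \<in> carrier L" "b \<in> carrier L" for a b
    using that by (simp add: L.minus_eq L.a_assoc L.r_neg)
  moreover have "a = (a \<oplus>\<^bsub>M\<^esub> b) \<ominus>\<^bsub>M\<^esub> b" if "a \<in> carrier M" "b \<in> carrier M" for a b
    using that by (simp add: M.minus_eq M.a_assoc M.r_neg)
  ultimately show "p (x \<ominus>\<^bsub>G\<^esub> y) = p x \<ominus>\<^bsub>L\<^esub> p y" "q (x \<ominus>\<^bsub>G\<^esub> y) = q x \<ominus>\<^bsub>M\<^esub> q y"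
    using assms by (metis p_closed G.minus_closed, metis q_closed G.minus_closed)
qed

lemma kelem2_G: "kelem2 G f1 f2 \<chi>G smG"
proof unfold_locales
  show "f1 \<in> carrier G" "f2 \<in> carrier G" by simp_all
  show "f1 \<otimes>\<^bsub>G\<^esub> f1 = f1" "f2 \<otimes>\<^bsub>G\<^esub> f2 = f2" "f1 \<otimes>\<^bsub>G\<^esub> f2 = \<zero>\<^bsub>G\<^esub>" "f2 \<otimes>\<^bsub>G\<^esub> f1 = \<zero>\<^bsub>G\<^esub>" "f1 \<oplus>\<^bsub>G\<^esub> f2 = \<one>\<^bsub>G\<^esub>"
    by (auto intro!: G_eqI simp: L.e_idem M.e_idem L.e_orth M.e_orth L.e_sum M.e_sum)
  show "\<chi>G i (x \<oplus>\<^bsub>G\<^esub> y) = \<chi>G i x + \<chi>G i y" "\<chi>G i (x \<otimes>\<^bsub>G\<^esub> y) = \<chi>G i x * \<chi>G i y"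
    if "x \<in> carrier G" "y \<in> carrier G" for i x y
    using that by (simp_all add: \<chi>G_def L.\<chi>_add L.\<chi>_mult)
  show "\<exists>y\<in>carrier G. \<chi>G i y = c" for i c
  proof -
    obtain x where "x \<in> carrier L" "\<chi> i x = c" using L.\<chi>_surj by blast
    then show ?thesis by (intro bexI[of _ "s x"]) (simp_all add: \<chi>G_def)
  qed
  show "\<chi>G i (ev f1 f2 j) = (if i = j then 1 else 0)" if "i \<in> {1,2}" "j \<in> {1,2}" for i j
    using L.\<chi>_E[OF that] by (simp add: \<chi>G_def ev_def split: if_splits)
  show "\<exists>y\<in>carrier G. (\<one>\<^bsub>G\<^esub> \<ominus>\<^bsub>G\<^esub> x) \<otimes>\<^bsub>G\<^esub> y = \<one>\<^bsub>G\<^esub>"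
    if x: "x \<in> carrier G" "\<chi>G 1 x = 0" "\<chi>G 2 x = 0" for x
  proof -
    have z: "\<chi> 1 (p x) = 0" "\<chi> 2 (p x) = 0" "\<xi> 1 (q x) = 0" "\<xi> 2 (q x) = 0"
      using x carrier_G[OF x(1)] by (simp_all add: \<chi>G_def)
    obtain a where a: "a \<in> carrier L" "(\<one>\<^bsub>L\<^esub> \<ominus>\<^bsub>L\<^esub> p x) \<otimes>\<^bsub>L\<^esub> a = \<one>\<^bsub>L\<^esub>"
      using L.quasi_regular[OF p_closed[OF x(1)] z(1,2)] by blast
    obtain b where b: "b \<in> carrier M" "(\<one>\<^bsub>M\<^esub> \<ominus>\<^bsub>M\<^esub> q x) \<otimes>\<^bsub>M\<^esub> b = \<one>\<^bsub>M\<^esub>"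
      using M.quasi_regular[OF q_closed[OF x(1)] z(3,4)] by blast
    \<comment> \<open>The right inverses found in the two factors form an element of the fibre
      product: a character that kills p x is 1 on a, and likewise for q x and b.\<close>
    have "\<chi> i a = 1" if "\<chi> i (p x) = 0" for i
      using arg_cong[OF a(2), of "\<chi> i"] a(1) x(1) that
      by (simp add: L.\<chi>_mult L.\<chi>_one L.minus_eq L.\<chi>_add L.\<chi>_minus)
    moreover have "\<xi> i b = 1" if "\<xi> i (q x) = 0" for i
      using arg_cong[OF b(2), of "\<xi> i"] b(1) x(1) that
      by (simp add: M.\<chi>_mult M.\<chi>_one M.minus_eq M.\<chi>_add M.\<chi>_minus)
    ultimately have ab: "\<psi> (a, b) \<in> carrier G" "p (\<psi> (a, b)) = a" "q (\<psi> (a, b)) = b"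
      using pq_\<psi>[OF a(1) b(1)] z by simp_all
    have "(\<one>\<^bsub>G\<^esub> \<ominus>\<^bsub>G\<^esub> x) \<otimes>\<^bsub>G\<^esub> \<psi> (a, b) = \<one>\<^bsub>G\<^esub>"
      by (rule G_eqI) (use x(1) a b ab in \<open>simp_all add: minus_G\<close>)
    then show ?thesis using ab(1) by blast
  qed
  show "kalg G smG"
    unfolding kalg_def
    by (auto intro!: G_eqI ring_G simp: L.sm_add M.sm_add L.sm_plus M.sm_plus L.sm_times M.sm_times
        L.sm_one M.sm_one L.sm_mult_left M.sm_mult_left L.sm_mult_right M.sm_mult_right)
  show "\<chi>G i (smG c x) = c * \<chi>G i x" if "x \<in> carrier G" for x i c
    using that by (simp add: \<chi>G_def L.\<chi>_sm)
qed

text \<open>As a vector space the fibre product is the sum of s(L), a copy of the first factor, and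
  0 x rad M.\<close>

lemma fin_dim_G:
  assumes "fin_dim L sm" "fin_dim M tm" shows "fin_dim G smG"
proof -
  interpret K: kelem2 G f1 f2 \<chi>G smG by (rule kelem2_G)
  obtain B where B: "finite B" "B \<subseteq> carrier L" "\<And>x. x \<in> carrier L \<Longrightarrow> \<exists>f. x = finsum L (\<lambda>b. sm (f b) b) B"
    using assms(1) unfolding fin_dim_def by blast
  obtain C where C: "finite C" "C \<subseteq> carrier M" "\<And>x. x \<in> carrier M \<Longrightarrow> \<exists>f. x = finsum M (\<lambda>b. tm (f b) b) C"
    using assms(2) unfolding fin_dim_def by blast
  \<comment> \<open>The radical component of y, placed over 0. It is linear in y, so it carries a
    spanning set of \<open>M\<close> to one of 0 x rad M.\<close>
  define r where "r y = \<psi> (\<zero>\<^bsub>L\<^esub>, y \<ominus>\<^bsub>M\<^esub> M.diag (\<xi> 1 y) (\<xi> 2 y))" for y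
  have r: "r y \<in> carrier G" "p (r y) = \<zero>\<^bsub>L\<^esub>" "q (r y) = y \<ominus>\<^bsub>M\<^esub> M.diag (\<xi> 1 y) (\<xi> 2 y)" if "y \<in> carrier M" for y
    unfolding r_def using that by (simp_all add: M.minus_eq M.\<chi>_add M.\<chi>_minus)
  let ?W = "s ` B \<union> r ` C"
  have W: "finite ?W" "?W \<subseteq> carrier G" using B C r(1) by auto
  have s_lin: "s (x \<oplus>\<^bsub>L\<^esub> y) = s x \<oplus>\<^bsub>G\<^esub> s y" "s (sm c x) = smG c (s x)" if "x \<in> carrier L" "y \<in> carrier L" for x y c
    by (rule G_eqI; use that in \<open>simp add: L.\<chi>_add M.diag_add L.\<chi>_sm M.diag_sm\<close>)+
  have r_lin: "r (x \<oplus>\<^bsub>M\<^esub> y) = r x \<oplus>\<^bsub>G\<^esub> r y" "r (tm c x) = smG c (r x)" if "x \<in> carrier M" "y \<in> carrier M" for x y c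
    by (rule G_eqI; use that r in \<open>simp add: M.\<chi>_add M.diag_add M.\<chi>_sm M.diag_sm M.minus_eq M.minus_add M.a_ac M.sm_add M.sm_minus\<close>)+
  have "g \<in> K.kspan ?W" if g: "g \<in> carrier G" for g
  proof -
    obtain a where a: "p g = finsum L (\<lambda>b. sm (a b) b) B" using B(3) g p_closed by blast
    obtain b where b: "q g = finsum M (\<lambda>c. tm (b c) c) C" using C(3) g q_closed by blast
    have "s (p g) \<in> K.kspan ?W"
      unfolding a
      by (rule linear_image_kspan[OF L.kelem2_axioms kelem2_G]) (use B W s_lin in auto)
    moreover have "r (q g) \<in> K.kspan ?W"
      unfolding b
      by (rule linear_image_kspan[OF M.kelem2_axioms kelem2_G]) (use C W r_lin r in auto)
    \<comment> \<open>The diagonal parts in the second coordinate cancel because p g and q g have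
      the same residues.\<close>
    moreover have "g = s (p g) \<oplus>\<^bsub>G\<^esub> r (q g)"
      by (rule G_eqI) (use g r carrier_G[OF g] in
        \<open>simp_all add: M.minus_eq M.a_assoc M.r_neg2 M.a_lcomm[of "M.diag _ _"] M.r_neg\<close>)
    ultimately show ?thesis using K.kspan_add[OF W(2)] by metis
  qed
  then show ?thesis
    unfolding fin_dim_def K.kspan_def using W by blast
qed

lemma fan_part_12:
  assumes "\<And>y. y \<in> carrier M \<Longrightarrow> d1 \<otimes>\<^bsub>M\<^esub> y \<otimes>\<^bsub>M\<^esub> d2 = \<zero>\<^bsub>M\<^esub>"
  shows "fan_part G f1 f2 {1} {2} = fan_part L e1 e2 {1} {2}"
proof -
  interpret K: kelem2 G f1 f2 \<chi>G smG by (rule kelem2_G)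
  interpret elem2_retract G f1 f2 L e1 e2 p s \<chi>G \<chi> "{1}" "{2}"
  proof unfold_locales
    show "p \<in> ring_hom G L" by (rule ring_hom_memI) simp_all
    show "s \<in> ring_hom L G"
      by (rule ring_hom_memI; (rule G_eqI)?; simp add: L.\<chi>_add L.\<chi>_mult M.diag_add M.diag_mult L.\<chi>_one M.diag_one)
    show "p f1 = e1" "p f2 = e2" by simp_all
    show "s e1 = f1" "s e2 = f2"
      by (rule G_eqI; simp add: L.e_closed M.diag_e1 M.diag_e2)+
    show "p (s y) = y" if "y \<in> carrier L" for y using that by simp
    show "\<chi> l (p x) = \<chi>G l x" for l x by (simp add: \<chi>G_def)
    fix i j :: nat and x
    assume "i \<in> {1}" "j \<in> {2}" and x: "x \<in> carrier G" and "ev f1 f2 i \<otimes>\<^bsub>G\<^esub> x = x" "x \<otimes>\<^bsub>G\<^esub> ev f1 f2 j = x"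
    then have f: "f1 \<otimes>\<^bsub>G\<^esub> x = x" "x \<otimes>\<^bsub>G\<^esub> f2 = x" by (simp_all add: ev_def)
    \<comment> \<open>q x lies in d1 M d2 = 0, and p x in e1 L e2, which both characters kill. So
      the second coordinate of s (p x), a diagonal element, is 0 as well.\<close>
    have q: "q x = d1 \<otimes>\<^bsub>M\<^esub> q x" "q x = q x \<otimes>\<^bsub>M\<^esub> d2" "p x = e1 \<otimes>\<^bsub>L\<^esub> p x" "p x = p x \<otimes>\<^bsub>L\<^esub> e2"
      using f x G_mult by (metis f_simps)+
    have "q x = \<zero>\<^bsub>M\<^esub>" using assms[of "q x"] q(1,2) x by (metis q_closed)
    moreover have "\<chi> (Suc 0) (p x) = 0" "\<chi> 2 (p x) = 0"
      using arg_cong[OF q(4), of "\<chi> (Suc 0)"] arg_cong[OF q(3), of "\<chi> 2"] x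
      by (simp_all add: L.\<chi>_mult L.e_closed)
    ultimately show "s (p x) = x"
      by (intro G_eqI) (use x in simp_all)
  qed
  show ?thesis by (rule fan_part_retract)
qed

lemma fan_part_21:
  assumes "\<And>y. y \<in> carrier L \<Longrightarrow> e2 \<otimes>\<^bsub>L\<^esub> y \<otimes>\<^bsub>L\<^esub> e1 = \<zero>\<^bsub>L\<^esub>"
  shows "fan_part G f1 f2 {2} {1} = fan_part M d1 d2 {2} {1}"
proof -
  interpret K: kelem2 G f1 f2 \<chi>G smG by (rule kelem2_G)
  \<comment> \<open>\<open>elem2_retract\<close> asks for compatible characters at every index,
    while \<open>\<chi>G\<close> and \<open>\<xi>\<close> are known to agree along q only at 1 and
    2. All other indices are redirected to 2.\<close>
  define \<zeta> where "\<zeta> i = \<xi> (if i = 1 then 1 else 2)" for i :: nat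
  define \<zeta>G where "\<zeta>G i = \<chi>G (if i = 1 then 1 else 2)" for i :: nat
  interpret M': elem2 M d1 d2 \<zeta>
    by unfold_locales (use M.\<chi>_E M.quasi_regular in \<open>auto simp: \<zeta>_def M.\<chi>_add M.\<chi>_mult M.\<chi>_surj\<close>)
  interpret G': elem2 G f1 f2 \<zeta>G
    by unfold_locales (use K.\<chi>_E K.quasi_regular in \<open>auto simp: \<zeta>G_def K.\<chi>_add K.\<chi>_mult K.\<chi>_surj\<close>)
  interpret elem2_retract G f1 f2 M d1 d2 q t \<zeta>G \<zeta> "{2}" "{1}"
  proof unfold_locales
    show "q \<in> ring_hom G M" by (rule ring_hom_memI) simp_all
    show "t \<in> ring_hom M G"
      by (rule ring_hom_memI; (rule G_eqI)?; simp add: M.\<chi>_add M.\<chi>_mult L.diag_add L.diag_mult M.\<chi>_one L.diag_one)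
    show "q f1 = d1" "q f2 = d2" by simp_all
    show "t d1 = f1" "t d2 = f2"
      by (rule G_eqI; simp add: M.e_closed L.diag_e1 L.diag_e2)+
    show "q (t y) = y" if "y \<in> carrier M" for y using that by simp
    show "\<zeta> l (q x) = \<zeta>G l x" if "x \<in> carrier G" for l x
      using carrier_G[OF that] by (simp add: \<zeta>_def \<zeta>G_def \<chi>G_def)
    fix i j :: nat and x
    assume "i \<in> {2}" "j \<in> {1}" and x: "x \<in> carrier G" and "ev f1 f2 i \<otimes>\<^bsub>G\<^esub> x = x" "x \<otimes>\<^bsub>G\<^esub> ev f1 f2 j = x"
    then have f: "f2 \<otimes>\<^bsub>G\<^esub> x = x" "x \<otimes>\<^bsub>G\<^esub> f1 = x" by (simp_all add: ev_def)
    have q: "p x = e2 \<otimes>\<^bsub>L\<^esub> p x" "p x = p x \<otimes>\<^bsub>L\<^esub> e1" "q x = d2 \<otimes>\<^bsub>M\<^esub> q x" "q x = q x \<otimes>\<^bsub>M\<^esub> d1"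
      using f x G_mult by (metis f_simps)+
    have "p x = \<zero>\<^bsub>L\<^esub>" using assms[of "p x"] q(1,2) x by (metis p_closed)
    moreover have "\<xi> (Suc 0) (q x) = 0" "\<xi> 2 (q x) = 0"
      using arg_cong[OF q(3), of "\<xi> (Suc 0)"] arg_cong[OF q(4), of "\<xi> 2"] x
      by (simp_all add: M.\<chi>_mult M.e_closed)
    ultimately show "t (q x) = x"
      by (intro G_eqI) (use x in simp_all)
  qed
  show ?thesis by (rule fan_part_retract)
qed

end

section \<open>Gluing the fans\<close>

text \<open>An arbitrary choice of coefficients is injective; linearity is not needed to transport the ring
  structure.\<close>

lemma (in kelem2) fin_dim_inj:
  assumes "fin_dim R sm" shows "\<exists>\<iota> :: 'a \<Rightarrow> nat \<Rightarrow> 'k. inj_on \<iota> (carrier R)"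
proof -
  obtain B where B: "finite B" "B \<subseteq> carrier R" "\<And>x. x \<in> carrier R \<Longrightarrow> \<exists>f. x = (\<Oplus>b\<in>B. sm (f b) b)"
    using assms unfolding fin_dim_def by blast
  then obtain a where a: "\<And>x. x \<in> carrier R \<Longrightarrow> x = (\<Oplus>b\<in>B. sm (a x b) b)" by metis
  obtain e :: "'a \<Rightarrow> nat" where e: "inj_on e B"
    using finite_imp_inj_to_nat_seg[OF B(1)] by blast
  have "inj_on (\<lambda>x n. a x (inv_into B e n)) (carrier R)"
  proof (rule inj_onI)
    fix x y assume xy: "x \<in> carrier R" "y \<in> carrier R"
      and eq: "(\<lambda>n. a x (inv_into B e n)) = (\<lambda>n. a y (inv_into B e n))"
    have "a x b = a y b" if "b \<in> B" for b
      using fun_cong[OF eq, of "e b"] e that by simp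
    then have "(\<Oplus>b\<in>B. sm (a x b) b) = (\<Oplus>b\<in>B. sm (a y b) b)"
      by (intro finsum_cong') (use B(2) in auto)
    then show "x = y" using a[OF xy(1)] a[OF xy(2)] by simp
  qed
  then show ?thesis by blast
qed

text \<open>Coefficients of the first factor sit at even positions, those of the second at odd ones;
  a pair becomes one sequence of scalars.\<close>

lemma inj_on_interleave:
  fixes f :: "'a \<Rightarrow> nat \<Rightarrow> 'k" and g :: "'b \<Rightarrow> nat \<Rightarrow> 'k"
  assumes "inj_on f A" "inj_on g B"
  shows "inj_on (\<lambda>(x, y) n. if even n then f x (n div 2) else g y (n div 2)) (A \<times> B)"
proof (rule inj_onI, clarify)
  fix x y x' y' assume xy: "x \<in> A" "y \<in> B" "x' \<in> A" "y' \<in> B"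
    and eq: "(\<lambda>n. if even n then f x (n div 2) else g y (n div 2)) = (\<lambda>n. if even n then f x' (n div 2) else g y' (n div 2))"
  have "f x m = f x' m" "g y m = g y' m" for m
    using fun_cong[OF eq, of "2 * m"] fun_cong[OF eq, of "2 * m + 1"] by simp_all
  then have "f x = f x'" "g y = g y'" by auto
  then show "x = x' \<and> y = y'" using assms xy by (auto dest: inj_onD)
qed

section \<open>Cones, half-planes and the star product\<close>

lemma gcone_mem:
  assumes "finite S" "v \<in> S" shows "v \<in> gcone S"
proof -
  have "(\<Sum>w\<in>S. (if w = v then 1 else 0) * h w) = h v" for h :: "real \<times> real \<Rightarrow> real"
  proof -
    have "(\<Sum>w\<in>S. (if w = v then 1 else 0) * h w) = (\<Sum>w\<in>S. if w = v then h w else 0)"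
      by (rule sum.cong) auto
    then show ?thesis using assms by simp
  qed
  then show ?thesis
    unfolding gcone_def by (intro CollectI exI[of _ "\<lambda>w. if w = v then 1 else 0"]) simp
qed

text \<open>Cones are told apart below by a closed half-plane that contains the generators of one
  and misses a point of the other.\<close>

lemma gcone_functional_nonneg:
  assumes "\<And>v. v \<in> S \<Longrightarrow> 0 \<le> a * fst v + b * snd v" "u \<in> gcone S"
  shows "0 \<le> a * fst u + b * snd u"
proof -
  obtain c where c: "\<And>v. v \<in> S \<Longrightarrow> c v \<ge> 0" and u: "u = ((\<Sum>v\<in>S. c v * fst v), (\<Sum>v\<in>S. c v * snd v))"
    using assms(2) unfolding gcone_def by blast
  have "a * fst u + b * snd u = (\<Sum>v\<in>S. c v * (a * fst v + b * snd v))"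
    unfolding u by (simp add: sum_distrib_left sum.distrib distrib_left mult.left_commute)
  also have "\<dots> \<ge> 0" using c assms(1) by (intro sum_nonneg mult_nonneg_nonneg) auto
  finally show ?thesis .
qed

lemma fan_part_functional:
  fixes R :: "'a ring"
  assumes "C \<in> fan_part R e1 e2 A0 A1" "u \<in> C"
    and "\<And>T :: 'a cx. set (c0 T) \<subseteq> A0 \<Longrightarrow> set (c1 T) \<subseteq> A1 \<Longrightarrow> 0 \<le> a * fst (gvec T) + b * snd (gvec T)"
  shows "0 \<le> a * fst u + b * snd u"
proof -
  obtain Ts :: "'a cx list" where C: "C = gcone (set (map gvec Ts))"
    and Ts: "\<forall>T\<in>set Ts. set (c0 T) \<subseteq> A0 \<and> set (c1 T) \<subseteq> A1"
    using assms(1) unfolding fan_part_def by blast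
  show ?thesis
    by (rule gcone_functional_nonneg[OF _ assms(2)[unfolded C]]) (use Ts assms(3) in auto)
qed

lemma sigma_mem: "(-1, 0) \<in> sigma_mp" "(0, 1) \<in> sigma_mp" "(1, 0) \<in> sigma_pm" "(0, -1) \<in> sigma_pm"
  unfolding sigma_mp_def sigma_pm_def by (rule gcone_mem; simp)+

lemma count_list_0: "set xs \<subseteq> A \<Longrightarrow> x \<notin> A \<Longrightarrow> count_list xs x = 0"
  by (auto simp: count_list_0_iff)

text \<open>Every g-vector of this sign pattern has first coordinate at least 0, whereas
  \<open>sigma_mp\<close> contains (-1, 0).\<close>

lemma sigma_mp_notin_12: "sigma_mp \<notin> fan_part R e1 e2 {1} {2}"
proof
  assume C: "sigma_mp \<in> fan_part R e1 e2 {1} {2}"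
  have "0 \<le> 1 * fst (-1 :: real, 0 :: real) + 0 * snd (-1 :: real, 0 :: real)"
  proof (rule fan_part_functional[OF C sigma_mem(1)])
    fix T :: "'a cx" assume "set (c1 T) \<subseteq> {2}"
    then have "count_list (c1 T) 1 = 0" by (rule count_list_0) simp
    then show "0 \<le> 1 * fst (gvec T) + 0 * snd (gvec T)" by (simp add: gvec_def)
  qed
  then show False by simp
qed

text \<open>Separated by minus the first coordinate, which is nonnegative for this sign pattern and
  -1 at (1, 0).\<close>

lemma sigma_pm_notin_21: "sigma_pm \<notin> fan_part R e1 e2 {2} {1}"
proof
  assume C: "sigma_pm \<in> fan_part R e1 e2 {2} {1}"
  have "0 \<le> (-1) * fst (1 :: real, 0 :: real) + 0 * snd (1 :: real, 0 :: real)"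
  proof (rule fan_part_functional[OF C sigma_mem(3)])
    fix T :: "'a cx" assume "set (c0 T) \<subseteq> {2}"
    then have "count_list (c0 T) 1 = 0" by (rule count_list_0) simp
    then show "0 \<le> (-1) * fst (gvec T) + 0 * snd (gvec T)" by (simp add: gvec_def)
  qed
  then show False by simp
qed

lemma (in elem2) fan_part_pp: "fan_part R e1 e2 {1,2} {} = gcone ` Pow {(1, 0), (0, 1)}"
  using fan_part_trivial[of "{1,2}" "{}"] by (simp add: svec_def)

lemma (in elem2) fan_part_mm: "fan_part R e1 e2 {} {1,2} = gcone ` Pow {(-1, 0), (0, -1)}"
  using fan_part_trivial[of "{}" "{1,2}"] by (simp add: svec_def)

lemma sigma_notin_pp:
  assumes "S \<subseteq> {(1, 0), (0, 1)}" shows "sigma_mp \<noteq> gcone S" "sigma_pm \<noteq> gcone S"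
proof -
  have "0 \<le> fst u \<and> 0 \<le> snd u" if "u \<in> gcone S" for u
    using gcone_functional_nonneg[of S 1 0 u] gcone_functional_nonneg[of S 0 1 u] assms that by fastforce
  then show "sigma_mp \<noteq> gcone S" "sigma_pm \<noteq> gcone S" using sigma_mem by fastforce+
qed

lemma sigma_notin_mm:
  assumes "S \<subseteq> {(-1, 0), (0, -1)}" shows "sigma_mp \<noteq> gcone S" "sigma_pm \<noteq> gcone S"
proof -
  have "0 \<ge> fst u \<and> 0 \<ge> snd u" if "u \<in> gcone S" for u
    using gcone_functional_nonneg[of S "-1" 0 u] gcone_functional_nonneg[of S 0 "-1" u] assms that by fastforce
  then show "sigma_mp \<noteq> gcone S" "sigma_pm \<noteq> gcone S" using sigma_mem by fastforce+
qed

lemma is2d_sigma: "is2d sigma_mp" "is2d sigma_pm"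
  unfolding is2d_def using sigma_mem
  by (intro bexI[OF _ sigma_mem(1)] bexI[OF _ sigma_mem(2)], simp)
    (intro bexI[OF _ sigma_mem(3)] bexI[OF _ sigma_mem(4)], simp)

lemma gcone_Pow_pair: "gcone ` Pow {a, b} = {gcone {}, gcone {a}, gcone {b}, gcone {a, b}}"
  by (auto simp: Pow_insert)

text \<open>The proper faces of \<open>sigma_mp\<close> and \<open>sigma_pm\<close> already occur in
  P and N, so deleting these two cones removes the trivial quadrants and no ray.
  \<open>sigma_pm\<close> may well belong to A; it survives there, being deleted from the second fan
  only.\<close>

lemma fan_star_eq:
  assumes A: "sigma_mp \<notin> A" and B: "sigma_pm \<notin> B"
    and defs: "P = gcone ` Pow {(1, 0), (0, 1)}" "N = gcone ` Pow {(-1, 0), (0, -1)}"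
  shows "fan_star (A \<union> gcone ` Pow {(0, 1), (-1, 0)} \<union> P \<union> N) (gcone ` Pow {(1, 0), (0, -1)} \<union> B \<union> P \<union> N)
    = A \<union> B \<union> P \<union> N"
proof -
  have PN: "sigma_mp \<notin> P \<union> N" "sigma_pm \<notin> P \<union> N"
    unfolding defs using sigma_notin_pp sigma_notin_mm by auto
  have in_PN: "gcone {} \<in> P \<union> N" "gcone {(0, 1)} \<in> P \<union> N" "gcone {(-1, 0)} \<in> P \<union> N"
    "gcone {(1, 0)} \<in> P \<union> N" "gcone {(0, -1)} \<in> P \<union> N"
    unfolding defs gcone_Pow_pair by simp_all
  have X: "gcone ` Pow {(0, 1), (-1, 0)} \<subseteq> insert sigma_mp (P \<union> N)"
    using in_PN unfolding gcone_Pow_pair sigma_mp_def by (simp add: insert_commute)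
  have Y: "gcone ` Pow {(1, 0), (0, -1)} \<subseteq> insert sigma_pm (P \<union> N)"
    using in_PN unfolding gcone_Pow_pair sigma_pm_def by simp
  \<comment> \<open>Each trivial part is treated abstractly, as its two-dimensional cone together
    with cones that are already in P or N.\<close>
  have "fan_star (A \<union> X \<union> P \<union> N) (Y \<union> B \<union> P \<union> N) = A \<union> B \<union> P \<union> N"
    if XY: "X \<subseteq> insert sigma_mp (P \<union> N)" "Y \<subseteq> insert sigma_pm (P \<union> N)" for X Y
  proof (intro equalityI subsetI)
    fix C assume C: "C \<in> A \<union> B \<union> P \<union> N"
    have "C \<noteq> sigma_mp" if "C \<in> A \<union> P \<union> N" using A PN that by blast
    moreover have "C \<noteq> sigma_pm" if "C \<in> B" using B that by blast
    ultimately show "C \<in> fan_star (A \<union> X \<union> P \<union> N) (Y \<union> B \<union> P \<union> N)"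
      using C unfolding fan_star_def by (cases "is2d C"; cases "C \<in> B") auto
  next
    fix C assume C: "C \<in> fan_star (A \<union> X \<union> P \<union> N) (Y \<union> B \<union> P \<union> N)"
    have "C = sigma_mp \<or> C \<in> P \<union> N" if "C \<in> X" using XY(1) that by blast
    moreover have "C = sigma_pm \<or> C \<in> P \<union> N" if "C \<in> Y" using XY(2) that by blast
    ultimately show "C \<in> A \<union> B \<union> P \<union> N"
      using C is2d_sigma unfolding fan_star_def by (cases "C \<in> P \<union> N"; cases "C \<in> X"; cases "C \<in> Y") auto
  qed
  from this[OF X Y] show ?thesis .
qed

theorem theorem4p2:
  fixes L :: "'a ring" and smL :: "'k::field \<Rightarrow> 'a \<Rightarrow> 'a" and e1 e2 :: 'a
    and L' :: "'b ring" and smL' :: "'k \<Rightarrow> 'b \<Rightarrow> 'b" and e1' e2' :: 'b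
  assumes "kalg L smL" and "fin_dim L smL" and "elementary2 L smL" and "cpoi L e1 e2"
    and "\<forall>x\<in>carrier L. e2 \<otimes>\<^bsub>L\<^esub> x \<otimes>\<^bsub>L\<^esub> e1 = \<zero>\<^bsub>L\<^esub>"
    and "kalg L' smL'" and "fin_dim L' smL'" and "elementary2 L' smL'" and "cpoi L' e1' e2'"
    and "\<forall>x\<in>carrier L'. e1' \<otimes>\<^bsub>L'\<^esub> x \<otimes>\<^bsub>L'\<^esub> e2' = \<zero>\<^bsub>L'\<^esub>"
  shows "\<exists>(G :: (nat \<Rightarrow> 'k) ring) (smG :: 'k \<Rightarrow> (nat \<Rightarrow> 'k) \<Rightarrow> (nat \<Rightarrow> 'k)) f1 f2. kalg G smG \<and> fin_dim G smG \<and> elementary2 G smG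
           \<and> cpoi G f1 f2 \<and> gfan G f1 f2 = fan_star (gfan L e1 e2) (gfan L' e1' e2')"
proof -
  obtain \<chi> :: "nat \<Rightarrow> 'a \<Rightarrow> 'k" where \<chi>: "elem2 L e1 e2 \<chi>" "\<forall>i c. \<forall>x\<in>carrier L. \<chi> i (smL c x) = c * \<chi> i x"
    using elem2_of_elementary2[OF assms(1,3,4)] by blast
  obtain \<xi> :: "nat \<Rightarrow> 'b \<Rightarrow> 'k" where \<xi>: "elem2 L' e1' e2' \<xi>" "\<forall>i c. \<forall>x\<in>carrier L'. \<xi> i (smL' c x) = c * \<xi> i x"
    using elem2_of_elementary2[OF assms(6,8,9)] by blast
  interpret L: kelem2 L e1 e2 \<chi> smL
    by (intro kelem2.intro \<chi>(1) kelem2_axioms.intro) (use \<chi>(2) assms(1,4) in \<open>simp_all add: cpoi_def\<close>)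
  interpret L': kelem2 L' e1' e2' \<xi> smL'
    by (intro kelem2.intro \<xi>(1) kelem2_axioms.intro) (use \<xi>(2) assms(6,9) in \<open>simp_all add: cpoi_def\<close>)
  obtain \<iota> :: "'a \<Rightarrow> nat \<Rightarrow> 'k" and \<iota>' :: "'b \<Rightarrow> nat \<Rightarrow> 'k" where "inj_on \<iota> (carrier L)" "inj_on \<iota>' (carrier L')"
    using L.fin_dim_inj[OF assms(2)] L'.fin_dim_inj[OF assms(7)] by blast
  note inj = inj_on_interleave[OF this]
  interpret Gl: glue L e1 e2 \<chi> smL L' e1' e2' \<xi> smL'
    "\<lambda>(x, y) n. if even n then \<iota> x (n div 2) else \<iota>' y (n div 2)"
    by unfold_locales (rule inj)
  interpret G: kelem2 Gl.G Gl.f1 Gl.f2 Gl.\<chi>G Gl.smG by (rule Gl.kelem2_G)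
  define P N :: "(real \<times> real) set set" where
    defs: "P = gcone ` Pow {(1, 0), (0, 1)}" "N = gcone ` Pow {(-1, 0), (0, -1)}"
  note parts = L.fan_part_pp L.fan_part_mm L'.fan_part_pp L'.fan_part_mm G.fan_part_pp G.fan_part_mm
  note triv = parts[folded defs]
  \<comment> \<open>e2 L e1 = 0 says that there are no nonzero maps from P_1 to P_2, so this
    quadrant contributes \<open>sigma_mp\<close> and its faces; the fact \<open>L12'\<close> is the
    mirror image with \<open>sigma_pm\<close>.\<close>
  have L21: "fan_part L e1 e2 {2} {1} = gcone ` Pow {(0, 1), (-1, 0)}"
    using L.fan_part_trivial[of "{2}" "{1}"] assms(5) by (simp add: ev_def svec_def insert_commute)
  have L12': "fan_part L' e1' e2' {1} {2} = gcone ` Pow {(1, 0), (0, -1)}"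
    using L'.fan_part_trivial[of "{1}" "{2}"] assms(10) by (simp add: ev_def svec_def insert_commute)
  have "gfan Gl.G Gl.f1 Gl.f2 = fan_part L e1 e2 {1} {2} \<union> fan_part L' e1' e2' {2} {1} \<union> P \<union> N"
    unfolding G.gfan_eq_parts triv
    using Gl.fan_part_12 Gl.fan_part_21 assms(5,10) by simp
  also have "\<dots> = fan_star (gfan L e1 e2) (gfan L' e1' e2')"
    unfolding L.gfan_eq_parts L'.gfan_eq_parts triv L21 L12'
    by (rule fan_star_eq[OF sigma_mp_notin_12 sigma_pm_notin_21 defs, symmetric])
  finally show ?thesis
    using G.alg Gl.fin_dim_G[OF assms(2,7)] G.elementary G.cpoi by blast
qed

end
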